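(* For the stable retrial queue with two input streams and two orbits described in the context, as $m\to\infty$ the boundary probabilities $\pi_{m,0}(1)$ have the following three types of tail asymptotics. Type 1 (exact geometric decay): under Condition 1, $$\pi_{m,0}(1)\sim C_{1,0}\left(\frac1{x_+}\right)^{m-1}.$$ Type 2 (geometric decay with prefactor $m^{-1/2}$): under Condition 2, $$\pi_{m,0}(1)\sim \frac{C_{2,0}}{\sqrt{\pi}}\,m^{-1/2}\left(\frac1{x_{dom}}\right)^{m-1}.$$ Type 3 (geometric decay with prefactor $m^{-3/2}$): under Condition 3, $$\pi_{m,0}(1)\sim \frac{C_{3,0}}{\sqrt{\pi}}\,m^{-3/2}\left(\frac1{x_3}\right)^{m-2}.$$ Here Conditions 1, 2, 3, $x_+$, $x_3$, $x_{dom}$ and the constants $C_{i,0}$ are those defined in the context.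
   Context: Model. $\lambda_1,\lambda_2,\mu,\mu_1,\mu_2>0$, $\lambda=\lambda_1+\lambda_2$, normalized so that $\lambda+\mu+\mu_1+\mu_2=1$. Consider the continuous-time Markov chain on $\{0,1,\dots\}^2\times\{0,1\}$ with states $(m,n,k)$ ($m,n$ = numbers of customers in orbits 1 and 2, $k=0$ idle server, $k=1$ busy server) and transition rates: from $(m,n,0)$ to $(m,n,1)$ at rate $\lambda$, to $(m-1,n,1)$ at rate $\mu_1$ if $m\ge1$, to $(m,n-1,1)$ at rate $\mu_2$ if $n\ge 1$; from $(m,n,1)$ to $(m+1,n,1)$ at rate $\lambda_1$, to $(m,n+1,1)$ at rate $\lambda_2$, to $(m,n,0)$ at rate $\mu$. Write $\alpha=\lambda+\mu_1+\mu_2=1-\mu$, $\hat\lambda_i=\alpha\lambda_i$, $\hat\mu_i=\mu\mu_i$. Standing assumptions: stability, i.e. $\lambda(\lambda_i+\mu_i)<\mu\mu_i$ for $i=1,2$; and $\hat\lambda_1<\hat\mu_1$. $\pi_{m,n}(k)$ denotes the unique stationary distribution. Generating functions: $\pi_1^{(1)}(x)=\sum_{m\ge1}\pi_{m,0}(1)x^{m-1}$, $\pi_2^{(1)}(y)=\sum_{n\ge1}\pi_{0,n}(1)y^{n-1}$; the same symbols denote their analytic continuations. The dominant singularity $x_{dom}$ of $\pi_1^{(1)}$ is its singularity of smallest modulus. Functions: $\hat b(x)=\hat\lambda_1x^2-(\hat\lambda_1+\hat\lambda_2+\hat\mu_1+\hat\mu_2)x+\hat\mu_1$; $b_\pm(x)=\hat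 b(x)\pm 2x\sqrt{\hat\lambda_2\hat\mu_2}$; $\Delta=b_+b_-$. The zeros of $b_+$ are $x_2<x_3$ and those of $b_-$ are $x_1<x_4$ (so $x_1<x_2<x_3<x_4$). $Y_\pm(x)=\frac{-\hat b(x)\pm\sqrt{\Delta(x)}}{2\hat\lambda_2x}$ are the two roots $y$ of the kernel equation $\hat\lambda_2xy^2+\hat b(x)y+\hat\mu_2x=0$; $Y_0(x)$ is the one of smaller modulus and $Y_1(x)$ the other ($Y_0=Y_-,Y_1=Y_+$ if $|Y_-|\le|Y_+|$, and otherwise interchanged). $h_1(x,y)=\lambda_2xy+b_1(x)$ with $b_1(x)=\lambda_1x^2-\big(\lambda+\frac{\hat\mu_1}{\lambda+\mu_1}\big)x+\frac{\hat\mu_1}{\lambda+\mu_1}$; $h_2(x,y)=\lambda_2y^2+\big(\lambda_1x-\lambda-\frac{\hat\mu_2}{\lambda+\mu_2}\big)y+\frac{\hat\mu_2}{\lambda+\mu_2}$; $h_0(x,y)=\lambda_1x+\lambda_2y-\lambda$. $x_+>0>x_-$ are the two zeros of $g(x)=\lambda\lambda_1(\lambda+\mu_1)x^2+\lambda\mu_1(\lambda+\mu_1-\mu)x-\mu\mu_1^2$, and $Y(x_+)=1-\frac{[\lambda_1(\lambda+\mu_1)x_+-\mu\mu_1](x_+-1)}{\lambda_2(\lambda+\mu_1)x_+}$. Condition 1: $\hat\mu_2>\hat\lambda_2$, $x_+\in\big(\frac{\hat\mu_1}{\hat\lambda_1},\min(x_3,\frac{\mu\mu_1}{\lambda_1(\lambda+\mu_1)})\big)$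 and $Y(x_+)<\sqrt{\hat\mu_2/\hat\lambda_2}$. Condition 2: $\hat\mu_2>\hat\lambda_2$ and $x_+=x_3\in\big(\frac{\hat\mu_1}{\hat\lambda_1},\frac{\mu\mu_1}{\lambda_1(\lambda+\mu_1)}\big)$. Condition 3: one of (a) $\hat\mu_2\le\hat\lambda_2$; (b) $\hat\mu_2>\hat\lambda_2$ and $x_+\in(1,\hat\mu_1/\hat\lambda_1]$; (c) $\hat\mu_2>\hat\lambda_2$, $x_+\in\big(\frac{\hat\mu_1}{\hat\lambda_1},\min(x_3,\frac{\mu\mu_1}{\lambda_1(\lambda+\mu_1)})\big)$ and $Y(x_+)\ge\sqrt{\hat\mu_2/\hat\lambda_2}$. (Under Condition 2, $x_{dom}=x_3=x_+$.) Constants: with $N(x,y)=h_2(x,y)\pi_2^{(1)}(y)+h_0(x,y)\pi_{0,0}(1)$, $$C_{1,0}=\frac{(\lambda+\mu_1)\sqrt{\Delta(x_+)}\,N(x_+,Y_0(x_+))}{\hat\mu_2\lambda\lambda_1x_+(x_+-1)(x_+-x_-)},$$ $$C_{2,0}=\frac2{\lambda_1}\cdot\frac{N(x_{dom},Y_0(x_{dom}))}{\sqrt{x_{dom}(x_{dom}-x_1)(x_{dom}-x_2)(x_4-x_{dom})}},$$ $$C_{3,0}=-\frac{q(x_3)}{2x_3}\,\frac{\partial}{\partial y}\left[-\frac{N(x_3,y)}{h_1(x_3,y)}\right]_{y=Y_0(x_3)},\qquad q(x)=-\frac1{2\hat\lambda_2x}\sqrt{\frac{\Delta(x)}{1-x/x_3}}$$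 (with $q(x_3)$ the limiting value at $x_3$). $a_m\sim b_m$ means $a_m/b_m\to1$. *)

theory Defs
  imports "HOL-Analysis.Analysis"
begin

section \<open>The Markov chain\<close>

record retrial_params =
  lam1 :: real
  lam2 :: real
  mu :: real
  mu1 :: real
  mu2 :: real

definition lam :: "retrial_params \<Rightarrow> real" where
  "lam P = lam1 P + lam2 P"

text \<open>The server states \<open>Idle\<close> and \<open>Busy\<close> are written \<open>k = 0\<close> and \<open>k = 1\<close> in the
  literature; \<open>p (m, n, Busy)\<close> is thus \<open>\<pi>\<^sub>m\<^sub>,\<^sub>n(1)\<close>.\<close>

datatype server = Idle | Busy

type_synonym state = "nat \<times> nat \<times> server"

text \<open>\<open>rate P s t\<close> is the rate of the transition from \<open>s\<close> to \<open>t\<close>; no state has a transition to itself.\<close>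

fun rate :: "retrial_params \<Rightarrow> state \<Rightarrow> state \<Rightarrow> real" where
  "rate P (m, n, Idle) t =
     (if t = (m, n, Busy) then lam P else 0) +
     (if 1 \<le> m \<and> t = (m - 1, n, Busy) then mu1 P else 0) +
     (if 1 \<le> n \<and> t = (m, n - 1, Busy) then mu2 P else 0)"
| "rate P (m, n, Busy) t =
     (if t = (m + 1, n, Busy) then lam1 P else 0) +
     (if t = (m, n + 1, Busy) then lam2 P else 0) +
     (if t = (m, n, Idle) then mu P else 0)"

text \<open>Global balance (flow into \<open>s\<close> equals flow out of \<open>s\<close>). Both sums have only finitely many
  nonzero terms. The rates are bounded, so these equations characterise stationarity.\<close>

definition stationary_distribution :: "retrial_params \<Rightarrow> (state \<Rightarrow> real) \<Rightarrow> bool" where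
  "stationary_distribution P p \<longleftrightarrow>
     (\<forall>s. 0 \<le> p s) \<and> (p has_sum 1) UNIV \<and>
     (\<forall>s. (\<Sum>\<^sub>\<infinity>t. p t * rate P t s) = p s * (\<Sum>\<^sub>\<infinity>t. rate P s t))"

definition alpha :: "retrial_params \<Rightarrow> real" where
  "alpha P = lam P + mu1 P + mu2 P"

definition lamh1 :: "retrial_params \<Rightarrow> real" where "lamh1 P = alpha P * lam1 P"
definition lamh2 :: "retrial_params \<Rightarrow> real" where "lamh2 P = alpha P * lam2 P"
definition muh1 :: "retrial_params \<Rightarrow> real" where "muh1 P = mu P * mu1 P"
definition muh2 :: "retrial_params \<Rightarrow> real" where "muh2 P = mu P * mu2 P"

section \<open>Analytic continuation of power series\<close>

text \<open>Continuation is taken along rays from the origin (the Mittag-Leffler star), which makes it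
  single-valued: two domains that are star-shaped about 0 have an intersection of the same kind.\<close>

definition star_continuation ::
    "complex fps \<Rightarrow> complex set \<Rightarrow> (complex \<Rightarrow> complex) \<Rightarrow> bool" where
  "star_continuation F S f \<longleftrightarrow>
     open S \<and> 0 \<in> S \<and> (\<forall>z\<in>S. closed_segment 0 z \<subseteq> S) \<and>
     f holomorphic_on S \<and> f has_fps_expansion F"

definition continuable_to :: "complex fps \<Rightarrow> complex \<Rightarrow> bool" where
  "continuable_to F z \<longleftrightarrow> (\<exists>S f. star_continuation F S f \<and> z \<in> S)"

definition continuation :: "complex fps \<Rightarrow> complex \<Rightarrow> complex" where
  "continuation F z = (THE v. \<exists>S f. star_continuation F S f \<and> z \<in> S \<and> v = f z)"

text \<open>A singularity is the first point on its ray to which \<open>F\<close> cannot be continued.\<close>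

definition singularity :: "complex fps \<Rightarrow> complex \<Rightarrow> bool" where
  "singularity F z \<longleftrightarrow>
     \<not> continuable_to F z \<and> (\<forall>t\<in>{0..<1::real}. continuable_to F (of_real t * z))"

definition dominant_singularity :: "complex fps \<Rightarrow> complex" where
  "dominant_singularity F = (ARG_MIN cmod z. singularity F z)"

section \<open>Generating functions of the boundary probabilities\<close>

definition gf1 :: "(state \<Rightarrow> real) \<Rightarrow> complex fps" where
  "gf1 p = Abs_fps (\<lambda>m. of_real (p (m + 1, 0, Busy)))"

definition gf2 :: "(state \<Rightarrow> real) \<Rightarrow> complex fps" where
  "gf2 p = Abs_fps (\<lambda>n. of_real (p (0, n + 1, Busy)))"

text \<open>The coefficients are real, so the continuation is real at real arguments and \<open>Re\<close> only
  changes the type; likewise for the dominant singularity, which lies on the positive real axis.\<close>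

definition pi2 :: "(state \<Rightarrow> real) \<Rightarrow> real \<Rightarrow> real" where
  "pi2 p y = Re (continuation (gf2 p) (of_real y))"

definition xdom :: "(state \<Rightarrow> real) \<Rightarrow> real" where
  "xdom p = Re (dominant_singularity (gf1 p))"

section \<open>The kernel\<close>

definition bhat :: "retrial_params \<Rightarrow> real \<Rightarrow> real" where
  "bhat P x = lamh1 P * x\<^sup>2 - (lamh1 P + lamh2 P + muh1 P + muh2 P) * x + muh1 P"

definition bplus :: "retrial_params \<Rightarrow> real \<Rightarrow> real" where
  "bplus P x = bhat P x + 2 * x * sqrt (lamh2 P * muh2 P)"

definition bminus :: "retrial_params \<Rightarrow> real \<Rightarrow> real" where
  "bminus P x = bhat P x - 2 * x * sqrt (lamh2 P * muh2 P)"

definition Delta :: "retrial_params \<Rightarrow> real \<Rightarrow> real" where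
  "Delta P x = bplus P x * bminus P x"

definition x1 :: "retrial_params \<Rightarrow> real" where "x1 P = Min {x. bminus P x = 0}"
definition x2 :: "retrial_params \<Rightarrow> real" where "x2 P = Min {x. bplus P x = 0}"
definition x3 :: "retrial_params \<Rightarrow> real" where "x3 P = Max {x. bplus P x = 0}"
definition x4 :: "retrial_params \<Rightarrow> real" where "x4 P = Max {x. bminus P x = 0}"

text \<open>The branches are meant for real \<open>x \<noteq> 0\<close> with \<open>Delta P x \<ge> 0\<close>; they are only used at points of
  the interval from \<open>x2 P\<close> to \<open>x3 P\<close>.\<close>

definition Yplus :: "retrial_params \<Rightarrow> real \<Rightarrow> real" where
  "Yplus P x = (- bhat P x + sqrt (Delta P x)) / (2 * lamh2 P * x)"

definition Yminus :: "retrial_params \<Rightarrow> real \<Rightarrow> real" where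
  "Yminus P x = (- bhat P x - sqrt (Delta P x)) / (2 * lamh2 P * x)"

definition Y0 :: "retrial_params \<Rightarrow> real \<Rightarrow> real" where
  "Y0 P x = (if \<bar>Yminus P x\<bar> \<le> \<bar>Yplus P x\<bar> then Yminus P x else Yplus P x)"

definition b1 :: "retrial_params \<Rightarrow> real \<Rightarrow> real" where
  "b1 P x = lam1 P * x\<^sup>2 - (lam P + muh1 P / (lam P + mu1 P)) * x + muh1 P / (lam P + mu1 P)"

definition h1 :: "retrial_params \<Rightarrow> real \<Rightarrow> real \<Rightarrow> real" where
  "h1 P x y = lam2 P * x * y + b1 P x"

definition h2 :: "retrial_params \<Rightarrow> real \<Rightarrow> real \<Rightarrow> real" where
  "h2 P x y = lam2 P * y\<^sup>2 + (lam1 P * x - lam P - muh2 P / (lam P + mu2 P)) * y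
     + muh2 P / (lam P + mu2 P)"

definition h0 :: "retrial_params \<Rightarrow> real \<Rightarrow> real \<Rightarrow> real" where
  "h0 P x y = lam1 P * x + lam2 P * y - lam P"

definition g :: "retrial_params \<Rightarrow> real \<Rightarrow> real" where
  "g P x = lam P * lam1 P * (lam P + mu1 P) * x\<^sup>2
     + lam P * mu1 P * (lam P + mu1 P - mu P) * x - mu P * (mu1 P)\<^sup>2"

definition xplus :: "retrial_params \<Rightarrow> real" where
  "xplus P = (THE x. g P x = 0 \<and> 0 < x)"

definition xminus :: "retrial_params \<Rightarrow> real" where
  "xminus P = (THE x. g P x = 0 \<and> x < 0)"

definition Yxplus :: "retrial_params \<Rightarrow> real" where
  "Yxplus P = 1 - ((lam1 P * (lam P + mu1 P) * xplus P - mu P * mu1 P) * (xplus P - 1))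
     / (lam2 P * (lam P + mu1 P) * xplus P)"

section \<open>The three regimes\<close>

definition condition1 :: "retrial_params \<Rightarrow> bool" where
  "condition1 P \<longleftrightarrow> muh2 P > lamh2 P \<and>
     xplus P \<in> {muh1 P / lamh1 P <..<
                min (x3 P) (mu P * mu1 P / (lam1 P * (lam P + mu1 P)))} \<and>
     Yxplus P < sqrt (muh2 P / lamh2 P)"

definition condition2 :: "retrial_params \<Rightarrow> bool" where
  "condition2 P \<longleftrightarrow> muh2 P > lamh2 P \<and> xplus P = x3 P \<and>
     x3 P \<in> {muh1 P / lamh1 P <..< mu P * mu1 P / (lam1 P * (lam P + mu1 P))}"

definition condition3 :: "retrial_params \<Rightarrow> bool" where
  "condition3 P \<longleftrightarrow>
     muh2 P \<le> lamh2 P \<or>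
     (muh2 P > lamh2 P \<and> xplus P \<in> {1 <.. muh1 P / lamh1 P}) \<or>
     (muh2 P > lamh2 P \<and>
      xplus P \<in> {muh1 P / lamh1 P <..<
                 min (x3 P) (mu P * mu1 P / (lam1 P * (lam P + mu1 P)))} \<and>
      Yxplus P \<ge> sqrt (muh2 P / lamh2 P))"

section \<open>The constants\<close>

definition N :: "retrial_params \<Rightarrow> (state \<Rightarrow> real) \<Rightarrow> real \<Rightarrow> real \<Rightarrow> real" where
  "N P p x y = h2 P x y * pi2 p y + h0 P x y * p (0, 0, Busy)"

definition C1 :: "retrial_params \<Rightarrow> (state \<Rightarrow> real) \<Rightarrow> real" where
  "C1 P p = (lam P + mu1 P) * sqrt (Delta P (xplus P)) * N P p (xplus P) (Y0 P (xplus P))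
     / (muh2 P * lam P * lam1 P * xplus P * (xplus P - 1) * (xplus P - xminus P))"

definition C2 :: "retrial_params \<Rightarrow> (state \<Rightarrow> real) \<Rightarrow> real" where
  "C2 P p = 2 / lam1 P * (N P p (xdom p) (Y0 P (xdom p))
     / sqrt (xdom p * (xdom p - x1 P) * (xdom p - x2 P) * (x4 P - xdom p)))"

definition q :: "retrial_params \<Rightarrow> real \<Rightarrow> real" where
  "q P x = - (1 / (2 * lamh2 P * x)) * sqrt (Delta P x / (1 - x / x3 P))"

text \<open>The formula for \<open>q\<close> is 0/0 at \<open>x3 P\<close>, hence the limit.\<close>

definition C3 :: "retrial_params \<Rightarrow> (state \<Rightarrow> real) \<Rightarrow> real" where
  "C3 P p = - (Lim (at (x3 P)) (q P) / (2 * x3 P))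
     * deriv (\<lambda>y. - (N P p (x3 P) y / h1 P (x3 P) y)) (Y0 P (x3 P))"

end

theory Submission
  imports Defs "HOL-Complex_Analysis.Complex_Analysis"
begin

text \<open>Eliminating the idle states leaves a nearest-neighbour walk on the busy states, whose generating
  function satisfies a kernel equation relating its restrictions \<open>A1(x)\<close> and \<open>A2(y)\<close> to the two axes.
  The cut equations between neighbouring columns bound the radii of convergence from below. Substituting
  the small root \<open>y = Y(x)\<close> of the kernel gives \<open>A1 = M / D\<close>, where \<open>M\<close> and \<open>D\<close> involve only \<open>A2\<close>, and this
  continues \<open>A1\<close> to the plane cut along \<open>[x3, \<infinity>)\<close>. The numerator is positive at every zero of \<open>D\<close>, and the
  only possible zero is \<open>x+\<close>. A zero inside the cut plane is a simple pole; otherwise \<open>A1\<close> is an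
  analytic function of \<open>sqrt (1 - x / x3)\<close> near \<open>x3\<close>, with a pole there if \<open>x+ = x3\<close>. After the leading
  singular terms are subtracted, the remainder has bounded second derivative, which bounds its
  coefficients. The constant of type 3 does not vanish, since otherwise the stationary measure would
  be summable against exponentials beyond the double root of the kernel, which a subharmonic test
  function excludes.\<close>

section \<open>Coefficient asymptotics on the slit plane\<close>

text \<open>Three obstacles shape the argument. On the cut plane the small root satisfies only
  \<open>norm (Y x) < rad\<close>, where \<open>rad\<close> is the value at which both roots
  coincide, so \<open>axis2\<close> must converge strictly beyond \<open>rad\<close>. Cut equations
  give this unless \<open>a2 = l2\<close>, where \<open>rad = 1\<close> and an extra estimate is
  needed. Secondly, the double series is known to converge only for \<open>norm y \<le> 1\<close>,
  while \<open>norm (Y x)\<close> may exceed 1; the relation \<open>A1 * D = M\<close> is therefore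
  proved near one real point and spread by the identity theorem. Thirdly, nothing in its formula
  gives the constant of type 3 a sign; its vanishing would create a double zero in \<open>y\<close>
  that cancels the double root of the kernel at \<open>x3\<close>.

  The zeros of \<open>D\<close> are found by multiplying \<open>D\<close> over both roots of the
  kernel: the product is symmetric in the roots, hence rational in \<open>x\<close>, with numerator
  \<open>(x - 1) * Gq x\<close>, and \<open>Gq\<close> is \<open>g\<close> up to a constant. In the
  coefficient transfer, a bounded second derivative gives a remainder of order
  \<open>n powr (- 2)\<close>, below the smallest leading order \<open>n powr (- 3/2)\<close>; this
  fixes the number of terms to subtract.\<close>

lemma has_fps_expansion_sums:
  fixes f :: "complex \<Rightarrow> complex"
  assumes "0 < R" "\<And>z. norm z < R \<Longrightarrow> (\<lambda>n. a n * z ^ n) sums f z"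
  shows "f has_fps_expansion Abs_fps a"
proof (rule has_fps_expansionI)
  show "\<forall>\<^sub>F u in nhds 0. (\<lambda>n. fps_nth (Abs_fps a) n * u ^ n) sums f u"
    using eventually_nhds_in_open[of "ball 0 R" "0::complex"] assms
    by (auto elim!: eventually_mono)
qed

lemma sums_imp_holomorphic:
  fixes f :: "complex \<Rightarrow> complex"
  assumes "\<And>z. norm z < R \<Longrightarrow> (\<lambda>n. a n * z ^ n) sums f z"
  shows "f holomorphic_on ball 0 R"
  using power_series_holomorphic[of 0 R a f] assms by auto

text \<open>The germ at 0 fixes the coefficients, so holomorphy on a larger disc alone enlarges the
  disc on which the given series is known to sum to \<open>f\<close>.\<close>

lemma sums_extend_ball:
  fixes f :: "complex \<Rightarrow> complex"
  assumes "0 < e" "\<And>z. norm z < e \<Longrightarrow> (\<lambda>n. a n * z ^ n) sums f z"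
    and "f holomorphic_on ball 0 R" and "norm z < R"
  shows "(\<lambda>n. a n * z ^ n) sums f z"
proof -
  have "a n = (deriv ^^ n) f 0 / fact n" for n
    using fps_nth_fps_expansion[OF has_fps_expansion_sums[OF assms(1,2)]] by simp
  with holomorphic_power_series[OF assms(3), of z] assms(4) show ?thesis by simp
qed

text \<open>Cauchy's inequality for the second derivative on circles of radius \<open>r < R\<close>,
  followed by \<open>r\<close> tending to \<open>R\<close>; nothing is assumed about
  \<open>f\<close> on the boundary circle.\<close>

lemma coeff_bound_of_deriv2_bound:
  fixes f :: "complex \<Rightarrow> complex"
  assumes R: "0 < R" and a: "\<And>z. norm z < R \<Longrightarrow> (\<lambda>n. a n * z ^ n) sums f z"
    and M: "\<And>z. norm z < R \<Longrightarrow> norm (deriv (deriv f) z) \<le> M"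
  shows "norm (a (n + 2)) * R ^ n \<le> M / (real (n + 1) * real (n + 2))"
proof -
  have f: "f holomorphic_on ball 0 R"
    using a by (rule sums_imp_holomorphic)
  hence d2: "deriv (deriv f) holomorphic_on ball 0 R"
    by (intro holomorphic_deriv) auto
  have an: "a (n + 2) = (deriv ^^ n) (deriv (deriv f)) 0 / fact (n + 2)"
    using fps_nth_fps_expansion[OF has_fps_expansion_sums[OF R a], of "n + 2"]
    by (simp add: funpow_Suc_right del: funpow.simps)
  have le: "norm (a (n + 2)) * r ^ n \<le> M / (real (n + 1) * real (n + 2))" if r: "0 < r" "r < R" for r
  proof -
    have "norm ((deriv ^^ n) (deriv (deriv f)) 0) \<le> fact n * M / r ^ n"
    proof (rule Cauchy_inequality)
      show "deriv (deriv f) holomorphic_on ball 0 r" "continuous_on (cball 0 r) (deriv (deriv f))"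
        using r by (auto intro!: holomorphic_on_imp_continuous_on holomorphic_on_subset[OF d2])
    qed (use r M in auto)
    hence "norm ((deriv ^^ n) (deriv (deriv f)) 0) * r ^ n / fact n \<le> M"
      using r by (simp add: field_simps)
    hence "norm ((deriv ^^ n) (deriv (deriv f)) 0) * r ^ n / fact n / (real (n + 1) * real (n + 2))
        \<le> M / (real (n + 1) * real (n + 2))"
      by (intro divide_right_mono) auto
    moreover have "norm (fact (n + 2) :: complex) = fact n * (real (n + 1) * real (n + 2))"
      by (simp only: norm_fact) (simp add: algebra_simps)
    ultimately show ?thesis
      unfolding an by (simp add: norm_divide del: of_nat_add of_nat_Suc fact_Suc)
  qed
  have "((\<lambda>r. norm (a (n + 2)) * r ^ n) \<longlongrightarrow> norm (a (n + 2)) * R ^ n) (at_left R)"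
    by (intro tendsto_intros)
  moreover have "\<forall>\<^sub>F r in at_left R. norm (a (n + 2)) * r ^ n \<le> M / (real (n + 1) * real (n + 2))"
    using le R by (intro eventually_at_leftI[of 0]) auto
  ultimately show ?thesis
    by (rule tendsto_upperbound) simp
qed

text \<open>Taylor's formula by repeatedly dividing out a removable singularity. Off the ball
  \<open>K\<close> is merely the algebraic quotient, which is why the identity holds for every
  \<open>w\<close>.\<close>

lemma power_expansion_remainder:
  fixes H :: "complex \<Rightarrow> complex"
  assumes H: "H holomorphic_on ball 0 d"
  shows "\<exists>h K. K holomorphic_on ball 0 d \<and> (\<forall>w. H w = (\<Sum>j<n. h j * w ^ j) + w ^ n * K w)"
proof (induction n)
  case 0
  show ?case using H by (intro exI[of _ H] exI[of _ "\<lambda>_. 0"]) auto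
next
  case (Suc n)
  then obtain h K where K: "K holomorphic_on ball 0 d"
    and eq: "\<And>w. H w = (\<Sum>j<n. h j * w ^ j) + w ^ n * K w" by auto
  define L where "L = (\<lambda>w. if w = 0 then deriv K 0 else (K w - K 0) / w)"
  have "L holomorphic_on ball 0 d"
  proof (rule pole_theorem_open_0[where g = "\<lambda>w. K w - K 0" and a = 0])
    show "(\<lambda>w. K w - K 0) holomorphic_on ball 0 d"
      using K by (intro holomorphic_intros)
    show "L 0 = deriv (\<lambda>w. K w - K 0) 0"
    proof (cases "0 < d")
      case True
      hence "K field_differentiable at 0"
        using K by (auto intro: holomorphic_on_imp_differentiable_at[of _ "ball 0 d"])
      thus ?thesis by (simp add: L_def)
    next
      case False
      show ?thesis
        by (simp add: L_def deriv_def DERIV_def)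
    qed
  qed (auto simp: L_def)
  moreover have "H w = (\<Sum>j<Suc n. (h(n := K 0)) j * w ^ j) + w ^ Suc n * L w" for w
  proof (cases "w = 0")
    case False
    hence "K w = K 0 + w * L w" by (simp add: L_def)
    thus ?thesis by (simp add: eq algebra_simps)
  qed (auto simp: eq)
  ultimately show ?case by blast
qed

text \<open>\<open>(- 1) ^ n * (s gchoose n)\<close> is the Taylor coefficient of
  \<open>(1 - z) powr s\<close>. The reciprocal \<open>rGamma\<close> also covers natural
  \<open>s\<close>, where the limit is 0.\<close>

lemma one_minus_powr_coeff_asymptotic:
  fixes s :: real
  shows "(\<lambda>n. (- 1) ^ n * (s gchoose n) * real n powr (s + 1)) \<longlonglongrightarrow> rGamma (- s)"
proof -
  have "(\<lambda>n. (s gchoose n) / ((- 1) ^ n / exp ((s + 1) * of_real (ln (real n))))) \<longlonglongrightarrow> rGamma (- s)"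
    using gbinomial_asymptotic[of s] by (simp add: rGamma_inverse_Gamma)
  moreover have "\<forall>\<^sub>F n in sequentially. (s gchoose n) / ((- 1) ^ n / exp ((s + 1) * of_real (ln (real n))))
      = (- 1) ^ n * (s gchoose n) * real n powr (s + 1)"
    using eventually_gt_at_top[of 0]
    by eventually_elim (auto simp: powr_def field_simps minus_one_power_iff)
  ultimately show ?thesis
    by (rule Lim_transform_eventually)
qed

section \<open>The slit plane and square roots on it\<close>

definition slit :: "real \<Rightarrow> complex set" where
  "slit R = - complex_of_real ` {R..}"

lemma slit_iff: "z \<in> slit R \<longleftrightarrow> Im z \<noteq> 0 \<or> Re z < R"
  by (auto simp: slit_def complex_eq_iff not_le image_iff)

lemma open_slit: "open (slit R)"
proof -
  have "slit R = {z. Im z < 0} \<union> {z. Im z > 0} \<union> {z. Re z < R}"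
    by (auto simp: slit_iff)
  thus ?thesis
    by (auto intro!: open_Un open_halfspace_Re_lt open_halfspace_Im_lt open_halfspace_Im_gt)
qed

lemma ball_subset_slit: "ball 0 R \<subseteq> slit R"
  by (auto simp: slit_iff) (metis abs_Re_le_cmod abs_ge_self order_le_less_trans order_trans)

lemma closed_segment_slit:
  assumes "z \<in> slit R" "0 < R"
  shows "closed_segment 0 z \<subseteq> slit R"
proof
  fix x assume "x \<in> closed_segment 0 z"
  then obtain u where u: "0 \<le> u" "u \<le> 1" "x = u *\<^sub>R z"
    by (auto simp: closed_segment_def)
  have "u * Re z < R" if "Im z = 0"
  proof -
    have "Re z < R" using assms that by (simp add: slit_iff)
    hence "u * Re z \<le> u * R" using u by (intro mult_left_mono) auto
    also have "\<dots> \<le> R" using u assms by (simp add: mult_left_le_one_le)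
    finally have "u * Re z \<le> R" .
    moreover have "u * Re z \<noteq> R"
    proof
      assume *: "u * Re z = R"
      hence "0 < Re z" using u assms by (smt (verit) mult_nonneg_nonpos)
      hence "u * Re z \<le> Re z" using u by (simp add: mult_left_le_one_le)
      thus False using * \<open>Re z < R\<close> by simp
    qed
    ultimately show ?thesis by simp
  qed
  thus "x \<in> slit R" using u assms(2) by (auto simp: slit_iff)
qed

lemma slit_imp_not_nonpos:
  assumes "z \<in> slit R" "0 < R"
  shows "1 - z / of_real R \<notin> \<real>\<^sub>\<le>\<^sub>0"
proof
  assume "1 - z / of_real R \<in> \<real>\<^sub>\<le>\<^sub>0"
  then obtain t where t: "t \<le> 0" "1 - z / of_real R = of_real t"
    by (auto elim: nonpos_Reals_cases)
  hence "z = of_real (R * (1 - t))"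
    using assms(2) by (simp add: field_simps)
  moreover have "R \<le> R * (1 - t)" using t(1) assms(2) by (simp add: algebra_simps mult_nonneg_nonpos)
  ultimately show False
    using assms(1) by (simp add: slit_iff)
qed

lemma csqrt_powers:
  assumes "w \<noteq> 0"
  shows "csqrt w = w powr (1/2)" "1 / csqrt w = w powr (- 1/2)" "csqrt w ^ 3 = w powr (3/2)"
proof -
  show *: "csqrt w = w powr (1/2)" by (rule csqrt_conv_powr)
  show "1 / csqrt w = w powr (- 1/2)"
    unfolding * by (simp add: powr_minus_divide)
  have "w powr (3/2) = w powr (1/2 + 1/2 + 1/2)" by simp
  thus "csqrt w ^ 3 = w powr (3/2)"
    unfolding * by (simp only: powr_add) (simp add: power3_eq_cube)
qed

lemma sums_one_minus_powr:
  fixes s R :: real and z :: complex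
  assumes "0 < R" "norm z < R"
  shows "(\<lambda>n. of_real ((- 1) ^ n * (s gchoose n) / R ^ n) * z ^ n) sums (1 - z / of_real R) powr of_real s"
proof -
  have "of_real s gchoose n = (of_real (s gchoose n) :: complex)" for n
    by (simp add: gbinomial_prod_rev)
  moreover have "norm (- z / complex_of_real R) < 1"
    using assms by (simp add: norm_divide)
  from gen_binomial_complex[OF this, of "of_real s"]
  have "(\<lambda>n. (of_real s gchoose n) * (- z / of_real R) ^ n) sums (1 - z / of_real R) powr of_real s"
    by simp
  moreover have "(- z / of_real R) ^ n = (- 1) ^ n * z ^ n / of_real R ^ n" for n
    by (metis mult_minus1 power_divide power_mult_distrib)
  ultimately show ?thesis by (simp add: mult_ac)
qed

text \<open>The derivative of \<open>S\<close> is \<open>- 1 / (2 * R * S)\<close>, so each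
  differentiation costs two powers of \<open>S\<close>. The factor \<open>S z ^ 4\<close> is what
  leaves a second derivative free of negative powers.\<close>

lemma deriv2_comp_csqrt:
  fixes K :: "complex \<Rightarrow> complex" and z :: complex and R :: real
  defines "S \<equiv> (\<lambda>z. csqrt (1 - z / of_real R))"
  assumes R: "0 < R" and K: "K holomorphic_on ball 0 d" and z: "z \<in> slit R" "norm (S z) < d"
  shows "deriv (deriv (\<lambda>z. S z ^ 4 * K (S z))) z =
      (8 * K (S z) + 7 * S z * deriv K (S z) + S z ^ 2 * deriv (deriv K) (S z)) / (4 * of_real R ^ 2)"
proof -
  define V where "V = slit R \<inter> S -` ball 0 d"
  have S: "S holomorphic_on slit R"
    unfolding S_def using slit_imp_not_nonpos R by (auto intro!: holomorphic_intros)
  have "open V"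
    unfolding V_def
    by (intro continuous_open_preimage holomorphic_on_imp_continuous_on S open_slit open_ball)
  have zV: "z \<in> V" using z by (auto simp: V_def)
  have S0: "S x \<noteq> 0" if "x \<in> V" for x
    using slit_imp_not_nonpos[of x R] that R by (auto simp: V_def S_def)
  have dS: "(S has_field_derivative (- 1 / (2 * of_real R * S x))) (at x)" if "x \<in> V" for x
    unfolding S_def using that slit_imp_not_nonpos[of x R] R
    by (auto intro!: derivative_eq_intros simp: V_def)
  have dK: "(K has_field_derivative deriv K (S x)) (at (S x))" if "x \<in> V" for x
    using that by (intro holomorphic_derivI[OF K]) (auto simp: V_def)
  have dK2: "(deriv K has_field_derivative deriv (deriv K) (S x)) (at (S x))" if "x \<in> V" for x
    using that K by (intro holomorphic_derivI[of _ "ball 0 d"] holomorphic_deriv) (auto simp: V_def)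
  have dKS: "((\<lambda>x. K (S x)) has_field_derivative deriv K (S x) * (- 1 / (2 * of_real R * S x))) (at x)"
    if "x \<in> V" for x
    using DERIV_chain2[OF dK dS, OF that that] .
  have dKS2: "((\<lambda>x. deriv K (S x)) has_field_derivative
      deriv (deriv K) (S x) * (- 1 / (2 * of_real R * S x))) (at x)" if "x \<in> V" for x
    using DERIV_chain2[OF dK2 dS, OF that that] .
  define D where "D = (\<lambda>x. - (4 * S x ^ 2 * K (S x) + S x ^ 3 * deriv K (S x)) / (2 * of_real R))"
  have 1: "deriv (\<lambda>z. S z ^ 4 * K (S z)) x = D x" if "x \<in> V" for x
  proof (rule DERIV_imp_deriv)
    show "((\<lambda>z. S z ^ 4 * K (S z)) has_field_derivative D x) (at x)"
      by (rule derivative_eq_intros dS dKS refl that)+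
         (use S0[OF that] R in \<open>simp add: D_def field_simps power2_eq_square power3_eq_cube power4_eq_xxxx\<close>)
  qed
  have "deriv (deriv (\<lambda>z. S z ^ 4 * K (S z))) z = deriv D z"
    using 1 \<open>open V\<close> zV by (intro deriv_cong_ev) (auto simp: eventually_nhds)
  also have "\<dots> = (8 * K (S z) + 7 * S z * deriv K (S z) + S z ^ 2 * deriv (deriv K) (S z)) / (4 * of_real R ^ 2)"
    (is "_ = ?rhs")
  proof (rule DERIV_imp_deriv)
    show "(D has_field_derivative ?rhs) (at z)"
      unfolding D_def
      by (rule derivative_eq_intros dS dKS dKS2 refl zV)+
         (use S0[OF zV] R in \<open>simp_all add: field_simps power2_eq_square power3_eq_cube\<close>)
  qed
  finally show ?thesis .
qed

text \<open>Where \<open>norm (S z)\<close> is small, the explicit second derivative is a continuous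
  function of \<open>S z\<close> on a compact disc. The rest of the closed disc is a compact subset
  of the slit plane, because \<open>R\<close> is its only point on the slit.\<close>

lemma sqrt_remainder_deriv2_bounded:
  fixes f K :: "complex \<Rightarrow> complex" and R d :: real
  defines "S \<equiv> (\<lambda>z. csqrt (1 - z / of_real R))"
  assumes R: "0 < R" and d: "0 < d" and f: "f holomorphic_on slit R"
    and K: "K holomorphic_on ball 0 d"
    and eq: "\<And>z. norm z < R \<Longrightarrow> norm (S z) < d \<Longrightarrow> f z = S z ^ 4 * K (S z)"
  shows "\<exists>M. \<forall>z\<in>ball 0 R. norm (deriv (deriv f) z) \<le> M"
proof -
  define D2 where "D2 = (\<lambda>w. (8 * K w + 7 * w * deriv K w + w ^ 2 * deriv (deriv K) w) / (4 * of_real R ^ 2))"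
  have "D2 holomorphic_on ball 0 d"
    unfolding D2_def using K R by (intro holomorphic_intros holomorphic_deriv) auto
  hence "continuous_on (cball 0 (d/2)) D2"
    using d by (auto intro!: holomorphic_on_imp_continuous_on elim!: holomorphic_on_subset)
  hence "bounded (D2 ` cball 0 (d/2))"
    by (intro compact_imp_bounded compact_continuous_image) auto
  then obtain M1 where "\<forall>w\<in>cball 0 (d/2). norm (D2 w) \<le> M1"
    by (auto simp: bounded_iff)
  hence M1: "norm (D2 w) \<le> M1" if "norm w \<le> d/2" for w
    using that by simp
  define C where "C = cball 0 R \<inter> {z. (d/2)\<^sup>2 \<le> norm (1 - z / complex_of_real R)}"
  have nS: "norm (S z) ^ 2 = norm (1 - z / of_real R)" for z
    unfolding S_def by (metis norm_power power2_csqrt)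
  have "compact C"
    unfolding C_def using R
    by (intro compact_Int_closed closed_Collect_le continuous_intros) auto
  have "C \<subseteq> slit R"
  proof
    fix z assume z: "z \<in> C"
    show "z \<in> slit R"
    proof (rule ccontr)
      assume "z \<notin> slit R"
      hence "Im z = 0" "R \<le> Re z" by (auto simp: slit_iff)
      moreover have "\<bar>Re z\<bar> \<le> R" using z abs_Re_le_cmod[of z] by (auto simp: C_def)
      ultimately have "z = of_real R" by (simp add: complex_eq_iff)
      thus False using z d R by (auto simp: C_def)
    qed
  qed
  have d2f: "deriv (deriv f) holomorphic_on slit R"
    using f open_slit by (intro holomorphic_deriv)
  hence "continuous_on C (deriv (deriv f))"
    using \<open>C \<subseteq> slit R\<close> by (auto intro: holomorphic_on_imp_continuous_on holomorphic_on_subset)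
  hence "bounded (deriv (deriv f) ` C)"
    using \<open>compact C\<close> by (intro compact_imp_bounded compact_continuous_image)
  then obtain M2 where M2: "\<And>z. z \<in> C \<Longrightarrow> norm (deriv (deriv f) z) \<le> M2"
    by (auto simp: bounded_iff)
  show ?thesis
  proof (intro exI[of _ "max M1 M2"] ballI)
    fix z :: complex assume z: "z \<in> ball 0 R"
    hence zs: "z \<in> slit R" using ball_subset_slit by blast
    show "norm (deriv (deriv f) z) \<le> max M1 M2"
    proof (cases "norm (S z) \<le> d/2")
      case True
      have "open (ball 0 R \<inter> S -` ball 0 d)"
        unfolding S_def using slit_imp_not_nonpos[OF subsetD[OF ball_subset_slit] R] R
        by (intro continuous_open_preimage holomorphic_on_imp_continuous_on holomorphic_intros) auto
      moreover have "z \<in> ball 0 R \<inter> S -` ball 0 d" using z True d by auto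
      ultimately have "\<forall>\<^sub>F x in nhds z. x \<in> ball 0 R \<inter> S -` ball 0 d"
        by (rule eventually_nhds_in_open)
      hence "\<forall>\<^sub>F x in nhds z. f x = S x ^ 4 * K (S x)"
        by eventually_elim (use eq in auto)
      from higher_deriv_cong_ev[OF this refl, of 2]
      have "deriv (deriv f) z = deriv (deriv (\<lambda>z. S z ^ 4 * K (S z))) z"
        by (simp add: numeral_2_eq_2)
      also have "\<dots> = D2 (S z)"
        unfolding D2_def S_def
        by (rule deriv2_comp_csqrt) (use R K zs True d in \<open>auto simp: S_def\<close>)
      finally show ?thesis using M1[OF True] by simp
    next
      case False
      hence "(d/2)\<^sup>2 \<le> norm (S z) ^ 2" using d by (intro power_mono) auto
      hence "z \<in> C" using z nS by (auto simp: C_def)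
      thus ?thesis using M2 by fastforce
    qed
  qed
qed

section \<open>From the type of singularity to the coefficients\<close>

lemma scaled_coeff_null:
  fixes b :: "nat \<Rightarrow> complex"
  assumes "0 < R" "s < 2"
    and bound: "\<And>n. norm (b (n + 2)) * R ^ n \<le> M / (real (n + 1) * real (n + 2))"
  shows "(\<lambda>n. b n * of_real (R ^ n * real n powr s)) \<longlonglongrightarrow> 0"
proof (rule Lim_null_comparison)
  have "0 \<le> M" using bound[of 0] assms(1) by (auto simp: field_simps intro: order_trans[rotated])
  show "\<forall>\<^sub>F n in sequentially. norm (b n * of_real (R ^ n * real n powr s)) \<le> (2 * M * R ^ 2) * real n powr (s - 2)"
    using eventually_ge_at_top[of 2]
  proof eventually_elim
    case (elim n)
    then obtain m where m: "n = m + 2" by (metis add.commute le_Suc_ex)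
    have "norm (b n) * R ^ n \<le> M / (real (m + 1) * real (m + 2)) * R ^ 2"
      using mult_right_mono[OF bound[of m], of "R ^ 2"] assms(1)
      by (simp add: m power_add mult_ac power2_eq_square)
    also have "\<dots> \<le> (2 * M / (real n)\<^sup>2) * R ^ 2"
    proof (intro mult_right_mono)
      have "2 * M / (2 * (real (m + 1) * real (m + 2))) \<le> 2 * M / (real n)\<^sup>2"
        using \<open>0 \<le> M\<close> by (intro frac_le) (auto simp: m power2_eq_square algebra_simps add_pos_nonneg)
      thus "M / (real (m + 1) * real (m + 2)) \<le> 2 * M / (real n)\<^sup>2"
        by (simp only: mult_divide_mult_cancel_left_if) simp
    qed auto
    finally have "norm (b n) * R ^ n * real n powr s \<le> (2 * M / (real n)\<^sup>2) * R ^ 2 * real n powr s"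
      by (intro mult_right_mono) auto
    also have "\<dots> = (2 * M / (real n)\<^sup>2) * R ^ 2 * (real n powr (s - 2) * real n ^ 2)"
      using elim by (simp add: powr_diff powr_numeral)
    also have "(2 * M / (real n)\<^sup>2) * R ^ 2 * (real n powr (s - 2) * real n ^ 2) = (2 * M * R ^ 2) * real n powr (s - 2)"
      using elim by simp
    finally have "norm (b n) * R ^ n * real n powr s \<le> (2 * M * R ^ 2) * real n powr (s - 2)" .
    thus ?case
      using assms(1) by (simp only: norm_mult norm_of_real abs_mult power_abs) (simp add: mult_ac)
  qed
  have "(\<lambda>n. real n powr (s - 2)) \<longlonglongrightarrow> 0"
    using assms(2) by (intro tendsto_neg_powr filterlim_real_sequentially) auto
  thus "(\<lambda>n. (2 * M * R ^ 2) * real n powr (s - 2)) \<longlonglongrightarrow> 0"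
    by (rule tendsto_mult_right_zero)
qed

lemma rGamma_half: "rGamma (1/2 :: real) = 1 / sqrt pi" "rGamma (- 1/2 :: real) = - 1 / (2 * sqrt pi)"
proof -
  show *: "rGamma (1/2 :: real) = 1 / sqrt pi"
    by (simp add: rGamma_inverse_Gamma Gamma_one_half_real inverse_eq_divide)
  show "rGamma (- 1/2 :: real) = - 1 / (2 * sqrt pi)"
    using rGamma_plus1[of "- 1/2 :: real"] * by simp
qed

text \<open>Expand \<open>G\<close> in \<open>S = csqrt (1 - z / R)\<close> to order three. The odd
  powers of \<open>S\<close> are binomial series with known coefficients, the even ones are
  polynomials in \<open>z\<close>, and what is left is \<open>S ^ 4\<close> times a holomorphic
  function of \<open>S\<close>, to which the second derivative bound applies. The local form at
  \<open>R\<close> is needed only inside the disc.\<close>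

theorem sqrt_singularity_transfer:
  fixes f G :: "complex \<Rightarrow> complex" and a :: "nat \<Rightarrow> complex" and R d e :: real and c :: complex
  assumes R: "0 < R" and d: "0 < d" and e: "0 < e"
    and f: "f holomorphic_on slit R"
    and a: "\<And>z. norm z < e \<Longrightarrow> (\<lambda>n. a n * z ^ n) sums f z"
    and G: "G holomorphic_on ball 0 d"
    and loc: "\<And>z. norm z < R \<Longrightarrow> norm (csqrt (1 - z / of_real R)) < d \<Longrightarrow>
      f z = c / csqrt (1 - z / of_real R) + G (csqrt (1 - z / of_real R))"
  shows "(\<lambda>n. a n * of_real (R ^ n * real n powr (1/2))) \<longlonglongrightarrow> c / of_real (sqrt pi)"
    and "c = 0 \<Longrightarrow> (\<lambda>n. a n * of_real (R ^ n * real n powr (3/2))) \<longlonglongrightarrow>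
           - deriv G 0 / of_real (2 * sqrt pi)"
proof -
  define S where "S = (\<lambda>z. csqrt (1 - z / of_real R))"
  obtain g K where "K holomorphic_on ball 0 d \<and> (\<forall>w. G w = (\<Sum>j<4. g j * w ^ j) + w ^ 4 * K w)"
    using power_expansion_remainder[OF G, of 4] by (elim exE) (rule that)
  hence K: "K holomorphic_on ball 0 d"
    and GK: "\<And>w. G w = (\<Sum>j<4. g j * w ^ j) + w ^ 4 * K w" by auto
  have GK': "G w = g 0 + g 1 * w + g 2 * w ^ 2 + g 3 * w ^ 3 + w ^ 4 * K w" for w
    unfolding GK by (simp add: numeral_eq_Suc)
  have "(G has_field_derivative g 1) (at 0)"
  proof -
    have "(K has_field_derivative deriv K 0) (at 0)"
      using K d by (auto intro!: holomorphic_derivI)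
    hence "((\<lambda>w. g 0 + g 1 * w + g 2 * w ^ 2 + g 3 * w ^ 3 + w ^ 4 * K w) has_field_derivative g 1) (at 0)"
      by (auto intro!: derivative_eq_intros)
    thus ?thesis unfolding GK' .
  qed
  hence dG: "deriv G 0 = g 1" by (rule DERIV_imp_deriv)
  have S0: "S z \<noteq> 0" if "norm z < R" for z
    using slit_imp_not_nonpos[OF subsetD[OF ball_subset_slit] R] that by (auto simp: S_def)
  have holS: "S holomorphic_on slit R"
    unfolding S_def using slit_imp_not_nonpos R by (auto intro!: holomorphic_intros)
  have S0': "S z \<noteq> 0" if "z \<in> slit R" for z
    using slit_imp_not_nonpos[OF that R] by (auto simp: S_def)
  define F where "F = (\<lambda>z. f z - (c * (1 / S z) + g 1 * S z + g 3 * S z ^ 3 + (g 0 + g 2 * (1 - z / of_real R))))"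
  define \<beta> where "\<beta> = (\<lambda>s n. (- 1) ^ n * (s gchoose n) :: real)"
  \<comment> \<open>Coefficients of the polynomial \<open>g 0 + g 2 * (1 - z / R)\<close>, the
    contribution of the even powers; zero from \<open>n = 2\<close> on.\<close>
  define q where "q = (\<lambda>n::nat. if n = 0 then g 0 + g 2 else if n = 1 then - g 2 / of_real R else 0)"
  define b where "b = (\<lambda>n. a n - (c * of_real (\<beta> (- 1/2) n / R ^ n) + g 1 * of_real (\<beta> (1/2) n / R ^ n)
     + g 3 * of_real (\<beta> (3/2) n / R ^ n) + q n))"
  have holF: "F holomorphic_on slit R"
    unfolding F_def using f holS S0' R by (auto intro!: holomorphic_intros)
  have b: "(\<lambda>n. b n * z ^ n) sums F z" if z: "norm z < R" for z
  proof -
    have 1: "(\<lambda>n. a n * z ^ n) sums f z"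
      using sums_extend_ball[OF e a holomorphic_on_subset[OF f ball_subset_slit] z] by simp
    have nz: "1 - z / of_real R \<noteq> 0" using S0[OF z] by (auto simp: S_def)
    have P: "S z = (1 - z / of_real R) powr of_real (1/2)"
        "1 / S z = (1 - z / of_real R) powr of_real (- 1/2)"
        "S z ^ 3 = (1 - z / of_real R) powr of_real (3/2)"
      using csqrt_powers[OF nz] unfolding S_def by simp_all
    have 2: "(\<lambda>n. c * (of_real (\<beta> (- 1/2) n / R ^ n) * z ^ n)) sums (c * (1 / S z))"
      unfolding \<beta>_def P(2) by (rule sums_mult[OF sums_one_minus_powr[OF R z]])
    have 3: "(\<lambda>n. g 1 * (of_real (\<beta> (1/2) n / R ^ n) * z ^ n)) sums (g 1 * S z)"
      unfolding \<beta>_def P(1) by (rule sums_mult[OF sums_one_minus_powr[OF R z]])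
    have 4: "(\<lambda>n. g 3 * (of_real (\<beta> (3/2) n / R ^ n) * z ^ n)) sums (g 3 * S z ^ 3)"
      unfolding \<beta>_def P(3) by (rule sums_mult[OF sums_one_minus_powr[OF R z]])
    have 5: "(\<lambda>n. q n * z ^ n) sums (g 0 + g 2 * (1 - z / of_real R))"
    proof -
      have "(\<lambda>n. q n * z ^ n) sums (\<Sum>n\<in>{0, 1}. q n * z ^ n)"
        by (intro sums_finite) (auto simp: q_def)
      thus ?thesis by (simp add: q_def algebra_simps)
    qed
    show ?thesis
      using sums_diff[OF 1 sums_add[OF sums_add[OF sums_add[OF 2 3] 4] 5]]
      by (simp only: b_def F_def left_diff_distrib distrib_right mult.assoc)
  qed
  have "F z = S z ^ 4 * K (S z)" if "norm z < R" "norm (S z) < d" for z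
    using loc[of z] that by (simp add: F_def S_def GK' power2_csqrt)
  hence "\<exists>M. \<forall>z\<in>ball 0 R. norm (deriv (deriv F) z) \<le> M"
    unfolding S_def by (rule sqrt_remainder_deriv2_bounded[OF R d holF K])
  then obtain M where "\<forall>z\<in>ball 0 R. norm (deriv (deriv F) z) \<le> M" by blast
  hence M: "norm (deriv (deriv F) z) \<le> M" if "norm z < R" for z using that by simp
  note bound = coeff_bound_of_deriv2_bound[OF R b M]
  \<comment> \<open>After scaling by \<open>R ^ n\<close> the remainder is of order
    \<open>n powr (- 2)\<close>, hence negligible against both exponents 1/2 and 3/2.\<close>
  have null: "(\<lambda>n. b n * of_real (R ^ n * real n powr s)) \<longlonglongrightarrow> 0" if "s < 2" for s
    using scaled_coeff_null[OF R that bound] .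
  have lim: "(\<lambda>n. of_real (\<beta> s n * real n powr t) :: complex) \<longlonglongrightarrow> 0" if "t < s + 1" for s t
  proof -
    have "(\<lambda>n. (\<beta> s n * real n powr (s + 1)) * real n powr (t - s - 1)) \<longlonglongrightarrow> rGamma (- s) * 0"
      unfolding \<beta>_def using that
      by (intro tendsto_mult one_minus_powr_coeff_asymptotic tendsto_neg_powr filterlim_real_sequentially) auto
    moreover have "(\<beta> s n * real n powr (s + 1)) * real n powr (t - s - 1) = \<beta> s n * real n powr t" for n
      by (simp add: mult.assoc powr_add [symmetric])
    ultimately have "(\<lambda>n. \<beta> s n * real n powr t) \<longlonglongrightarrow> 0" by simp
    from tendsto_of_real[OF this, where ?'a = complex] show ?thesis by simp
  qed
  have eq: "\<forall>\<^sub>F n in sequentially. b n * of_real (R ^ n * real n powr s) + c * of_real (\<beta> (- 1/2) n * real n powr s)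
        + g 1 * of_real (\<beta> (1/2) n * real n powr s) + g 3 * of_real (\<beta> (3/2) n * real n powr s)
      = a n * of_real (R ^ n * real n powr s)" for s
    using eventually_ge_at_top[of 2]
  proof eventually_elim
    case (elim n)
    hence "q n = 0" by (auto simp: q_def)
    moreover have "of_real (t / R ^ n) * of_real (R ^ n * real n powr s) = (of_real (t * real n powr s) :: complex)" for t
      unfolding of_real_mult [symmetric] using R by simp
    ultimately show ?case
      by (simp only: b_def left_diff_distrib distrib_right mult.assoc) simp
  qed
  have "(\<lambda>n. b n * of_real (R ^ n * real n powr (1/2)) + c * of_real (\<beta> (- 1/2) n * real n powr (1/2))
        + g 1 * of_real (\<beta> (1/2) n * real n powr (1/2)) + g 3 * of_real (\<beta> (3/2) n * real n powr (1/2)))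
       \<longlonglongrightarrow> 0 + c * of_real (rGamma (1/2)) + g 1 * 0 + g 3 * 0"
    using one_minus_powr_coeff_asymptotic[of "- 1/2"]
    by (intro tendsto_add tendsto_mult tendsto_const null lim tendsto_of_real) (auto simp: \<beta>_def)
  hence "(\<lambda>n. a n * of_real (R ^ n * real n powr (1/2))) \<longlonglongrightarrow> 0 + c * of_real (rGamma (1/2)) + g 1 * 0 + g 3 * 0"
    using eq by (rule Lim_transform_eventually)
  thus "(\<lambda>n. a n * of_real (R ^ n * real n powr (1/2))) \<longlonglongrightarrow> c / of_real (sqrt pi)"
    by (simp add: rGamma_half)
  assume "c = 0"
  have "(\<lambda>n. b n * of_real (R ^ n * real n powr (3/2)) + c * of_real (\<beta> (- 1/2) n * real n powr (3/2))
        + g 1 * of_real (\<beta> (1/2) n * real n powr (3/2)) + g 3 * of_real (\<beta> (3/2) n * real n powr (3/2)))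
       \<longlonglongrightarrow> 0 + 0 + g 1 * of_real (rGamma (- 1/2)) + g 3 * 0"
    using one_minus_powr_coeff_asymptotic[of "1/2"]
    by (intro tendsto_add tendsto_mult tendsto_const null lim tendsto_of_real) (auto simp: \<beta>_def \<open>c = 0\<close>)
  hence "(\<lambda>n. a n * of_real (R ^ n * real n powr (3/2))) \<longlonglongrightarrow> 0 + 0 + g 1 * of_real (rGamma (- 1/2)) + g 3 * 0"
    using eq by (rule Lim_transform_eventually)
  thus "(\<lambda>n. a n * of_real (R ^ n * real n powr (3/2))) \<longlonglongrightarrow> - deriv G 0 / of_real (2 * sqrt pi)"
    by (simp add: rGamma_half(2)[simplified] dG)
qed

text \<open>Without its polar part \<open>L / (z - \<rho>)\<close> the function is holomorphic
  beyond \<open>\<rho>\<close>, so its series converges at \<open>\<rho>\<close> and the terms there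
  tend to 0. The polar part has the coefficients \<open>- L / \<rho> ^ Suc n\<close>.\<close>

theorem simple_pole_transfer:
  fixes f :: "complex \<Rightarrow> complex" and a :: "nat \<Rightarrow> complex" and \<rho> R e :: real
  assumes \<rho>: "0 < \<rho>" "\<rho> < R" and e: "0 < e"
    and f: "f holomorphic_on ball 0 R - {of_real \<rho>}"
    and a: "\<And>z. norm z < e \<Longrightarrow> (\<lambda>n. a n * z ^ n) sums f z"
    and L: "((\<lambda>z. (z - of_real \<rho>) * f z) \<longlongrightarrow> L) (at (of_real \<rho>))"
  shows "(\<lambda>n. a n * of_real (\<rho> ^ Suc n)) \<longlonglongrightarrow> - L"
proof -
  define h where "h = (\<lambda>z. f z - L / (z - of_real \<rho>))"
  have "h holomorphic_on ball 0 R - {of_real \<rho>}"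
    unfolding h_def using f by (auto intro!: holomorphic_intros)
  moreover have "((\<lambda>z. (z - of_real \<rho>) * h z) \<longlongrightarrow> 0) (at (of_real \<rho>))"
  proof -
    have "((\<lambda>z. (z - of_real \<rho>) * f z - L) \<longlongrightarrow> L - L) (at (of_real \<rho>))"
      by (intro tendsto_diff L tendsto_const)
    moreover have "\<forall>\<^sub>F z in at (of_real \<rho>). (z - of_real \<rho>) * f z - L = (z - of_real \<rho>) * h z"
    proof -
      have "\<forall>\<^sub>F z in at (complex_of_real \<rho>). z \<noteq> of_real \<rho>" by (simp add: eventually_at_filter)
      thus ?thesis by eventually_elim (simp add: h_def right_diff_distrib)
    qed
    ultimately show ?thesis using Lim_transform_eventually by fastforce
  qed
  moreover have "complex_of_real \<rho> \<in> interior (ball 0 R)" using \<rho> by auto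
  ultimately obtain g where g: "g holomorphic_on ball 0 R"
    and gh: "\<And>z. z \<in> ball 0 R - {of_real \<rho>} \<Longrightarrow> g z = h z"
    using holomorphic_on_extend_lim[of h "ball 0 R" "of_real \<rho>"] by metis
  define b where "b = (\<lambda>n. a n + L / of_real \<rho> ^ Suc n)"
  have *: "(\<lambda>n. b n * z ^ n) sums g z" if z: "norm z < min e \<rho>" for z
  proof -
    have "(\<lambda>n. (z / of_real \<rho>) ^ n) sums (1 / (1 - z / of_real \<rho>))"
      using z \<rho> by (intro geometric_sums) (auto simp: norm_divide)
    from sums_mult[OF this, of "L / of_real \<rho>"]
    have "(\<lambda>n. L / of_real \<rho> ^ Suc n * z ^ n) sums (L / of_real \<rho> * (1 / (1 - z / of_real \<rho>)))"
      by (simp add: power_divide mult_ac)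
    also have "L / of_real \<rho> * (1 / (1 - z / of_real \<rho>)) = - (L / (z - of_real \<rho>))"
      using \<rho> z by (auto simp: divide_simps algebra_simps)
    finally have "(\<lambda>n. b n * z ^ n) sums (f z + - (L / (z - of_real \<rho>)))"
      unfolding b_def distrib_right using a[of z] z by (intro sums_add) auto
    also have "f z + - (L / (z - of_real \<rho>)) = g z"
      using z \<rho> by (subst gh) (auto simp: h_def)
    finally show ?thesis .
  qed
  have "(\<lambda>n. b n * of_real \<rho> ^ n) sums g (of_real \<rho>)"
    by (rule sums_extend_ball[where e = "min e \<rho>", OF _ * g]) (use e \<rho> in auto)
  hence "summable (\<lambda>n. b n * of_real \<rho> ^ n)" by (rule sums_summable)
  hence "(\<lambda>n. b n * of_real \<rho> ^ n) \<longlonglongrightarrow> 0" by (rule summable_LIMSEQ_zero)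
  from tendsto_diff[OF tendsto_mult[OF this tendsto_const[of "of_real \<rho>"]] tendsto_const[of L]]
  have "(\<lambda>n. b n * of_real \<rho> ^ n * of_real \<rho> - L) \<longlonglongrightarrow> - L" by simp
  moreover have "b n * of_real \<rho> ^ n * of_real \<rho> - L = a n * of_real (\<rho> ^ Suc n)" for n
  proof -
    have "b n * of_real \<rho> ^ n * of_real \<rho> = a n * of_real \<rho> ^ Suc n + L / of_real \<rho> ^ Suc n * of_real \<rho> ^ Suc n"
      by (simp add: b_def algebra_simps)
    also have "L / of_real \<rho> ^ Suc n * of_real \<rho> ^ Suc n = L"
      using \<rho> by simp
    finally show ?thesis by simp
  qed
  ultimately show ?thesis by simp
qed

section \<open>Star continuations\<close>

text \<open>The intersection of the two domains is star-shaped about 0, hence connected, so the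
  identity theorem applies from the common germ.\<close>

lemma star_continuation_unique:
  assumes "star_continuation F S f" "star_continuation F S' f'" "z \<in> S" "z \<in> S'"
  shows "f z = f' z"
proof -
  have S: "open (S \<inter> S')" "0 \<in> S \<inter> S'"
    and hol: "f holomorphic_on S \<inter> S'" "f' holomorphic_on S \<inter> S'"
    using assms by (auto simp: star_continuation_def elim: holomorphic_on_subset)
  have conn: "connected (S \<inter> S')"
  proof (rule starlike_imp_connected)
    show "starlike (S \<inter> S')"
      using assms unfolding starlike_def star_continuation_def by (intro bexI[of _ 0]) auto
  qed
  have "\<forall>\<^sub>F x in nhds 0. eval_fps F x = f x" "\<forall>\<^sub>F x in nhds 0. eval_fps F x = f' x"
    using assms by (auto simp: star_continuation_def has_fps_expansion_def)
  hence "\<forall>\<^sub>F x in nhds 0. f x - f' x = 0"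
    by eventually_elim auto
  moreover have "\<forall>\<^sub>F x in nhds 0. x \<in> S \<inter> S'"
    using S by (rule eventually_nhds_in_open)
  ultimately have "\<forall>\<^sub>F x in nhds 0. f x - f' x = 0 \<and> x \<in> S \<inter> S'"
    by eventually_elim auto
  then obtain U where U: "open U" "0 \<in> U" "\<And>x. x \<in> U \<Longrightarrow> f x - f' x = 0 \<and> x \<in> S \<inter> S'"
    by (auto simp: eventually_nhds)
  have "(\<lambda>x. f x - f' x) z = 0"
  proof (rule analytic_continuation[where f = "\<lambda>x. f x - f' x" and S = "S \<inter> S'" and U = U and \<xi> = 0])
    show "0 islimpt U" using U interior_limit_point[of 0 U] by (simp add: interior_open)
  qed (use assms S hol conn U in \<open>auto intro!: holomorphic_intros\<close>)
  thus ?thesis by simp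
qed

lemma continuation_eq:
  assumes "star_continuation F S f" "z \<in> S"
  shows "continuation F z = f z"
  unfolding continuation_def
  using assms star_continuation_unique[of F] by (intro the_equality) blast+

lemma star_continuation_ball:
  assumes "0 < R" "\<And>z. norm z < R \<Longrightarrow> (\<lambda>n. a n * z ^ n) sums f z"
  shows "star_continuation (Abs_fps a) (ball 0 R) f"
  using assms has_fps_expansion_sums[OF assms] sums_imp_holomorphic[OF assms(2)]
    closed_segment_subset[of 0 "ball (0::complex) R"]
  by (auto simp: star_continuation_def)

text \<open>The slit plane is star-shaped, so a function holomorphic there has no singularity off the slit.\<close>

lemma dominant_singularity_eqI:
  assumes R: "0 < R" and sc: "star_continuation F (slit R) f"
    and lim: "filterlim (\<lambda>t. norm (f (of_real t))) at_top (at_left R)"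
  shows "dominant_singularity F = of_real R"
proof -
  have cont: "continuable_to F z" if "z \<in> slit R" for z
    using sc that by (auto simp: continuable_to_def)
  \<comment> \<open>A continuation through \<open>R\<close> would be continuous there and would
    agree with \<open>f\<close> to the left of \<open>R\<close>, where \<open>f\<close> blows
    up.\<close>
  have ncont: "\<not> continuable_to F (of_real R)"
  proof
    assume "continuable_to F (of_real R)"
    then obtain S h where h: "star_continuation F S h" "of_real R \<in> S"
      by (auto simp: continuable_to_def)
    hence "isCont h (of_real R)"
      by (auto simp: star_continuation_def intro: holomorphic_on_imp_continuous_on
          dest!: holomorphic_on_imp_continuous_on continuous_on_interior simp: interior_open)
    moreover have "((\<lambda>t. complex_of_real t) \<longlongrightarrow> of_real R) (at_left R)"
      by (intro tendsto_of_real tendsto_ident_at)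
    ultimately have "((\<lambda>t. norm (h (of_real t))) \<longlongrightarrow> norm (h (of_real R))) (at_left R)"
      by (intro tendsto_norm) (metis isCont_tendsto_compose)
    moreover have "\<forall>\<^sub>F t in at_left R. norm (h (of_real t)) = norm (f (of_real t))"
    proof -
      have "open S" using h by (simp add: star_continuation_def)
      have "\<forall>\<^sub>F t in at_left R. complex_of_real t \<in> S"
        using topological_tendstoD[OF tendsto_of_real[OF tendsto_ident_at] \<open>open S\<close> h(2)] .
      moreover have "\<forall>\<^sub>F t in at_left R. t < R"
        by (simp add: eventually_at_filter)
      ultimately show ?thesis
        by eventually_elim
          (metis Re_complex_of_real h(1) sc slit_iff star_continuation_unique)
    qed
    ultimately have "((\<lambda>t. norm (f (of_real t))) \<longlongrightarrow> norm (h (of_real R))) (at_left R)"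
      by (rule Lim_transform_eventually)
    thus False
      using lim not_tendsto_and_filterlim_at_infinity[of "at_left R" "\<lambda>t. norm (f (of_real t))"]
        filterlim_at_top_imp_at_infinity[OF lim] by (simp add: trivial_limit_at_left_real)
  qed
  have sing: "singularity F (of_real R)"
    unfolding singularity_def using ncont cont R
    by (auto simp: slit_iff simp flip: of_real_mult)
  have less: "R < norm z" if "singularity F z" "z \<noteq> of_real R" for z
  proof -
    have "z \<notin> slit R" using that cont by (auto simp: singularity_def)
    hence "Im z = 0" "R \<le> Re z" by (auto simp: slit_iff)
    moreover from this have "R \<noteq> Re z" using that(2) by (auto simp: complex_eq_iff)
    ultimately show ?thesis using abs_Re_le_cmod[of z] by linarith
  qed
  \<comment> \<open>Every other singular point has strictly larger modulus, so the choice hidden in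
    \<open>ARG_MIN\<close> is forced.\<close>
  have "is_arg_min cmod (singularity F) (dominant_singularity F)"
    unfolding dominant_singularity_def arg_min_def
  proof (rule someI)
    show "is_arg_min cmod (singularity F) (of_real R)"
      using sing less R by (force simp: is_arg_min_def)
  qed
  thus ?thesis
    using sing less[of "dominant_singularity F"] R by (force simp: is_arg_min_def)
qed

section \<open>The walk on the busy states\<close>

lemma has_sum_Suc_shift1:
  fixes J :: "nat \<times> nat \<Rightarrow> 'a::{comm_monoid_add,topological_space}"
  assumes "(J has_sum s) UNIV" "\<And>n. J (0, n) = 0"
  shows "((\<lambda>(m, n). J (Suc m, n)) has_sum s) UNIV"
proof -
  have "(J has_sum s) ((\<lambda>(m, n). (Suc m, n)) ` UNIV)"
    using assms
    by (subst has_sum_cong_neutral[where T = UNIV and g = J]) (auto simp: image_iff, metis not0_implies_Suc)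
  thus ?thesis
    by (subst (asm) has_sum_reindex) (auto simp: inj_on_def o_def case_prod_unfold)
qed

lemma has_sum_Suc_shift2:
  fixes J :: "nat \<times> nat \<Rightarrow> 'a::{comm_monoid_add,topological_space}"
  assumes "(J has_sum s) UNIV" "\<And>m. J (m, 0) = 0"
  shows "((\<lambda>(m, n). J (m, Suc n)) has_sum s) UNIV"
proof -
  have "(J has_sum s) ((\<lambda>(m, n). (m, Suc n)) ` UNIV)"
    using assms
    by (subst has_sum_cong_neutral[where T = UNIV and g = J]) (auto simp: image_iff, metis not0_implies_Suc)
  thus ?thesis
    by (subst (asm) has_sum_reindex) (auto simp: inj_on_def o_def case_prod_unfold)
qed

lemma has_sum_Suc_unshift1:
  fixes J :: "nat \<times> nat \<Rightarrow> 'a::{comm_monoid_add,topological_space}"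
  assumes "((\<lambda>(m, n). J (Suc m, n)) has_sum s) UNIV" "\<And>n. J (0, n) = 0"
  shows "(J has_sum s) UNIV"
proof -
  have "(J has_sum s) ((\<lambda>(m, n). (Suc m, n)) ` UNIV)"
    using assms by (subst has_sum_reindex) (auto simp: inj_on_def o_def case_prod_unfold)
  thus ?thesis
    using assms
    by (subst (asm) has_sum_cong_neutral[where T = UNIV and g = J]) (auto simp: image_iff, metis not0_implies_Suc)
qed

lemma has_sum_Suc_unshift2:
  fixes J :: "nat \<times> nat \<Rightarrow> 'a::{comm_monoid_add,topological_space}"
  assumes "((\<lambda>(m, n). J (m, Suc n)) has_sum s) UNIV" "\<And>m. J (m, 0) = 0"
  shows "(J has_sum s) UNIV"
proof -
  have "(J has_sum s) ((\<lambda>(m, n). (m, Suc n)) ` UNIV)"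
    using assms by (subst has_sum_reindex) (auto simp: inj_on_def o_def case_prod_unfold)
  thus ?thesis
    using assms
    by (subst (asm) has_sum_cong_neutral[where T = UNIV and g = J]) (auto simp: image_iff, metis not0_implies_Suc)
qed

lemma has_sum_column:
  assumes "(u has_sum s) UNIV"
  shows "((\<lambda>(m, n). if m = k then u n else 0) has_sum s) UNIV"
proof -
  have "((\<lambda>(m, n). if m = k then u n else 0) has_sum s) (Pair k ` UNIV)"
    using assms by (subst has_sum_reindex) (auto simp: inj_on_def o_def)
  thus ?thesis
    by (subst (asm) has_sum_cong_neutral[where T = UNIV]) auto
qed

lemma has_sum_row:
  assumes "(u has_sum s) UNIV"
  shows "((\<lambda>(m, n). if n = k then u m else 0) has_sum s) UNIV"
proof -
  have "((\<lambda>(m, n). if n = k then u m else 0) has_sum s) ((\<lambda>m. (m, k)) ` UNIV)"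
    using assms by (subst has_sum_reindex) (auto simp: inj_on_def o_def)
  thus ?thesis
    by (subst (asm) has_sum_cong_neutral[where T = UNIV]) auto
qed

lemma has_sum_neg:
  fixes f :: "'a \<Rightarrow> 'b::topological_ab_group_add"
  shows "(f has_sum a) A \<Longrightarrow> ((\<lambda>x. - f x) has_sum - a) A"
  by (simp add: has_sum_uminus)

text \<open>One function serves both directions: exchanging the two orbits in all arguments turns it
  into the downward rate, so every statement about columns has a mirror image for rows through
  \<open>swap_walk\<close>.\<close>

definition left_rate :: "real \<Rightarrow> real \<Rightarrow> real \<Rightarrow> nat \<Rightarrow> nat \<Rightarrow> real" where
  "left_rate a1 a2 t1 m n = (if m = 0 then 0 else if n = 0 then a1 + a2 * t1 else a1)"

text \<open>Here \<open>w m n\<close> stands for \<open>\<pi>\<^sub>m\<^sub>,\<^sub>n(1)\<close>. On an axis the retrials from the empty orbit are missing, and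
  the fraction \<open>t\<close> of that rate goes to the other orbit.\<close>

locale orbit_walk =
  fixes l1 l2 a1 a2 t1 t2 :: real and w :: "nat \<Rightarrow> nat \<Rightarrow> real"
  assumes rate_pos: "0 < l1" "0 < l2" "0 < a1" "0 < a2"
    and t_bounds: "0 < t1" "t1 < 1" "0 < t2" "t2 < 1"
    and w_pos: "\<And>m n. 0 < w m n"
    and w_summable: "(\<lambda>(m, n). w m n) summable_on UNIV"
    and balance: "\<And>m n. (l1 + l2 + left_rate a1 a2 t1 m n + left_rate a2 a1 t2 n m) * w m n =
       (case m of 0 \<Rightarrow> 0 | Suc i \<Rightarrow> l1 * w i n) + (case n of 0 \<Rightarrow> 0 | Suc j \<Rightarrow> l2 * w m j) +
       left_rate a1 a2 t1 (Suc m) n * w (Suc m) n + left_rate a2 a1 t2 (Suc n) m * w m (Suc n)"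
begin

abbreviation "lft \<equiv> left_rate a1 a2 t1"
abbreviation "dwn m n \<equiv> left_rate a2 a1 t2 n m"

lemma swap_walk: "orbit_walk l2 l1 a2 a1 t2 t1 (\<lambda>m n. w n m)"
proof
  show "(\<lambda>(m, n). w n m) summable_on UNIV"
    using w_summable summable_on_swap[of "\<lambda>(m, n). w m n" UNIV UNIV] by (simp add: case_prod_unfold)
qed (use rate_pos t_bounds w_pos balance in \<open>auto simp: algebra_simps\<close>)

definition "cap = l1 + l2 + (a1 + a2 * t1) + (a2 + a1 * t2)"

lemma lft_bounds: "0 \<le> lft m n" "lft m n \<le> a1 + a2 * t1" "a1 \<le> lft (Suc m) n"
  and dwn_bounds: "0 \<le> dwn m n" "dwn m n \<le> a2 + a1 * t2" "a2 \<le> dwn m (Suc n)"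
  using rate_pos t_bounds by (auto simp: left_rate_def intro!: add_nonneg_nonneg)

lemma cap_pos: "0 < cap"
  using rate_pos t_bounds by (auto simp: cap_def intro!: add_pos_pos)

lemma outflow_le: "(l1 + l2 + lft m n + dwn m n) * w m n \<le> cap * w m n"
  using lft_bounds(2)[of m n] dwn_bounds(2)[of n m] w_pos[of m n]
  by (intro mult_right_mono) (auto simp: cap_def)

lemma inflow_terms:
  "0 \<le> (case m of 0 \<Rightarrow> 0 | Suc i \<Rightarrow> l1 * w i n)" "0 \<le> (case n of 0 \<Rightarrow> 0 | Suc j \<Rightarrow> l2 * w m j)"
  "0 \<le> lft (Suc m) n * w (Suc m) n" "0 \<le> dwn m (Suc n) * w m (Suc n)"
  using rate_pos less_imp_le[OF w_pos] lft_bounds dwn_bounds by (auto split: nat.splits)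

text \<open>By balance the four nonnegative inflows add up to the outflow, so each is at most the
  outflow, and \<open>cap\<close> bounds the outflow rate uniformly. This is a Harnack inequality
  between neighbouring states.\<close>

lemma inflow_le:
  "(case m of 0 \<Rightarrow> 0 | Suc i \<Rightarrow> l1 * w i n) \<le> cap * w m n"
  "(case n of 0 \<Rightarrow> 0 | Suc j \<Rightarrow> l2 * w m j) \<le> cap * w m n"
  "lft (Suc m) n * w (Suc m) n \<le> cap * w m n"
  "dwn m (Suc n) * w m (Suc n) \<le> cap * w m n"
  using balance[of m n] outflow_le[of m n] inflow_terms[of m n] inflow_terms[of n m] by linarith+

text \<open>The generator of the walk acting on test functions. The truncated \<open>m - 1\<close>
  at \<open>m = 0\<close> is harmless because \<open>lft 0 n = 0\<close>; likewise for
  \<open>n\<close>.\<close>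

definition gen :: "(nat \<Rightarrow> nat \<Rightarrow> 'a::real_vector) \<Rightarrow> nat \<Rightarrow> nat \<Rightarrow> 'a" where
  "gen f m n = l1 *\<^sub>R (f (Suc m) n - f m n) + l2 *\<^sub>R (f m (Suc n) - f m n) +
     lft m n *\<^sub>R (f (m - 1) n - f m n) + dwn m n *\<^sub>R (f m (n - 1) - f m n)"

text \<open>Stationarity against unbounded test functions. By \<open>inflow_le\<close>, weighting
  \<open>f\<close> by any single inflow is dominated by \<open>cap\<close> times the weighting by
  \<open>w\<close>, so summability of \<open>w * norm f\<close> alone allows the shifted sums to be
  taken apart and cancelled through \<open>balance\<close>.\<close>

lemma has_sum_gen_eq_0:
  fixes f :: "nat \<Rightarrow> nat \<Rightarrow> 'a::banach"
  assumes f: "(\<lambda>(m, n). w m n * norm (f m n)) summable_on UNIV"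
  shows "((\<lambda>(m, n). w m n *\<^sub>R gen f m n) has_sum 0) UNIV"
proof -
  have summ: "(\<lambda>(m, n). c m n *\<^sub>R f m n) summable_on UNIV"
    if c: "\<And>m n. 0 \<le> c m n \<and> c m n \<le> cap * w m n" for c
  proof (rule abs_summable_summable, rule summable_on_comparison_test)
    show "(\<lambda>(m, n). cap * (w m n * norm (f m n))) summable_on UNIV"
      using summable_on_cmult_right[OF f, of cap] by (simp add: case_prod_unfold)
    fix x :: "nat \<times> nat"
    show "norm (case x of (m, n) \<Rightarrow> c m n *\<^sub>R f m n) \<le> (case x of (m, n) \<Rightarrow> cap * (w m n * norm (f m n)))"
      using c[of "fst x" "snd x"]
        mult_right_mono[of "c (fst x) (snd x)" "cap * w (fst x) (snd x)" "norm (f (fst x) (snd x))"]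
      by (simp add: case_prod_unfold mult.assoc)
  qed auto
  define J1 where "J1 = (\<lambda>m n. case m of 0 \<Rightarrow> 0 | Suc i \<Rightarrow> l1 * w i n)"
  define J2 where "J2 = (\<lambda>m n. case n of 0 \<Rightarrow> 0 | Suc j \<Rightarrow> l2 * w m j)"
  define J3 where "J3 = (\<lambda>m n. lft (Suc m) n * w (Suc m) n)"
  define J4 where "J4 = (\<lambda>m n. dwn m (Suc n) * w m (Suc n))"
  obtain s1 where s1: "((\<lambda>(m, n). J1 m n *\<^sub>R f m n) has_sum s1) UNIV"
    using summ[of J1] inflow_terms inflow_le by (auto simp: J1_def summable_on_def)
  obtain s2 where s2: "((\<lambda>(m, n). J2 m n *\<^sub>R f m n) has_sum s2) UNIV"
    using summ[of J2] inflow_terms inflow_le by (auto simp: J2_def summable_on_def)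
  obtain s3 where s3: "((\<lambda>(m, n). J3 m n *\<^sub>R f m n) has_sum s3) UNIV"
    using summ[of J3] inflow_terms inflow_le by (auto simp: J3_def summable_on_def)
  obtain s4 where s4: "((\<lambda>(m, n). J4 m n *\<^sub>R f m n) has_sum s4) UNIV"
    using summ[of J4] inflow_terms inflow_le by (auto simp: J4_def summable_on_def)
  have i1: "((\<lambda>(m, n). (l1 * w m n) *\<^sub>R f (Suc m) n) has_sum s1) UNIV"
    using has_sum_Suc_shift1[OF s1] by (simp add: J1_def)
  have i2: "((\<lambda>(m, n). (l2 * w m n) *\<^sub>R f m (Suc n)) has_sum s2) UNIV"
    using has_sum_Suc_shift2[OF s2] by (simp add: J2_def)
  have i3: "((\<lambda>(m, n). (lft m n * w m n) *\<^sub>R f (m - 1) n) has_sum s3) UNIV"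
    by (rule has_sum_Suc_unshift1) (use s3 in \<open>auto simp: J3_def left_rate_def\<close>)
  have i4: "((\<lambda>(m, n). (dwn m n * w m n) *\<^sub>R f m (n - 1)) has_sum s4) UNIV"
    by (rule has_sum_Suc_unshift2) (use s4 in \<open>auto simp: J4_def left_rate_def\<close>)
  have eq: "w m n *\<^sub>R gen f m n =
      (l1 * w m n) *\<^sub>R f (Suc m) n + (l2 * w m n) *\<^sub>R f m (Suc n)
      + (lft m n * w m n) *\<^sub>R f (m - 1) n + (dwn m n * w m n) *\<^sub>R f m (n - 1)
      + - (J1 m n *\<^sub>R f m n + J2 m n *\<^sub>R f m n + J3 m n *\<^sub>R f m n + J4 m n *\<^sub>R f m n)" for m n
  proof -
    have "(l1 + l2 + lft m n + dwn m n) * w m n = J1 m n + J2 m n + J3 m n + J4 m n"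
      unfolding J1_def J2_def J3_def J4_def by (rule balance)
    hence "(J1 m n + J2 m n + J3 m n + J4 m n) *\<^sub>R f m n = ((l1 + l2 + lft m n + dwn m n) * w m n) *\<^sub>R f m n"
      by simp
    thus ?thesis
      unfolding gen_def by (simp add: algebra_simps)
  qed
  have "((\<lambda>x. (case x of (m, n) \<Rightarrow> (l1 * w m n) *\<^sub>R f (Suc m) n) + (case x of (m, n) \<Rightarrow> (l2 * w m n) *\<^sub>R f m (Suc n))
      + (case x of (m, n) \<Rightarrow> (lft m n * w m n) *\<^sub>R f (m - 1) n) + (case x of (m, n) \<Rightarrow> (dwn m n * w m n) *\<^sub>R f m (n - 1))
      + - ((case x of (m, n) \<Rightarrow> J1 m n *\<^sub>R f m n) + (case x of (m, n) \<Rightarrow> J2 m n *\<^sub>R f m n)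
        + (case x of (m, n) \<Rightarrow> J3 m n *\<^sub>R f m n) + (case x of (m, n) \<Rightarrow> J4 m n *\<^sub>R f m n)))
      has_sum (s1 + s2 + s3 + s4 + - (s1 + s2 + s3 + s4))) UNIV"
    by (intro has_sum_add has_sum_neg i1 i2 i3 i4 s1 s2 s3 s4)
  thus ?thesis
    by (simp add: case_prod_unfold eq)
qed

section \<open>Cuts between columns and the region of convergence\<close>

definition "col m = (\<Sum>\<^sub>\<infinity>n. w m n)"

lemma col_has_sum: "(w m has_sum col m) UNIV"
  unfolding col_def
  using summable_on_SigmaD1[of w UNIV "\<lambda>_. UNIV" m] w_summable by simp

text \<open>Stationarity tested on the indicator of the columns from \<open>Suc M\<close> on: only
  the flux across the cut survives.\<close>

lemma column_cut: "l1 * col M = a1 * col (Suc M) + a2 * t1 * w (Suc M) 0"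
proof -
  define f :: "nat \<Rightarrow> nat \<Rightarrow> real" where "f = (\<lambda>m n. if Suc M \<le> m then 1 else 0)"
  have "(\<lambda>(m, n). w m n * norm (f m n)) summable_on UNIV"
    using w_summable
  proof (rule summable_on_comparison_test)
  qed (auto simp: f_def less_imp_le[OF w_pos])
  from has_sum_gen_eq_0[OF this]
  have 1: "((\<lambda>(m, n). w m n *\<^sub>R gen f m n) has_sum 0) UNIV" .
  have "((\<lambda>n. if n = 0 then w (Suc M) 0 else 0) has_sum w (Suc M) 0) UNIV"
    by (rule has_sum_finite_neutralI[of "{0}"]) auto
  hence "((\<lambda>n. a1 * w (Suc M) n + a2 * t1 * (if n = 0 then w (Suc M) 0 else 0)) has_sum
      (a1 * col (Suc M) + a2 * t1 * w (Suc M) 0)) UNIV"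
    by (intro has_sum_add has_sum_cmult_right col_has_sum)
  from has_sum_add[OF has_sum_column[OF has_sum_cmult_right[OF col_has_sum, of l1], of M]
      has_sum_neg[OF has_sum_column[OF this, of "Suc M"]]]
  have "((\<lambda>(m, n). w m n *\<^sub>R gen f m n) has_sum
      (l1 * col M + - (a1 * col (Suc M) + a2 * t1 * w (Suc M) 0))) UNIV"
    by (rule has_sum_cong[THEN iffD1, rotated])
       (auto simp: gen_def f_def left_rate_def algebra_simps)
  from has_sum_unique[OF 1 this] show ?thesis by simp
qed

lemma col_pos: "0 < col m"
proof -
  have "w m 0 \<le> col m"
    using has_sum_mono2[OF has_sum_finite[of "{0}" "w m"] col_has_sum] less_imp_le[OF w_pos] by auto
  thus ?thesis using w_pos[of m 0] by linarith
qed

text \<open>Dropping the nonnegative axis term of the cut equation leaves the ratio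
  \<open>l1 / a1\<close>.\<close>

lemma col_geometric: "col m \<le> (l1 / a1) ^ m * col 0"
proof (induction m)
  case (Suc m)
  have "a1 * col (Suc m) \<le> l1 * col m"
    using column_cut[of m] rate_pos t_bounds w_pos[of "Suc m" 0] by simp
  hence "col (Suc m) \<le> l1 / a1 * col m"
    using rate_pos by (simp add: field_simps)
  also have "\<dots> \<le> l1 / a1 * ((l1 / a1) ^ m * col 0)"
    using Suc rate_pos by (intro mult_left_mono) auto
  finally show ?case by simp
qed simp

definition wsum :: "real \<Rightarrow> real \<Rightarrow> bool" where
  "wsum x y \<longleftrightarrow> (\<lambda>(m, n). w m n * x ^ m * y ^ n) summable_on UNIV"

lemma wsum_mono:
  assumes "wsum x y" "0 \<le> x'" "x' \<le> x" "0 \<le> y'" "y' \<le> y"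
  shows "wsum x' y'"
  using assms(1) unfolding wsum_def
proof (rule summable_on_comparison_test)
  fix z :: "nat \<times> nat"
  show "(case z of (m, n) \<Rightarrow> w m n * x' ^ m * y' ^ n) \<le> (case z of (m, n) \<Rightarrow> w m n * x ^ m * y ^ n)"
    using assms less_imp_le[OF w_pos] by (cases z) (auto intro!: mult_mono power_mono mult_nonneg_nonneg)
  show "0 \<le> (case z of (m, n) \<Rightarrow> w m n * x' ^ m * y' ^ n)"
    using assms less_imp_le[OF w_pos] by (cases z) (auto intro!: mult_nonneg_nonneg)
qed

lemma wsum_one:
  assumes "0 \<le> x" "x < a1 / l1"
  shows "wsum x 1"
proof -
  have "(\<lambda>m. col m * x ^ m) summable_on UNIV"
  proof (rule summable_on_comparison_test)
    show "(\<lambda>m. col 0 * (l1 / a1 * x) ^ m) summable_on UNIV"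
      using assms rate_pos
      by (intro summable_on_cmult_right norm_summable_imp_summable_on)
         (simp only: norm_power, intro summable_geometric, auto simp: abs_mult field_simps)
    show "col m * x ^ m \<le> col 0 * (l1 / a1 * x) ^ m" for m
      using mult_right_mono[OF col_geometric, of "x ^ m" m] assms by (simp only: power_mult_distrib) (simp add: mult_ac)
    show "0 \<le> col m * x ^ m" for m using less_imp_le[OF col_pos] assms by simp
  qed
  hence "(\<lambda>(m, n). w m n * x ^ m) summable_on UNIV \<times> UNIV"
    using assms less_imp_le[OF w_pos] has_sum_cmult_left[OF col_has_sum]
    by (intro summable_on_SigmaI[where g = "\<lambda>m. col m * x ^ m"]) auto
  thus ?thesis by (simp add: wsum_def)
qed


section \<open>The kernel and the functional equation\<close>

definition kern :: "'a::real_normed_field \<Rightarrow> 'a \<Rightarrow> 'a" where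
  "kern x y = of_real l1 * (x - 1) + of_real l2 * (y - 1) + of_real a1 * (1 / x - 1) + of_real a2 * (1 / y - 1)"

definition gfun :: "complex \<Rightarrow> complex \<Rightarrow> complex" where
  "gfun x y = (\<Sum>\<^sub>\<infinity>(m, n). of_real (w m n) * x ^ m * y ^ n)"

definition axis1 :: "complex \<Rightarrow> complex" where
  "axis1 x = (\<Sum>m. of_real (w m 0) * x ^ m)"

definition axis2 :: "complex \<Rightarrow> complex" where
  "axis2 y = (\<Sum>n. of_real (w 0 n) * y ^ n)"

lemma wsum_axis1:
  assumes "wsum x y" "0 \<le> x" "0 \<le> y"
  shows "summable (\<lambda>m. w m 0 * x ^ m)"
proof -
  have "(\<lambda>(m, n). w m n * x ^ m * y ^ n) summable_on ((\<lambda>m. (m, 0)) ` UNIV)"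
    using assms(1) unfolding wsum_def by (rule summable_on_subset_banach) auto
  hence "(\<lambda>m. w m 0 * x ^ m) summable_on UNIV"
    by (subst (asm) summable_on_reindex) (auto simp: inj_on_def o_def)
  thus ?thesis by (rule summable_on_imp_summable)
qed

lemma wsum_axis2:
  assumes "wsum x y" "0 \<le> x" "0 \<le> y"
  shows "summable (\<lambda>n. w 0 n * y ^ n)"
proof -
  have "(\<lambda>(m, n). w m n * x ^ m * y ^ n) summable_on (Pair 0 ` UNIV)"
    using assms(1) unfolding wsum_def by (rule summable_on_subset_banach) auto
  hence "(\<lambda>n. w 0 n * y ^ n) summable_on UNIV"
    by (subst (asm) summable_on_reindex) (auto simp: inj_on_def o_def)
  thus ?thesis by (rule summable_on_imp_summable)
qed

lemma axis_has_sum: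
  assumes "summable (\<lambda>n. v n * norm x ^ n)" "\<And>n. 0 \<le> v n"
  shows "((\<lambda>n. complex_of_real (v n) * x ^ n) has_sum (\<Sum>n. of_real (v n) * x ^ n)) UNIV"
proof (rule norm_summable_imp_has_sum)
  show *: "summable (\<lambda>n. norm (complex_of_real (v n) * x ^ n))"
    using assms by (simp add: norm_mult norm_power)
  show "(\<lambda>n. complex_of_real (v n) * x ^ n) sums (\<Sum>n. of_real (v n) * x ^ n)"
    using summable_norm_cancel[OF *] by (rule summable_sums)
qed

text \<open>Off both axes the bracket is \<open>kern x y\<close>: the kernel is the eigenvalue of
  the generator on exponentials in the interior. Multiplied by \<open>x * y\<close> and cleared of
  its constant factor it is the usual quadratic in \<open>y\<close>.\<close>

lemma gen_power:
  fixes x y :: complex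
  assumes "x \<noteq> 0" "y \<noteq> 0"
  shows "gen (\<lambda>m n. x ^ m * y ^ n) m n = x ^ m * y ^ n * (of_real l1 * (x - 1) + of_real l2 * (y - 1)
    + of_real (lft m n) * (1 / x - 1) + of_real (dwn m n) * (1 / y - 1))"
proof -
  have 1: "of_real (lft m n) * (x ^ (m - 1) * y ^ n - x ^ m * y ^ n) = x ^ m * y ^ n * (of_real (lft m n) * (1 / x - 1))"
  proof (cases m)
    case (Suc k)
    thus ?thesis using assms by (simp add: field_simps)
  qed (simp add: left_rate_def)
  have 2: "of_real (dwn m n) * (x ^ m * y ^ (n - 1) - x ^ m * y ^ n) = x ^ m * y ^ n * (of_real (dwn m n) * (1 / y - 1))"
  proof (cases n)
    case (Suc k)
    thus ?thesis using assms by (simp add: field_simps)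
  qed (simp add: left_rate_def)
  have 3: "of_real l1 * (x ^ Suc m * y ^ n - x ^ m * y ^ n) + of_real l2 * (x ^ m * y ^ Suc n - x ^ m * y ^ n)
      = x ^ m * y ^ n * (of_real l1 * (x - 1) + of_real l2 * (y - 1))"
    by (simp add: algebra_simps)
  show ?thesis
    unfolding gen_def scaleR_conv_of_real 3 1 2 by (simp add: distrib_left)
qed

theorem fundamental_equation:
  fixes x y :: complex
  assumes nz: "x \<noteq> 0" "y \<noteq> 0" and ws: "wsum (norm x) (norm y)"
  shows "kern x y * gfun x y + of_real a2 * (of_real t1 * (1 / x - 1) - (1 / y - 1)) * axis1 x
     + of_real a1 * (of_real t2 * (1 / y - 1) - (1 / x - 1)) * axis2 y
     = (of_real (a2 * t1) * (1 / x - 1) + of_real (a1 * t2) * (1 / y - 1)) * of_real (w 0 0)"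
proof -
  define \<xi> \<eta> where "\<xi> = 1 / x - 1" and "\<eta> = 1 / y - 1"
  have S: "(\<lambda>(m, n). w m n * norm (x ^ m * y ^ n)) summable_on UNIV"
    using ws by (simp add: wsum_def norm_mult norm_power mult.assoc case_prod_unfold)
  have z: "((\<lambda>(m, n). w m n *\<^sub>R gen (\<lambda>m n. x ^ m * y ^ n) m n) has_sum 0) UNIV"
    using has_sum_gen_eq_0[OF S] .
  have W: "((\<lambda>(m, n). of_real (w m n) * x ^ m * y ^ n) has_sum gfun x y) UNIV"
    unfolding gfun_def
    by (rule has_sum_infsum, rule abs_summable_summable)
       (use S less_imp_le[OF w_pos] in \<open>simp add: norm_mult norm_power case_prod_unfold mult.assoc\<close>)
  have A: "((\<lambda>m. of_real (w m 0) * x ^ m) has_sum axis1 x) UNIV"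
    unfolding axis1_def using wsum_axis1[OF ws] less_imp_le[OF w_pos] by (intro axis_has_sum) auto
  have B: "((\<lambda>n. of_real (w 0 n) * y ^ n) has_sum axis2 y) UNIV"
    unfolding axis2_def using wsum_axis2[OF ws] less_imp_le[OF w_pos] by (intro axis_has_sum) auto
  \<comment> \<open>The origin lies on both axes, where each axis correction adds a surplus rate
    from the other orbit; this term removes both surpluses at the corner.\<close>
  have O: "((\<lambda>(m, n). if m = 0 \<and> n = 0 then complex_of_real (w 0 0) else 0) has_sum of_real (w 0 0)) UNIV"
    by (rule has_sum_finite_neutralI[of "{(0, 0)}"]) (auto split: if_splits)
  have "((\<lambda>z. kern x y * (case z of (m, n) \<Rightarrow> of_real (w m n) * x ^ m * y ^ n)
      + (of_real (a2 * t1) * \<xi> - of_real a2 * \<eta>) * (case z of (m, n) \<Rightarrow> if n = 0 then of_real (w m 0) * x ^ m else 0)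
      + (of_real (a1 * t2) * \<eta> - of_real a1 * \<xi>) * (case z of (m, n) \<Rightarrow> if m = 0 then of_real (w 0 n) * y ^ n else 0)
      + (- (of_real (a2 * t1) * \<xi> + of_real (a1 * t2) * \<eta>)) * (case z of (m, n) \<Rightarrow> if m = 0 \<and> n = 0 then of_real (w 0 0) else 0))
    has_sum (kern x y * gfun x y + (of_real (a2 * t1) * \<xi> - of_real a2 * \<eta>) * axis1 x
      + (of_real (a1 * t2) * \<eta> - of_real a1 * \<xi>) * axis2 y
      + (- (of_real (a2 * t1) * \<xi> + of_real (a1 * t2) * \<eta>)) * of_real (w 0 0))) UNIV"
    by (intro has_sum_add has_sum_cmult_right W O has_sum_row[OF A] has_sum_column[OF B])
  also have "(\<lambda>z. kern x y * (case z of (m, n) \<Rightarrow> of_real (w m n) * x ^ m * y ^ n)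
      + (of_real (a2 * t1) * \<xi> - of_real a2 * \<eta>) * (case z of (m, n) \<Rightarrow> if n = 0 then of_real (w m 0) * x ^ m else 0)
      + (of_real (a1 * t2) * \<eta> - of_real a1 * \<xi>) * (case z of (m, n) \<Rightarrow> if m = 0 then of_real (w 0 n) * y ^ n else 0)
      + (- (of_real (a2 * t1) * \<xi> + of_real (a1 * t2) * \<eta>)) * (case z of (m, n) \<Rightarrow> if m = 0 \<and> n = 0 then of_real (w 0 0) else 0))
      = (\<lambda>(m, n). w m n *\<^sub>R gen (\<lambda>m n. x ^ m * y ^ n) m n)"
    by (auto simp: fun_eq_iff gen_power[OF nz] scaleR_conv_of_real kern_def left_rate_def algebra_simps
        simp flip: \<xi>_def \<eta>_def)
  finally have "kern x y * gfun x y + (of_real (a2 * t1) * \<xi> - of_real a2 * \<eta>) * axis1 x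
      + (of_real (a1 * t2) * \<eta> - of_real a1 * \<xi>) * axis2 y
      + (- (of_real (a2 * t1) * \<xi> + of_real (a1 * t2) * \<eta>)) * of_real (w 0 0) = 0"
    using z by (rule has_sum_unique)
  thus ?thesis
    unfolding \<xi>_def [symmetric] \<eta>_def [symmetric] by (simp add: algebra_simps)
qed

section \<open>No summability beyond a double root of the kernel\<close>

lemma power_times_linear_bounded:
  fixes r y \<beta> :: real
  assumes "0 < r" "r < y"
  shows "\<exists>B>0. \<forall>n. r ^ n * (real n + \<beta>) \<le> B * y ^ n"
proof -
  have "(\<lambda>n. real n * (r / y) ^ n) \<longlonglongrightarrow> 0"
    using powser_times_n_limit_0[of "r / y"] assms by simp
  moreover have "(\<lambda>n. \<beta> * (r / y) ^ n) \<longlonglongrightarrow> \<beta> * 0"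
    using assms by (intro tendsto_mult LIMSEQ_power_zero tendsto_const) auto
  ultimately have "(\<lambda>n. real n * (r / y) ^ n + \<beta> * (r / y) ^ n) \<longlonglongrightarrow> 0 + \<beta> * 0"
    by (rule tendsto_add)
  hence "Bseq (\<lambda>n. real n * (r / y) ^ n + \<beta> * (r / y) ^ n)"
    by (intro convergent_imp_Bseq) (auto simp: convergent_def)
  then obtain B where B: "0 < B" "\<And>n. norm (real n * (r / y) ^ n + \<beta> * (r / y) ^ n) \<le> B"
    by (auto simp: Bseq_def)
  show ?thesis
  proof (intro exI[of _ B] conjI allI)
    fix n
    have "(r / y) ^ n * (real n + \<beta>) \<le> B"
      using B(2)[of n] by (simp add: algebra_simps abs_le_iff)
    thus "r ^ n * (real n + \<beta>) \<le> B * y ^ n"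
      using assms by (simp add: power_divide field_simps)
  qed fact
qed

text \<open>If \<open>w\<close> were summable against the exponentials below, the positive part of a difference of
  two of them, harmonic respectively superharmonic off the first column, would be a nonconstant
  subharmonic function integrating to zero.\<close>

theorem not_wsum_beyond_double_root:
  fixes x3 r r1 :: real
  assumes pos: "0 < x3" "0 < r" "r < r1" and k0: "kern x3 r = 0" and ky: "l2 * r = a2 / r"
    and kx: "a1 / x3 ^ 2 < l1"
    and h: "l1 * (x3 - 1) + l2 * (r - 1) + (a1 + a2 * t1) * (1 / x3 - 1) < 0"
  shows "\<not> wsum x3 r1"
proof
  assume ws: "wsum x3 r1"
  define hh where "hh = (\<lambda>x y. l1 * (x - 1) + l2 * (y - 1) + (a1 + a2 * t1) * (1 / x - 1))"
  \<comment> \<open>The value for which \<open>f\<close> below is harmonic on the bottom row as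
    well: \<open>\<beta> * hh x3 r + l2 * r = 0\<close>. Its positivity uses
    \<open>hh x3 r < 0\<close>.\<close>
  define \<beta> where "\<beta> = - (l2 * r) / hh x3 r"
  have h': "hh x3 r < 0" using h by (simp add: hh_def)
  have \<beta>: "0 < \<beta>" using h' rate_pos pos by (simp add: \<beta>_def divide_pos_neg)
  have "\<forall>\<^sub>F t in at_right 0. kern (x3 - t) (r + t) < (0::real)"
  proof -
    \<comment> \<open>At the double root the \<open>y\<close>-derivative of the kernel vanishes
      while its \<open>x\<close>-derivative is positive, so moving \<open>x\<close> left and
      \<open>y\<close> right by the same \<open>t\<close> makes the kernel negative to first
      order.\<close>
    have d1: "((\<lambda>t. 1 / (x3 - t)) has_real_derivative 1 / x3 ^ 2) (at 0)"
      using pos by (auto intro!: derivative_eq_intros simp: power2_eq_square)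
    have d2: "((\<lambda>t. 1 / (r + t)) has_real_derivative - (1 / r ^ 2)) (at 0)"
      using pos by (auto intro!: derivative_eq_intros simp: power2_eq_square)
    have "((\<lambda>t. kern (x3 - t) (r + t)) has_real_derivative (- l1 + l2 + a1 / x3 ^ 2 - a2 / r ^ 2)) (at 0)"
      unfolding kern_def by (rule derivative_eq_intros d1 d2 refl)+ simp
    moreover have "a2 / r ^ 2 = l2" using ky pos by (simp add: field_simps power2_eq_square)
    ultimately have "((\<lambda>t. kern (x3 - t) (r + t)) has_real_derivative (a1 / x3 ^ 2 - l1)) (at 0)"
      by simp
    from DERIV_neg_dec_right[OF this] kx obtain d where d: "0 < d"
      "\<And>t. 0 < t \<Longrightarrow> t < d \<Longrightarrow> kern (x3 - (0 + t)) (r + (0 + t)) < kern (x3 - 0) (r + 0)"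
      by auto
    thus ?thesis using k0 by (intro eventually_at_rightI[of 0 d]) auto
  qed
  moreover have "\<forall>\<^sub>F t in at_right 0. hh (x3 - t) (r + t) < 0"
  proof (rule order_tendstoD)
    have "((\<lambda>t. hh (x3 - t) (r + t)) \<longlongrightarrow> hh (x3 - 0) (r + 0)) (at_right 0)"
      unfolding hh_def using pos by (intro tendsto_intros) auto
    thus "((\<lambda>t. hh (x3 - t) (r + t)) \<longlongrightarrow> hh x3 r) (at_right 0)" by simp
  qed fact
  moreover have "\<forall>\<^sub>F t in at_right 0. t < min x3 (r1 - r)"
    using pos by (intro order_tendstoD[OF tendsto_ident_at]) auto
  moreover have "\<forall>\<^sub>F t in at_right 0. (0::real) < t" by (simp add: eventually_at_filter)
  ultimately have "\<forall>\<^sub>F t in at_right 0. kern (x3 - t) (r + t) < 0 \<and> hh (x3 - t) (r + t) < 0 \<and> t < min x3 (r1 - r) \<and> 0 < t"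
    by eventually_elim auto
  from eventually_happens[OF this] obtain t where
    t: "kern (x3 - t) (r + t) < 0" "hh (x3 - t) (r + t) < 0" "t < x3" "t < r1 - r" "0 < t"
    by (auto simp: trivial_limit_at_right_real)
  define x y where "x = x3 - t" and "y = r + t"
  have xy: "0 < x" "x < x3" "r < y" "y < r1" "kern x y < 0" "hh x y < 0"
    using t by (auto simp: x_def y_def)
  \<comment> \<open>\<open>B\<close> is taken so large that the difference below is nonpositive on
    the column \<open>m = 0\<close>, the one column where its generator is not controlled.\<close>
  obtain B where B: "0 < B" "\<And>n. r ^ n * (real n + \<beta>) \<le> B * y ^ n"
    using power_times_linear_bounded[OF pos(2) xy(3)] by blast
  obtain B' where B': "0 < B'" "\<And>n. r ^ n * (real n + \<beta>) \<le> B' * r1 ^ n"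
    using power_times_linear_bounded[OF pos(2,3)] by blast
  \<comment> \<open>Because \<open>r\<close> is a double root, \<open>n * r ^ n\<close> is harmonic
    in the interior along with \<open>r ^ n\<close>; the linear factor is the second solution
    belonging to the double root.\<close>
  define f where "f = (\<lambda>m n. x3 ^ m * (r ^ n * (real n + \<beta>)))"
  define e where "e = (\<lambda>m n. x ^ m * y ^ n)"
  define \<phi> where "\<phi> = (\<lambda>m n. f m n - B * e m n)"
  define F where "F = (\<lambda>m n. max 0 (\<phi> m n))"
  have gen_f: "gen f (Suc i) n = 0" for i n
  proof (cases n)
    case 0
    have "\<beta> * hh x3 r + l2 * r = 0" using h' by (simp add: \<beta>_def)
    moreover have "gen f (Suc i) 0 = x3 ^ Suc i * (\<beta> * hh x3 r + l2 * r)"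
      using pos by (simp add: gen_def f_def hh_def left_rate_def field_simps)
    ultimately show ?thesis using 0 by simp
  next
    case (Suc j)
    have "gen f (Suc i) (Suc j) = x3 ^ Suc i * r ^ Suc j * ((real (Suc j) + \<beta>) * kern x3 r + (l2 * r - a2 / r))"
      using pos by (simp add: gen_def f_def kern_def left_rate_def field_simps)
    thus ?thesis using Suc k0 ky by simp
  qed
  have gen_e: "gen e (Suc i) n \<le> 0" for i n
  proof (cases n)
    case 0
    have "gen e (Suc i) 0 = x ^ Suc i * hh x y"
      using xy by (simp add: gen_def e_def hh_def left_rate_def field_simps)
    thus ?thesis using 0 xy by (simp add: mult_le_0_iff)
  next
    case (Suc j)
    have "gen e (Suc i) (Suc j) = x ^ Suc i * y ^ Suc j * kern x y"
      using xy pos by (simp add: gen_def e_def kern_def left_rate_def field_simps)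
    thus ?thesis using Suc xy pos by (simp add: mult_le_0_iff)
  qed
  have gen_\<phi>: "0 \<le> gen \<phi> (Suc i) n" for i n
  proof -
    have "gen \<phi> (Suc i) n = gen f (Suc i) n - B * gen e (Suc i) n"
      by (simp add: gen_def \<phi>_def algebra_simps)
    thus ?thesis using gen_f gen_e B by (simp add: mult_le_0_iff)
  qed
  have F0: "F 0 n = 0" for n
    using B(2)[of n] by (simp add: F_def \<phi>_def f_def e_def)
  have genF_zero: "gen F m n \<ge> l1 * F (Suc m) n" if "F m n = 0" for m n
    using that rate_pos lft_bounds(1)[of m n] dwn_bounds(1)[of n m]
    by (simp add: gen_def F_def mult_nonneg_nonneg)
  \<comment> \<open>The positive part of a subharmonic function is subharmonic: where
    \<open>F\<close> is 0 its neighbours can only add, and where it equals the difference its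
    neighbours dominate those of the difference.\<close>
  have genF: "0 \<le> gen F m n" for m n
  proof (cases "F m n = 0")
    case True
    have "0 \<le> l1 * F (Suc m) n" using rate_pos by (simp add: F_def)
    thus ?thesis using genF_zero[OF True] by linarith
  next
    case False
    then obtain i where i: "m = Suc i" using F0 by (cases m) auto
    have Fm: "F m n = \<phi> m n" and le: "\<And>m n. \<phi> m n \<le> F m n"
      using False by (auto simp: F_def)
    have "gen \<phi> m n \<le> gen F m n"
      unfolding gen_def Fm using rate_pos lft_bounds(1)[of m n] dwn_bounds(1)[of n m]
      by (auto intro!: add_mono mult_left_mono diff_right_mono le)
    thus ?thesis using gen_\<phi>[of i n] i by simp
  qed
  have "(\<lambda>(m, n). w m n * norm (F m n)) summable_on UNIV"
  proof (rule summable_on_comparison_test)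
    show "(\<lambda>(m, n). B' * (w m n * x3 ^ m * r1 ^ n)) summable_on UNIV"
      using summable_on_cmult_right[OF ws[unfolded wsum_def], of B'] by (simp add: case_prod_unfold)
    fix z :: "nat \<times> nat"
    obtain m n where z: "z = (m, n)" by (cases z)
    have "F m n \<le> f m n"
      using B(1) xy pos \<beta> by (auto simp: F_def \<phi>_def f_def e_def)
    also have "f m n \<le> x3 ^ m * (B' * r1 ^ n)"
      unfolding f_def using B'(2) pos by (intro mult_left_mono) auto
    finally have "w m n * F m n \<le> w m n * (x3 ^ m * (B' * r1 ^ n))"
      using less_imp_le[OF w_pos] by (rule mult_left_mono)
    moreover have "0 \<le> F m n" by (simp add: F_def)
    ultimately show "(case z of (m, n) \<Rightarrow> w m n * norm (F m n)) \<le> (case z of (m, n) \<Rightarrow> B' * (w m n * x3 ^ m * r1 ^ n))"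
      by (simp add: z mult_ac)
  qed (use less_imp_le[OF w_pos] in auto)
  from has_sum_gen_eq_0[OF this]
  have "((\<lambda>(m, n). w m n * gen F m n) has_sum 0) UNIV" by simp
  from nonneg_has_sum_le_0D[OF this] genF less_imp_le[OF w_pos]
  have zero: "gen F m n = 0" for m n
    using w_pos[of m n] by (force simp: mult_nonneg_nonneg)
  \<comment> \<open>Since \<open>gen F\<close> is identically 0, a zero of \<open>F\<close> forces a
    zero at its right neighbour. Along the bottom row this bounds \<open>x3 ^ m\<close> by a
    multiple of \<open>x ^ m\<close> with \<open>x < x3\<close>.\<close>
  have "F m 0 = 0" for m
  proof (induction m)
    case (Suc m)
    have "l1 * F (Suc m) 0 \<le> 0" using genF_zero[OF Suc] zero by simp
    thus ?case using rate_pos by (simp add: F_def mult_le_0_iff max_def split: if_splits)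
  qed (rule F0)
  hence "\<phi> m 0 \<le> 0" for m by (metis F_def max.cobounded2)
  hence "\<beta> * x3 ^ m \<le> B * x ^ m" for m
    by (simp add: \<phi>_def f_def e_def mult.commute)
  hence le: "\<beta> \<le> B * (x / x3) ^ m" for m
    using pos by (simp add: power_divide pos_le_divide_eq)
  have "(\<lambda>m. B * (x / x3) ^ m) \<longlonglongrightarrow> B * 0"
    using xy by (intro tendsto_mult LIMSEQ_power_zero tendsto_const) auto
  hence "\<beta> \<le> B * 0" by (rule LIMSEQ_le_const) (use le in auto)
  thus False using \<beta> by simp
qed

end

section \<open>The inverse Joukowski map\<close>

lemma Re_csqrt_pos: "z \<notin> \<real>\<^sub>\<le>\<^sub>0 \<Longrightarrow> 0 < Re (csqrt z)"
proof -
  assume z: "z \<notin> \<real>\<^sub>\<le>\<^sub>0"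
  have "0 \<le> Re (csqrt z)" using csqrt_principal[of z] by auto
  moreover have "Re (csqrt z) \<noteq> 0"
  proof
    assume "Re (csqrt z) = 0"
    hence "csqrt z ^ 2 = of_real (- (Im (csqrt z) ^ 2))"
      by (simp add: complex_eq_iff power2_eq_square)
    hence "z = of_real (- (Im (csqrt z) ^ 2))" by simp
    thus False using z by (metis neg_le_0_iff_le nonpos_Reals_of_real_iff zero_le_power2)
  qed
  ultimately show ?thesis by simp
qed

text \<open>The root of modulus less than one of \<open>v + 1 / v = 2 * T\<close>, written so that the principal
  branches only require \<open>T - 1\<close> to avoid the nonpositive reals.\<close>

definition jroot :: "complex \<Rightarrow> complex" where
  "jroot T = (csqrt (T + 1) - csqrt (T - 1)) / (csqrt (T + 1) + csqrt (T - 1))"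

lemma jroot_facts:
  assumes "T - 1 \<notin> \<real>\<^sub>\<le>\<^sub>0"
  shows "T + 1 \<notin> \<real>\<^sub>\<le>\<^sub>0" "csqrt (T + 1) + csqrt (T - 1) \<noteq> 0" "norm (jroot T) < 1" "jroot T \<noteq> 0"
    and "jroot T + 1 / jroot T = 2 * T"
proof -
  define a b where "a = csqrt (T - 1)" and "b = csqrt (T + 1)"
  show T1: "T + 1 \<notin> \<real>\<^sub>\<le>\<^sub>0"
  proof
    assume "T + 1 \<in> \<real>\<^sub>\<le>\<^sub>0"
    then obtain t where "t \<le> 0" "T + 1 = of_real t" by (auto elim: nonpos_Reals_cases)
    hence "T - 1 = of_real (t - 2)" "t - 2 \<le> 0" by (auto simp: algebra_simps)
    thus False using assms by (metis nonpos_Reals_of_real_iff)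
  qed
  have pos: "0 < Re a" "0 < Re b"
    unfolding a_def b_def by (rule Re_csqrt_pos, fact)+
  have sq: "a ^ 2 = T - 1" "b ^ 2 = T + 1" by (auto simp: a_def b_def)
  \<comment> \<open>Both squares have imaginary part \<open>Im T\<close> and both roots have
    positive real part, so \<open>Im a\<close> and \<open>Im b\<close> do not have opposite signs.
    The inner product of \<open>a\<close> and \<open>b\<close> is then positive, which makes
    \<open>b - a\<close> shorter than \<open>b + a\<close>.\<close>
  have "Im (a ^ 2) = Im T" "Im (b ^ 2) = Im T" unfolding sq by auto
  hence im: "2 * (Re a * Im a) = Im T" "2 * (Re b * Im b) = Im T"
    by (auto simp: power2_eq_square mult_ac)
  have "(2 * (Re a * Im a)) * (2 * (Re b * Im b)) = Im T * Im T" unfolding im ..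
  hence "(Re a * Re b) * (4 * (Im a * Im b)) = Im T * Im T" by (simp add: algebra_simps)
  hence "0 \<le> (Re a * Re b) * (4 * (Im a * Im b))" by simp
  moreover have "Re a * Re b * (4 * (Im a * Im b)) < 0" if "Im a * Im b < 0"
    using mult_pos_neg[OF mult_pos_pos[OF pos], of "4 * (Im a * Im b)"] that by simp
  ultimately have "0 \<le> Im a * Im b" by fastforce
  hence dot: "0 < Re a * Re b + Im a * Im b" using pos by (simp add: add_pos_nonneg)
  show nz: "csqrt (T + 1) + csqrt (T - 1) \<noteq> 0"
    using pos by (auto simp flip: a_def b_def simp: complex_eq_iff)
  have ne: "b - a \<noteq> 0"
  proof
    assume "b - a = 0"
    hence "a ^ 2 = b ^ 2" by simp
    thus False unfolding sq by (simp add: algebra_simps)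
  qed
  have "norm (b - a) ^ 2 < norm (b + a) ^ 2"
    using dot unfolding cmod_power2 by (simp add: power2_eq_square algebra_simps)
  hence "norm (b - a) < norm (b + a)" by (rule power2_less_imp_less) simp
  thus "norm (jroot T) < 1"
    using nz by (simp add: jroot_def norm_divide divide_less_eq flip: a_def b_def)
  show "jroot T \<noteq> 0"
    using ne nz by (simp add: jroot_def flip: a_def b_def)
  have "q / p + 1 / (q / p) = (q ^ 2 + p ^ 2) / (p * q)" if "p \<noteq> 0" "q \<noteq> 0" for p q :: complex
    using that by (simp add: field_simps power2_eq_square)
  from this[of "b + a" "b - a"] nz ne
  have "jroot T + 1 / jroot T = ((b - a) ^ 2 + (b + a) ^ 2) / ((b + a) * (b - a))"
    unfolding jroot_def a_def b_def by blast
  also have "(b - a) ^ 2 + (b + a) ^ 2 = 2 * (a ^ 2 + b ^ 2)" by (simp add: power2_eq_square algebra_simps)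
  also have "(b + a) * (b - a) = b ^ 2 - a ^ 2" by (simp add: power2_eq_square algebra_simps)
  finally show "jroot T + 1 / jroot T = 2 * T" unfolding sq by simp
qed

lemma holomorphic_jroot:
  assumes "f holomorphic_on S" "\<And>z. z \<in> S \<Longrightarrow> f z - 1 \<notin> \<real>\<^sub>\<le>\<^sub>0"
  shows "(\<lambda>z. jroot (f z)) holomorphic_on S"
  unfolding jroot_def using assms jroot_facts(1,2)[OF assms(2)]
  by (auto intro!: holomorphic_intros)

lemma jroot_of_real:
  assumes "1 < T"
  shows "\<exists>v. jroot (of_real T) = of_real v \<and> 0 < v \<and> v < 1"
proof -
  define v where "v = (sqrt (T + 1) - sqrt (T - 1)) / (sqrt (T + 1) + sqrt (T - 1))"
  have "csqrt (of_real T + 1) = of_real (sqrt (T + 1))" "csqrt (of_real T - 1) = of_real (sqrt (T - 1))"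
    using assms of_real_sqrt[of "T + 1"] of_real_sqrt[of "T - 1"] by auto
  hence jv: "jroot (of_real T) = of_real v"
    by (simp add: jroot_def v_def)
  have *: "sqrt (T - 1) < sqrt (T + 1)" "0 < sqrt (T - 1)" using assms by auto
  moreover from this have "0 < sqrt (T + 1) + sqrt (T - 1)" by linarith
  ultimately have "0 < v" "v < 1"
    unfolding v_def by (auto intro!: divide_pos_pos simp: divide_less_eq)
  with jv show ?thesis by blast
qed

section \<open>Convergence along the second axis\<close>

context orbit_walk begin

lemma wsum_one_one: "wsum 1 1"
  using w_summable by (simp add: wsum_def)

lemma has_sum_gen_rows:
  fixes g :: "nat \<Rightarrow> nat \<Rightarrow> real"
  assumes "(\<lambda>(m, n). w m n * norm (g m n)) summable_on UNIV"
    and "\<And>n. ((\<lambda>m. w m n * gen g m n) has_sum G n) UNIV"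
  shows "G sums 0"
proof -
  have "((\<lambda>(n, m). w m n * gen g m n) has_sum 0) (UNIV \<times> UNIV)"
    using has_sum_gen_eq_0[OF assms(1)] has_sum_swap[where f = "\<lambda>(m, n). w m n * gen g m n" and S = 0 and A = UNIV and B = UNIV]
    by (simp add: case_prod_unfold)
  hence "(G has_sum 0) UNIV"
    by (rule has_sum_SigmaD) (use assms(2) in simp)
  thus ?thesis by (rule has_sum_imp_sums)
qed

text \<open>The hypothesis rearranges to \<open>V (Suc n) \<le> (1 - 1 / c) * V n\<close>; for
  \<open>c < 1\<close> it forces \<open>V\<close> to vanish.\<close>

lemma geometric_tail_decay:
  fixes v V :: "nat \<Rightarrow> real"
  assumes "\<And>n. 0 \<le> V n" "\<And>n. V n \<le> c * (V n - V (Suc n))" "0 < c"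
  shows "V n \<le> V 0 * ((c - 1) / c) ^ n"
proof (induction n)
  case (Suc n)
  have step: "V (Suc n) \<le> (c - 1) / c * V n"
    using assms(2)[of n] assms(3) by (simp add: field_simps)
  show ?case
  proof (cases "1 \<le> c")
    case True
    hence "(c - 1) / c * V n \<le> (c - 1) / c * (V 0 * ((c - 1) / c) ^ n)"
      using Suc assms(3) by (intro mult_left_mono) auto
    with step show ?thesis by (simp add: mult_ac)
  next
    case False
    have "V n = 0" if "0 \<le> V n" for n
    proof -
      have "c * (V n - V (Suc n)) \<le> c * V n" using assms(1,3) by (intro mult_left_mono) auto
      hence "V n \<le> c * V n" using assms(2)[of n] by linarith
      hence "(1 - c) * V n \<le> 0" by (simp add: algebra_simps)
      thus ?thesis using False that by (simp add: mult_le_0_iff)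
    qed
    thus ?thesis using assms(1) by simp
  qed
qed simp

text \<open>When \<open>l2 = a2\<close> the rows do not decay by the cut equation alone. Weighting them by \<open>x ^ m\<close>
  with \<open>x > 1\<close> bounds the mass above a row by a multiple of the mass on it.\<close>

lemma critical_axis2_decay:
  assumes eq: "a2 = l2" and d1: "l1 < a1"
  shows "\<exists>R>1. summable (\<lambda>n. w 0 n * R ^ n)"
proof -
  define x where "x = (1 + a1 / l1) / 2"
  have x: "1 < x" "x < a1 / l1" using d1 rate_pos by (auto simp: x_def field_simps)
  have "wsum x 1" using wsum_one x by simp
  hence ws: "(\<lambda>(m, n). w m n * x ^ m) summable_on UNIV" by (simp add: wsum_def)
  hence ws': "(\<lambda>(n, m). w m n * x ^ m) summable_on (UNIV \<times> UNIV)"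
    using summable_on_swap[of "\<lambda>(m, n). w m n * x ^ m" UNIV UNIV] by simp
  define v where "v = (\<lambda>n. \<Sum>\<^sub>\<infinity>m. w m n * x ^ m)"
  have v: "((\<lambda>m. w m n * x ^ m) has_sum v n) UNIV" for n
    unfolding v_def using summable_on_SigmaD1[OF ws', of n] by simp
  have "v summable_on UNIV"
    using summable_on_SigmaD[OF ws'] v unfolding v_def by (auto simp: summable_on_def)
  hence sv: "summable v" by (rule summable_on_imp_summable)
  have wv: "w 0 n \<le> v n" for n
  proof -
    have "((\<lambda>m. w m n * x ^ m) has_sum (w 0 n)) {0}" using has_sum_finite[of "{0}" "\<lambda>m. w m n * x ^ m"] by simp
    thus ?thesis by (rule has_sum_mono2[OF _ v]) (use x in \<open>auto simp: less_imp_le[OF w_pos]\<close>)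
  qed
  have v0: "0 < v n" for n using wv[of n] w_pos[of 0 n] by linarith
  have sw: "summable (\<lambda>n. w 0 n)"
    using sv by (rule summable_comparison_test') (use wv less_imp_le[OF w_pos] in auto)
  interpret s: orbit_walk l2 l1 a2 a1 t2 t1 "\<lambda>m n. w n m" by (rule swap_walk)
  \<comment> \<open>\<open>e\<close> is the relative rate at which retrials of the first orbit
    diminish the weight \<open>x ^ m\<close>, and \<open>\<eta>\<close> is the net rate of loss once
    arrivals are counted; it is positive exactly because \<open>1 < x < a1 / l1\<close>.\<close>
  define e where "e = a1 * (1 - 1 / x)"
  define \<eta> where "\<eta> = e - l1 * (x - 1)"
  have "\<eta> = (x - 1) * (a1 / x - l1)" using x by (simp add: \<eta>_def e_def field_simps)
  moreover have "l1 < a1 / x" using x rate_pos by (simp add: field_simps)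
  ultimately have \<eta>: "0 < \<eta>" using x by simp
  have main: "\<eta> * (\<Sum>n. v (n + Suc N)) \<le> (l2 + l2 / t2) * v N" for N
  proof -
    define g where "g = (\<lambda>m n. if Suc N \<le> n then x ^ m else (0::real))"
    have sg: "(\<lambda>(m, n). w m n * norm (g m n)) summable_on UNIV"
      using ws by (rule summable_on_comparison_test)
        (use x in \<open>auto simp: g_def less_imp_le[OF w_pos] intro!: mult_nonneg_nonneg\<close>)
    \<comment> \<open>Row sums of \<open>w * gen g\<close>. The second summand corrects the column
      \<open>m = 0\<close>, where the loss \<open>e\<close> is absent and row \<open>Suc N\<close>
      leaks downwards at the additional rate \<open>a1 * t2\<close>.\<close>
    define G where "G = (\<lambda>n. (if n = N then l2 else if n = Suc N then - \<eta> - a2 else if Suc N < n then - \<eta> else 0) * v n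
       + (if n = Suc N then e - a1 * t2 else if Suc N < n then e else 0) * w 0 n)"
    have "G sums 0"
    proof (rule has_sum_gen_rows[OF sg])
      fix n
      have "((\<lambda>m. if m = 0 then w 0 n else 0) has_sum w 0 n) UNIV"
        by (rule has_sum_finite_neutralI[of "{0}"]) auto
      hence "((\<lambda>m. (if n = N then l2 else if n = Suc N then - \<eta> - a2 else if Suc N < n then - \<eta> else 0) * (w m n * x ^ m)
         + (if n = Suc N then e - a1 * t2 else if Suc N < n then e else 0) * (if m = 0 then w 0 n else 0))
         has_sum G n) UNIV"
        unfolding G_def by (intro has_sum_add has_sum_cmult_right v)
      thus "((\<lambda>m. w m n * gen g m n) has_sum G n) UNIV"
      proof (rule has_sum_cong[THEN iffD1, rotated])
        fix m :: nat
        have "x * x ^ (m - 1) = x ^ m" if "m \<noteq> 0"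
          using that by (cases m) auto
        hence xm: "x ^ (m - 1) = x ^ m / x" if "m \<noteq> 0"
          using that x by (simp add: field_simps)
        show "(if n = N then l2 else if n = Suc N then - \<eta> - a2 else if Suc N < n then - \<eta> else 0) * (w m n * x ^ m)
         + (if n = Suc N then e - a1 * t2 else if Suc N < n then e else 0) * (if m = 0 then w 0 n else 0)
         = w m n * gen g m n"
          using xm by (auto simp: gen_def g_def left_rate_def \<eta>_def e_def algebra_simps)
      qed
    qed
    moreover have "(\<lambda>n. if n = N then l2 * v N else 0) sums (l2 * v N)"
      using sums_single[of N "\<lambda>_. l2 * v N"] by simp
    ultimately have "(\<lambda>n. (if n = N then l2 * v N else 0) - G n) sums (l2 * v N - 0)"
      by (rule sums_diff[rotated])
    hence "(\<lambda>n. (if n + Suc N = N then l2 * v N else 0) - G (n + Suc N)) sums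
        (l2 * v N - 0 - (\<Sum>i<Suc N. (if i = N then l2 * v N else 0) - G i))"
      by (rule sums_split_initial_segment)
    hence G': "(\<lambda>n. - G (n + Suc N)) sums (l2 * v N)"
      by (simp add: G_def)
    have A: "(\<lambda>n. \<eta> * v (n + Suc N) - a1 * w 0 (n + Suc N)) sums
        (\<eta> * (\<Sum>n. v (n + Suc N)) - a1 * (\<Sum>n. w 0 (n + Suc N)))"
      by (intro sums_diff sums_mult summable_sums summable_ignore_initial_segment[OF sv] summable_ignore_initial_segment[OF sw])
    have "\<eta> * (\<Sum>n. v (n + Suc N)) - a1 * (\<Sum>n. w 0 (n + Suc N)) \<le> l2 * v N"
    proof (rule sums_le[OF _ A G'])
      fix n
      have "e * w 0 (n + Suc N) \<le> a1 * w 0 (n + Suc N)"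
        unfolding e_def using rate_pos x less_imp_le[OF w_pos] by (intro mult_right_mono) auto
      moreover have "0 \<le> a2 * v (n + Suc N)"
        "0 \<le> a1 * t2 * w 0 (n + Suc N)"
        using rate_pos x t_bounds less_imp_le[OF w_pos] less_imp_le[OF v0] by auto
      ultimately show "\<eta> * v (n + Suc N) - a1 * w 0 (n + Suc N) \<le> - G (n + Suc N)"
        by (cases "n = 0") (simp_all add: G_def algebra_simps)
    qed
    moreover have "a1 * (\<Sum>n. w 0 (n + Suc N)) \<le> l2 / t2 * v N"
    proof -
      \<comment> \<open>With \<open>a2 = l2\<close> the row cuts telescope: the mass on the second
        axis above row \<open>N\<close> is bounded by a multiple of the mass of row
        \<open>N\<close>. This absorbs the correction from the column \<open>m = 0\<close>.\<close>
      have tele: "a1 * t2 * (\<Sum>n<K. w 0 (n + Suc N)) = l2 * (s.col N - s.col (N + K))" for K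
      proof (induction K)
        case (Suc K)
        thus ?case using s.column_cut[of "N + K"] eq by (simp add: algebra_simps)
      qed simp
      have "s.col N \<le> v N"
      proof (rule has_sum_mono[OF s.col_has_sum v])
        fix m show "w m N \<le> w m N * x ^ m"
          using x w_pos[of m N] by (simp add: one_le_power)
      qed
      hence "l2 * s.col N \<le> l2 * v N" using rate_pos by simp
      have "a1 * t2 * (\<Sum>n. w 0 (n + Suc N)) \<le> l2 * v N"
      proof (rule LIMSEQ_le_const2)
        show "(\<lambda>K. a1 * t2 * (\<Sum>n<K. w 0 (n + Suc N))) \<longlonglongrightarrow> a1 * t2 * (\<Sum>n. w 0 (n + Suc N))"
          by (intro tendsto_mult tendsto_const summable_LIMSEQ summable_ignore_initial_segment[OF sw])
        show "\<exists>k. \<forall>K\<ge>k. a1 * t2 * (\<Sum>n<K. w 0 (n + Suc N)) \<le> l2 * v N"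
        proof (intro exI allI impI)
          fix K
          have "0 < l2 * s.col (N + K)" using rate_pos s.col_pos by simp
          thus "a1 * t2 * (\<Sum>n<K. w 0 (n + Suc N)) \<le> l2 * v N"
            unfolding tele right_diff_distrib using \<open>l2 * s.col N \<le> l2 * v N\<close> by linarith
        qed
      qed
      thus ?thesis using t_bounds by (simp add: field_simps)
    qed
    ultimately show ?thesis by (simp add: algebra_simps)
  qed
  define V where "V = (\<lambda>N. \<Sum>n. v (n + N))"
  have VS: "V N = v N + V (Suc N)" for N
    using suminf_split_head[of "\<lambda>n. v (n + N)"] sv by (simp add: V_def summable_iff_shift)
  have V0: "0 \<le> V N" for N
    unfolding V_def using sv less_imp_le[OF v0] by (intro suminf_nonneg) (auto simp: summable_iff_shift)
  define c where "c = 1 + (l2 + l2 / t2) / \<eta>"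
  have c: "1 < c" using rate_pos t_bounds \<eta> by (auto simp: c_def intro!: divide_pos_pos add_pos_pos)
  have "V N \<le> c * (V N - V (Suc N))" for N
    using main[of N] \<eta> VS[of N] by (simp add: V_def c_def field_simps)
  with V0 c have dec: "V N \<le> V 0 * ((c - 1) / c) ^ N" for N
    by (intro geometric_tail_decay) auto
  \<comment> \<open>The midpoint of 1 and the reciprocal of the decay ratio.\<close>
  define R where "R = (1 + c / (c - 1)) / 2"
  have R: "1 < R" "R * ((c - 1) / c) < 1" using c by (auto simp: R_def field_simps)
  have "summable (\<lambda>n. w 0 n * R ^ n)"
  proof (rule summable_comparison_test')
    show "summable (\<lambda>n. V 0 * (R * ((c - 1) / c)) ^ n)"
      using R c by (intro summable_mult summable_geometric) auto
    fix n :: nat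
    have "w 0 n \<le> V n" using wv[of n] VS[of n] V0[of "Suc n"] by linarith
    hence "w 0 n \<le> V 0 * ((c - 1) / c) ^ n" using dec[of n] by linarith
    hence "w 0 n * R ^ n \<le> V 0 * ((c - 1) / c) ^ n * R ^ n" using R by (intro mult_right_mono) auto
    thus "norm (w 0 n * R ^ n) \<le> V 0 * (R * ((c - 1) / c)) ^ n"
      unfolding power_mult_distrib using R less_imp_le[OF w_pos] by (simp add: mult_ac)
  qed
  with R show ?thesis by blast
qed

text \<open>For \<open>a2 < l2\<close> the square root is below 1 and finiteness of the total mass
  suffices. For \<open>a2 > l2\<close> the row cuts give convergence up to \<open>a2 / l2\<close>,
  which exceeds its own square root. Equality needs the critical estimate.\<close>

lemma axis2_radius:
  assumes "l1 < a1"
  shows "\<exists>R>sqrt (a2 / l2). 1 \<le> R \<and> summable (\<lambda>n. w 0 n * R ^ n)"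
proof -
  consider "a2 < l2" | "a2 = l2" | "l2 < a2" by linarith
  thus ?thesis
  proof cases
    case 1
    hence "sqrt (a2 / l2) < 1" using rate_pos by simp
    thus ?thesis using wsum_axis2[OF wsum_one_one] by (intro exI[of _ 1]) auto
  next
    case 2
    thus ?thesis using critical_axis2_decay assms rate_pos by fastforce
  next
    case 3
    define q where "q = a2 / l2"
    have q: "1 < q" using 3 rate_pos by (simp add: q_def)
    hence "sqrt q < q" by (simp add: real_less_lsqrt power2_eq_square)
    then obtain R where R: "sqrt q < R" "R < q" using dense by blast
    have "1 < sqrt q" using q by simp
    interpret s: orbit_walk l2 l1 a2 a1 t2 t1 "\<lambda>m n. w n m" by (rule swap_walk)
    have "s.wsum R 1" using s.wsum_one[of R] R \<open>1 < sqrt q\<close> by (simp add: q_def)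
    from s.wsum_axis1[OF this] R \<open>1 < sqrt q\<close> have "summable (\<lambda>n. w 0 n * R ^ n)" by simp
    moreover have "1 \<le> R" using R \<open>1 < sqrt q\<close> by linarith
    ultimately show ?thesis using R by (auto simp: q_def)
  qed
qed

end

lemma quadratic_factor:
  fixes a b c :: real
  assumes "a \<noteq> 0" "0 \<le> b ^ 2 - 4 * a * c"
  defines "u \<equiv> (- b - sqrt (b ^ 2 - 4 * a * c)) / (2 * a)" and "v \<equiv> (- b + sqrt (b ^ 2 - 4 * a * c)) / (2 * a)"
  shows "a * (u + v) = - b" "a * (u * v) = c"
proof -
  define d where "d = sqrt (b ^ 2 - 4 * a * c)"
  have d: "d ^ 2 = b ^ 2 - 4 * a * c" using assms(2) by (simp add: d_def)
  have uv: "u = (- b - d) / (2 * a)" "v = (- b + d) / (2 * a)" by (simp_all add: u_def v_def d_def)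
  have "u + v = - b / a" unfolding uv by (simp add: add_divide_distrib [symmetric])
  thus "a * (u + v) = - b" using assms(1) by simp
  have "u * v = ((- b - d) * (- b + d)) / (2 * a * (2 * a))" unfolding uv by simp
  also have "(- b - d) * (- b + d) = b ^ 2 - d ^ 2" by (simp add: algebra_simps power2_eq_square)
  also have "\<dots> = 2 * a * (2 * c)" unfolding d by simp
  also have "\<dots> / (2 * a * (2 * a)) = c / a" using assms(1) by simp
  finally show "a * (u * v) = c" using assms(1) by simp
qed

section \<open>The small root of the kernel\<close>

text \<open>\<open>drift1\<close> makes \<open>axis1\<close> converge beyond the unit disc, which
  leaves an annulus in which to start the continuation; \<open>stable\<close> says that
  \<open>Gq\<close> is negative at 1, which places \<open>xp\<close> beyond 1.\<close>

locale stable_orbit_walk = orbit_walk +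
  assumes drift1: "l1 < a1" and stable: "l1 + l2 * t1 < a1 + a2 * t1"
begin

text \<open>The roots \<open>y\<close> of the kernel have product \<open>a2 / l2 = rad ^ 2\<close>
  whatever \<open>x\<close> is, so one of them has modulus at most \<open>rad\<close>. At
  \<open>br2\<close> and \<open>br3\<close>, the branch points \<open>x2\<close> and
  \<open>x3\<close>, both roots equal \<open>rad\<close>; \<open>gm = l2 * rad\<close> normalises
  the equation.\<close>

definition "gm = sqrt (l2 * a2)"
definition "rad = sqrt (a2 / l2)"
definition "mid = l1 + l2 + a1 + a2 - 2 * gm"
definition "br2 = (mid - sqrt (mid ^ 2 - 4 * l1 * a1)) / (2 * l1)"
definition "br3 = (mid + sqrt (mid ^ 2 - 4 * l1 * a1)) / (2 * l1)"

lemma gm_rad: "0 < gm" "0 < rad" "l2 * rad = gm" "a2 / rad = gm" "rad ^ 2 = a2 / l2" "gm ^ 2 = l2 * a2"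
proof -
  show 1: "0 < gm" "0 < rad" using rate_pos by (auto simp: gm_def rad_def)
  show 2: "rad ^ 2 = a2 / l2" "gm ^ 2 = l2 * a2" using rate_pos by (auto simp: gm_def rad_def)
  have "(l2 * rad) ^ 2 = gm ^ 2" unfolding power_mult_distrib 2 using rate_pos by (simp add: power2_eq_square)
  thus 3: "l2 * rad = gm" using 1 rate_pos by (simp add: power2_eq_iff_nonneg)
  have "a2 = l2 * rad * rad" using 2(1) rate_pos by (simp add: field_simps power2_eq_square)
  hence "a2 / rad = l2 * rad" using 1 by (simp add: divide_eq_eq)
  thus "a2 / rad = gm" using 3 by simp
qed

lemma mid_gt: "2 * sqrt (l1 * a1) < mid"
proof -
  have "0 < (sqrt a1 - sqrt l1) ^ 2 + (sqrt l2 - sqrt a2) ^ 2"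
    using drift1 rate_pos by (intro add_pos_nonneg) auto
  also have "\<dots> = mid - 2 * sqrt (l1 * a1)"
    using rate_pos by (simp add: power2_diff mid_def gm_def real_sqrt_mult)
  finally show ?thesis by simp
qed

lemma mid_disc: "0 < mid ^ 2 - 4 * l1 * a1" "0 < mid"
proof -
  have "0 < 2 * sqrt (l1 * a1)" using rate_pos by simp
  thus "0 < mid" using mid_gt by linarith
  have "(2 * sqrt (l1 * a1)) ^ 2 < mid ^ 2"
    using mid_gt \<open>0 < 2 * sqrt (l1 * a1)\<close> by (intro power_strict_mono) auto
  thus "0 < mid ^ 2 - 4 * l1 * a1" using rate_pos by (simp add: power_mult_distrib)
qed

lemma br_vieta: "l1 * (br2 + br3) = mid" "l1 * (br2 * br3) = a1"
  using quadratic_factor[of l1 "- mid" a1] mid_disc rate_pos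
  unfolding br2_def br3_def by simp_all

lemma br_quadratic: "l1 * z ^ 2 - mid * z + a1 = l1 * (z - br2) * (z - br3)"
proof -
  have "l1 * (z - br2) * (z - br3) = l1 * z ^ 2 - (l1 * (br2 + br3)) * z + l1 * (br2 * br3)"
    by (simp add: algebra_simps power2_eq_square)
  thus ?thesis unfolding br_vieta by simp
qed

text \<open>The quadratic with zeros \<open>br2\<close> and \<open>br3\<close> is nonpositive at 1
  and at \<open>a1 / l1\<close>: in both cases it is a positive multiple of
  \<open>- (sqrt l2 - sqrt a2) ^ 2\<close>. Hence both points lie between the zeros.\<close>

lemma br_bounds: "0 < br2" "br2 < br3" "br2 \<le> 1" "1 < a1 / l1" "a1 / l1 \<le> br3" "1 < br3"
proof -
  show lt: "br2 < br3" using mid_disc rate_pos by (simp add: br2_def br3_def divide_strict_right_mono)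
  have between: "br2 \<le> z \<and> z \<le> br3" if "l1 * z ^ 2 - mid * z + a1 \<le> 0" for z
  proof -
    have "(z - br2) * (z - br3) \<le> 0"
      using that rate_pos unfolding br_quadratic by (simp add: mult.assoc mult_le_0_iff)
    thus ?thesis using lt by (auto simp: mult_le_0_iff)
  qed
  have "0 \<le> (sqrt l2 - sqrt a2) ^ 2" by simp
  also have "\<dots> = l2 + a2 - 2 * gm"
    using rate_pos by (simp add: power2_diff gm_def real_sqrt_mult)
  finally have le: "l1 - mid + a1 \<le> 0" by (simp add: mid_def)
  show "br2 \<le> 1" using between[of 1] le by simp
  show gt: "1 < a1 / l1" using drift1 rate_pos by simp
  have "l1 * (a1 / l1) ^ 2 - mid * (a1 / l1) + a1 = (a1 / l1) * (l1 - mid + a1)"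
    using rate_pos by (simp add: field_simps power2_eq_square)
  also have "\<dots> \<le> 0" using le rate_pos by (simp add: mult_le_0_iff divide_le_0_iff)
  finally show ge: "a1 / l1 \<le> br3" using between by blast
  show "1 < br3" using gt ge by simp
  have "0 < l1 * (br2 * br3)" unfolding br_vieta using rate_pos by simp
  hence "0 < br2 * br3" using rate_pos by (simp add: zero_less_mult_iff)
  thus "0 < br2" using \<open>1 < br3\<close> by (simp add: zero_less_mult_iff)
qed

text \<open>With \<open>y = rad * v\<close> the kernel equation becomes
  \<open>v + 1 / v = 2 * Tf x\<close>, so \<open>jroot (Tf x)\<close> gives the root inside the unit
  circle.\<close>

definition Tf :: "complex \<Rightarrow> complex" where
  "Tf x = (of_real (l1 + l2 + a1 + a2) - of_real l1 * x - of_real a1 / x) / of_real (2 * gm)"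

lemma Tf_minus_one:
  assumes "x \<noteq> 0"
  shows "Tf x - 1 = of_real l1 * (x - of_real br2) * (of_real br3 - x) / (2 * of_real gm * x)"
proof -
  have "of_real l1 * (x - of_real br2) * (of_real br3 - x)
      = of_real (l1 * (br2 + br3)) * x - of_real l1 * x ^ 2 - of_real (l1 * (br2 * br3))"
    by (simp add: algebra_simps power2_eq_square)
  also have "\<dots> = of_real mid * x - of_real l1 * x ^ 2 - of_real a1" unfolding br_vieta ..
  finally have 1: "of_real l1 * (x - of_real br2) * (of_real br3 - x)
      = of_real mid * x - of_real l1 * x ^ 2 - of_real a1" .
  have g: "of_real gm \<noteq> (0 :: complex)" using gm_rad(1) by simp
  have "2 * of_real gm * (Tf x - 1) = of_real mid - of_real l1 * x - of_real a1 / x"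
  proof -
    have "2 * of_real gm * Tf x = of_real (l1 + l2 + a1 + a2) - of_real l1 * x - of_real a1 / x"
      using g unfolding Tf_def by simp
    thus ?thesis by (simp add: mid_def right_diff_distrib)
  qed
  moreover have "(Tf x - 1) * (2 * of_real gm * x) = 2 * of_real gm * (Tf x - 1) * x"
    by (simp only: mult_ac)
  ultimately have "(Tf x - 1) * (2 * of_real gm * x) = (of_real mid - of_real l1 * x - of_real a1 / x) * x"
    by simp
  hence "(Tf x - 1) * (2 * of_real gm * x) = of_real mid * x - of_real l1 * x ^ 2 - of_real a1"
    using assms by (simp add: algebra_simps power2_eq_square)
  thus ?thesis unfolding 1 using g assms by (simp add: eq_divide_eq)
qed

text \<open>Leaving the closed unit disc avoids the pole at 0 and the inner branch point
  \<open>br2 \<le> 1\<close>; inside, \<open>axis1\<close> itself is available.\<close>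

definition "cutdom = slit br3 \<inter> {x. 1 < norm x}"

lemma open_dom: "open cutdom"
  unfolding cutdom_def by (intro open_Int open_slit open_Collect_less continuous_intros)

lemma dom_nz: "x \<in> cutdom \<Longrightarrow> x \<noteq> 0" "x \<in> cutdom \<Longrightarrow> x \<noteq> 1"
  by (auto simp: cutdom_def)

lemma dom_real: "complex_of_real x \<in> cutdom \<longleftrightarrow> 1 < \<bar>x\<bar> \<and> x < br3"
  by (auto simp: cutdom_def slit_iff)

text \<open>If \<open>Tf x - 1\<close> were real and nonpositive, \<open>l1 * x + a1 / x\<close>
  would be a real number at least \<open>mid\<close>. For real \<open>x\<close> this contradicts the
  sign of the quadratic between \<open>br2\<close> and \<open>br3\<close>. For other
  \<open>x\<close> it forces \<open>norm x ^ 2 = a1 / l1\<close>, whence the sum is at most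
  \<open>2 * sqrt (l1 * a1) < mid\<close>.\<close>

lemma Tf_dom:
  assumes "x \<in> cutdom"
  shows "Tf x - 1 \<notin> \<real>\<^sub>\<le>\<^sub>0"
proof
  assume "Tf x - 1 \<in> \<real>\<^sub>\<le>\<^sub>0"
  then obtain \<tau> where \<tau>: "\<tau> \<le> 0" "Tf x - 1 = of_real \<tau>" by (auto elim: nonpos_Reals_cases)
  define \<kappa> where "\<kappa> = mid - 2 * gm * \<tau>"
  have "mid \<le> \<kappa>" using \<tau>(1) gm_rad(1) by (simp add: \<kappa>_def mult_nonneg_nonpos)
  have "of_real l1 * x + of_real a1 / x = of_real (l1 + l2 + a1 + a2) - of_real (2 * gm) * Tf x"
    using gm_rad(1) by (simp add: Tf_def)
  also have "Tf x = of_real (1 + \<tau>)" using \<tau>(2) by (simp add: algebra_simps)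
  finally have eq: "of_real l1 * x + of_real a1 / x = of_real \<kappa>"
    by (simp add: \<kappa>_def mid_def algebra_simps)
  show False
  proof (cases "Im x = 0")
    case True
    define y where "y = Re x"
    have y: "x = of_real y" using True by (simp add: complex_eq_iff y_def)
    have "complex_of_real (l1 * y + a1 / y) = of_real \<kappa>" using eq y by simp
    hence eqr: "l1 * y + a1 / y = \<kappa>" by (simp only: of_real_eq_iff)
    have y1: "1 < \<bar>y\<bar>" "y < br3" using assms y dom_real by auto
    show False
    proof (cases "0 < y")
      case False
      hence "l1 * y + a1 / y \<le> 0"
        using rate_pos by (intro add_nonpos_nonpos) (auto simp: mult_le_0_iff divide_le_0_iff)
      thus False using eqr \<open>mid \<le> \<kappa>\<close> mid_disc by simp
    next
      case True
      hence "l1 * y ^ 2 - \<kappa> * y + a1 = 0" using eqr by (simp add: field_simps power2_eq_square)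
      moreover have "mid * y \<le> \<kappa> * y" using True \<open>mid \<le> \<kappa>\<close> by simp
      ultimately have "0 \<le> l1 * (y - br2) * (y - br3)" unfolding br_quadratic [symmetric] by simp
      moreover have "l1 * (y - br2) * (y - br3) < 0"
        using rate_pos y1 True br_bounds by (intro mult_pos_neg mult_pos_pos) auto
      ultimately show False by simp
    qed
  next
    case False
    define N where "N = Re x ^ 2 + Im x ^ 2"
    have N: "0 < N" using False by (auto simp: N_def intro: add_nonneg_pos)
    have "Im (of_real l1 * x + of_real a1 / x) = 0" unfolding eq by simp
    hence "Im x * (l1 - a1 / N) = 0"
      by (simp add: Im_divide N_def algebra_simps)
    hence "l1 = a1 / N" using False by simp
    hence N': "N = a1 / l1" using N rate_pos by (simp add: field_simps)
    have "Re (of_real l1 * x + of_real a1 / x) = \<kappa>" unfolding eq by simp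
    hence "l1 * Re x + a1 * Re x / N = \<kappa>"
      by (simp add: Re_divide N_def)
    hence k: "2 * (l1 * Re x) = \<kappa>" unfolding N' using rate_pos by simp
    have "Re x ^ 2 \<le> a1 / l1" unfolding N' [symmetric] N_def by simp
    hence "l1 ^ 2 * Re x ^ 2 \<le> l1 ^ 2 * (a1 / l1)" by (rule mult_left_mono) simp
    hence "(l1 * Re x) ^ 2 \<le> l1 * a1" using rate_pos by (simp add: power_mult_distrib power2_eq_square mult_ac)
    hence "l1 * Re x \<le> sqrt (l1 * a1)" by (rule real_le_rsqrt)
    thus False using k mid_gt \<open>mid \<le> \<kappa>\<close> by simp
  qed
qed

definition "vr x = jroot (Tf x)"
definition "Y x = of_real rad * vr x"

lemma vr_facts:
  assumes "x \<in> cutdom"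
  shows "norm (vr x) < 1" "vr x \<noteq> 0" "vr x + 1 / vr x = 2 * Tf x"
  using jroot_facts[OF Tf_dom[OF assms]] by (simp_all add: vr_def)

lemma norm_Y: "x \<in> cutdom \<Longrightarrow> norm (Y x) < rad" "x \<in> cutdom \<Longrightarrow> Y x \<noteq> 0"
  using vr_facts gm_rad by (auto simp: Y_def norm_mult)

lemma holomorphic_Y: "Y holomorphic_on cutdom"
proof -
  have "(\<lambda>x. jroot (Tf x)) holomorphic_on cutdom"
  proof (rule holomorphic_jroot[OF _ Tf_dom])
    show "Tf holomorphic_on cutdom"
      unfolding Tf_def[abs_def] using dom_nz gm_rad(1) by (intro holomorphic_intros) auto
  qed
  thus ?thesis unfolding Y_def vr_def by (intro holomorphic_intros)
qed

lemma kern_scaled: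
  assumes "x \<noteq> 0" "v \<noteq> 0"
  shows "kern x (of_real rad * v) = of_real gm * (v + 1 / v - 2 * Tf x)"
proof -
  have A: "of_real l2 * (of_real rad * v) = of_real gm * v"
    by (simp add: gm_rad(3)[symmetric])
  have B: "of_real a2 / (of_real rad * v) = of_real gm * (1 / v)"
    by (simp add: gm_rad(4)[symmetric])
  have C: "of_real gm * (2 * Tf x) = of_real (l1 + l2 + a1 + a2) - of_real l1 * x - of_real a1 / x"
    using gm_rad(1) by (simp add: Tf_def)
  have D: "kern x y = of_real l2 * y + of_real a2 / y - (of_real (l1 + l2 + a1 + a2) - of_real l1 * x - of_real a1 / x)" for y
    by (simp add: kern_def algebra_simps)
  show ?thesis
    unfolding D A B C [symmetric] by (simp only: distrib_left right_diff_distrib)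
qed

lemma kern_Y:
  assumes "x \<in> cutdom"
  shows "kern x (Y x) = 0"
proof -
  have "kern x (Y x) = of_real gm * (vr x + 1 / vr x - 2 * Tf x)"
    unfolding Y_def by (rule kern_scaled[OF dom_nz(1)[OF assms] vr_facts(2)[OF assms]])
  thus ?thesis unfolding vr_facts(3)[OF assms] by simp
qed

lemma Tf_of_real: "Tf (of_real x) = of_real ((l1 + l2 + a1 + a2 - l1 * x - a1 / x) / (2 * gm))"
  by (simp add: Tf_def)

lemma vr_of_real:
  assumes "complex_of_real x \<in> cutdom"
  shows "\<exists>v. vr (of_real x) = of_real v \<and> 0 < v \<and> v < 1"
proof -
  define \<tau> where "\<tau> = (l1 + l2 + a1 + a2 - l1 * x - a1 / x) / (2 * gm)"
  have "of_real (\<tau> - 1) \<notin> (\<real>\<^sub>\<le>\<^sub>0 :: complex set)"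
    using Tf_dom[OF assms] by (simp add: Tf_of_real \<tau>_def)
  hence "\<not> \<tau> - 1 \<le> 0" by (metis nonpos_Reals_of_real_iff)
  hence "1 < \<tau>" by simp
  from jroot_of_real[OF this] show ?thesis by (simp add: vr_def Tf_of_real \<tau>_def)
qed

text \<open>The second root is \<open>rad / v\<close>, because the product of the roots is
  \<open>rad ^ 2\<close>.\<close>

lemma kern_factor:
  fixes x y v :: real
  assumes "x \<noteq> 0" "y \<noteq> 0" "v \<noteq> 0" "kern x (rad * v) = 0"
  shows "kern x y * y = l2 * (y - rad * v) * (y - rad / v)"
proof -
  have e: "l1 * (x - 1) + a1 * (1 / x - 1) - l2 - a2 = - (l2 * (rad * v) + a2 / (rad * v))"
    using assms(4) unfolding kern_def by (simp add: right_diff_distrib)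
  have "l2 * (rad * v) * (rad / v) = l2 * rad ^ 2" using assms(3) by (simp add: power2_eq_square)
  hence p: "l2 * (rad * v) * (rad / v) = a2" using gm_rad(5) rate_pos by simp
  have "a2 / (rad * v) = (a2 / rad) / v" by simp
  hence "a2 / (rad * v) = l2 * (rad / v)" using gm_rad(3,4) by simp
  hence "kern x y = l2 * y + a2 / y - (l2 * (rad * v) + l2 * (rad / v))"
  proof -
    have "kern x y = l2 * y + a2 / y + (l1 * (x - 1) + a1 * (1 / x - 1) - l2 - a2)"
      by (simp add: kern_def right_diff_distrib)
    thus ?thesis unfolding e \<open>a2 / (rad * v) = l2 * (rad / v)\<close> by simp
  qed
  moreover have "(l2 * y + a2 / y - c) * y = l2 * y ^ 2 + a2 - c * y" for c
    using assms(2) by (simp add: distrib_right left_diff_distrib power2_eq_square)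
  ultimately have F: "kern x y * y = l2 * y ^ 2 + l2 * (rad * v) * (rad / v) - (l2 * (rad * v) + l2 * (rad / v)) * y"
    unfolding p by simp
  have "l2 * y ^ 2 + l2 * p * q - (l2 * p + l2 * q) * y = l2 * (y - p) * (y - q)" for p q
    by (simp add: algebra_simps power2_eq_square)
  thus ?thesis unfolding F .
qed

lemma kern_one: "x \<noteq> 0 \<Longrightarrow> kern x (1::real) = (x - 1) * (l1 - a1 / x)"
  by (simp add: kern_def field_simps)

lemma kern_of_real: "kern (complex_of_real x) (of_real y) = of_real (kern x y)"
  by (simp add: kern_def)

lemma kern_vr_of_real:
  assumes "complex_of_real x \<in> cutdom" "vr (of_real x) = of_real v"
  shows "kern x (rad * v) = 0"
proof -
  have "kern (complex_of_real x) (of_real (rad * v)) = 0"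
    using kern_Y[OF assms(1)] by (simp only: Y_def assms(2) of_real_mult)
  thus ?thesis by (simp only: kern_of_real of_real_eq_0_iff)
qed

text \<open>\<open>Df x y\<close> vanishes when \<open>1 / y = zet x\<close>; substituting this into the kernel leaves the quadratic \<open>Gq\<close>.\<close>

definition "zet x = 1 + of_real t1 * (1 / x - 1)" for x :: "'a::real_normed_field"
definition Gq :: "'a::real_normed_field \<Rightarrow> 'a" where
  "Gq x = (of_real l1 * x - of_real (a1 + a2 * t1)) * (of_real (1 - t1) * x + of_real t1) + of_real (l2 * t1) * x"

text \<open>\<open>1 / (rad * v)\<close> and \<open>v / rad\<close> are the reciprocals of the two
  roots, so the left side is the product of \<open>Df\<close> over both roots up to a factor. Being
  symmetric it is rational in \<open>x\<close>. The factor \<open>x - 1\<close> reflects the common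
  zero of kernel and \<open>Df\<close> at \<open>(1, 1)\<close>.\<close>

lemma zet_product:
  fixes x v :: "'a::real_normed_field"
  assumes "x \<noteq> 0" "v \<noteq> 0" "kern x (of_real rad * v) = 0"
  shows "(1 / (of_real rad * v) - zet x) * (v / of_real rad - zet x) * (of_real a2 * x ^ 2) = (x - 1) * Gq x"
proof -
  have r: "of_real rad \<noteq> (0::'a)" using gm_rad by simp
  have e: "of_real l2 * (of_real rad * v) + of_real a2 / (of_real rad * v)
      = of_real l2 + of_real a2 - of_real l1 * (x - 1) - of_real a1 * (1 / x - 1)"
    using assms(3) by (simp add: kern_def algebra_simps add_eq_0_iff)
  have p: "of_real a2 * (1 / (of_real rad * v)) * (v / of_real rad) = (of_real l2 :: 'a)"
  proof -
    have "a2 / rad ^ 2 = l2" using gm_rad(5) rate_pos by simp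
    hence "of_real a2 / of_real rad ^ 2 = (of_real l2 :: 'a)"
      by (metis of_real_divide of_real_power)
    thus ?thesis using assms(2) r by (simp add: power2_eq_square)
  qed
  have q: "of_real a2 * (v / of_real rad) = of_real l2 * (of_real rad * v)"
  proof -
    have "a2 / rad = l2 * rad" using gm_rad by simp
    hence "of_real a2 / of_real rad = (of_real l2 * of_real rad :: 'a)"
      by (metis of_real_divide of_real_mult)
    moreover have "of_real a2 * (v / of_real rad) = v * (of_real a2 / of_real rad :: 'a)" by simp
    ultimately show ?thesis by (simp only: mult_ac)
  qed
  have "(1 / (of_real rad * v) - zet x) * (v / of_real rad - zet x) * of_real a2
     = of_real a2 * (1 / (of_real rad * v)) * (v / of_real rad)
       - zet x * (of_real a2 / (of_real rad * v) + of_real a2 * (v / of_real rad)) + of_real a2 * zet x ^ 2"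
    by (simp add: algebra_simps power2_eq_square)
  also have "\<dots> = of_real l2 - zet x * (of_real l2 + of_real a2 - of_real l1 * (x - 1) - of_real a1 * (1 / x - 1)) + of_real a2 * zet x ^ 2"
    unfolding p q e [symmetric] by (simp add: algebra_simps)
  finally have main: "(1 / (of_real rad * v) - zet x) * (v / of_real rad - zet x) * of_real a2
     = of_real l2 - zet x * (of_real l2 + of_real a2 - of_real l1 * (x - 1) - of_real a1 * (1 / x - 1)) + of_real a2 * zet x ^ 2" .
  have "(of_real l2 - zet x * (of_real l2 + of_real a2 - of_real l1 * (x - 1) - of_real a1 * (1 / x - 1)) + of_real a2 * zet x ^ 2) * x ^ 2
      = (x - 1) * Gq x"
  proof -
    have z: "zet x * x = of_real (1 - t1) * x + of_real t1"
      using assms(1) by (simp add: zet_def field_simps)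
    have "(of_real l2 - zet x * (of_real l2 + of_real a2 - of_real l1 * (x - 1) - of_real a1 * (1 / x - 1)) + of_real a2 * zet x ^ 2) * x ^ 2
       = of_real l2 * x ^ 2 - (zet x * x) * ((of_real l2 + of_real a2) * x - of_real l1 * (x - 1) * x - of_real a1 * (1 - x)) + of_real a2 * (zet x * x) ^ 2"
      using assms(1) by (simp add: field_simps power2_eq_square)
    also have "\<dots> = (x - 1) * Gq x"
      unfolding z Gq_def by (simp add: algebra_simps power2_eq_square)
    finally show ?thesis .
  qed
  thus ?thesis using main by (metis mult.assoc)
qed

definition "xp = (- (l1 * t1 - (a1 + a2 * t1) * (1 - t1) + l2 * t1)
  + sqrt ((l1 * t1 - (a1 + a2 * t1) * (1 - t1) + l2 * t1) ^ 2 - 4 * (l1 * (1 - t1)) * (- (a1 + a2 * t1) * t1))) / (2 * (l1 * (1 - t1)))"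
definition "xm = (- (l1 * t1 - (a1 + a2 * t1) * (1 - t1) + l2 * t1)
  - sqrt ((l1 * t1 - (a1 + a2 * t1) * (1 - t1) + l2 * t1) ^ 2 - 4 * (l1 * (1 - t1)) * (- (a1 + a2 * t1) * t1))) / (2 * (l1 * (1 - t1)))"

text \<open>The zeros have a negative product by Vieta, and \<open>Gq 1 < 0\<close> by stability, so
  1 lies strictly between them.\<close>

lemma Gq_factor: "Gq x = of_real (l1 * (1 - t1)) * (x - of_real xp) * (x - of_real xm)"
  and xpm: "xm < 0" "1 < xp"
proof -
  define b where "b = l1 * t1 - (a1 + a2 * t1) * (1 - t1) + l2 * t1"
  define a where "a = l1 * (1 - t1)"
  define c where "c = - (a1 + a2 * t1) * t1"
  have a: "0 < a" using rate_pos t_bounds by (simp add: a_def)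
  have "0 < (a1 + a2 * t1) * t1" using rate_pos t_bounds by (intro mult_pos_pos add_pos_pos) auto
  hence c: "c < 0" unfolding c_def mult_minus_left by simp
  have "0 < 4 * a * (- c)" using a c by (intro mult_pos_pos) auto
  hence "0 \<le> b ^ 2 - 4 * a * c" using zero_le_power2[of b] by linarith
  have v: "a * (xm + xp) = - b" "a * (xm * xp) = c"
    using quadratic_factor[of a b c, OF _ \<open>0 \<le> b ^ 2 - 4 * a * c\<close>] a
    unfolding xp_def xm_def b_def [symmetric] a_def [symmetric] c_def [symmetric] by auto
  have G: "Gq z = of_real (l1 * (1 - t1)) * (z - of_real xp) * (z - of_real xm)" for z :: "'b::real_normed_field"
  proof -
    have "of_real a * (z - of_real xp) * (z - of_real xm)
        = of_real a * z ^ 2 - of_real (a * (xm + xp)) * z + of_real (a * (xm * xp))"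
      by (simp add: algebra_simps power2_eq_square)
    also have "\<dots> = of_real a * z ^ 2 + of_real b * z + of_real c" unfolding v by simp
    also have "\<dots> = Gq z" by (simp add: Gq_def a_def b_def c_def algebra_simps power2_eq_square)
    finally show ?thesis by (simp add: a_def)
  qed
  thus "Gq x = of_real (l1 * (1 - t1)) * (x - of_real xp) * (x - of_real xm)" .
  have "Gq (1::real) < 0" using stable by (simp add: Gq_def)
  hence "a * ((1 - xp) * (1 - xm)) < 0"
    using G[of "1::real"] by (simp add: a_def mult.assoc)
  hence neg: "(1 - xp) * (1 - xm) < 0" using a by (simp add: mult_less_0_iff)
  have le: "xm \<le> xp"
    unfolding xp_def xm_def b_def [symmetric] a_def [symmetric] c_def [symmetric]
    using a \<open>0 \<le> b ^ 2 - 4 * a * c\<close> by (intro divide_right_mono) auto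
  have neg2: "xm * xp < 0"
  proof (rule ccontr)
    assume "\<not> xm * xp < 0"
    hence "0 \<le> a * (xm * xp)" using a by simp
    thus False using v(2) c by simp
  qed
  show "xm < 0"
  proof (rule ccontr)
    assume "\<not> xm < 0"
    hence "0 \<le> xm * xp" using le by (intro mult_nonneg_nonneg) auto
    thus False using neg2 by simp
  qed
  show "1 < xp"
  proof (rule ccontr)
    assume "\<not> 1 < xp"
    hence "0 \<le> (1 - xp) * (1 - xm)" using \<open>xm < 0\<close> by (intro mult_nonneg_nonneg) auto
    thus False using neg by simp
  qed
qed

lemma zet_pos: "0 < x \<Longrightarrow> 0 < zet x" "1 < x \<Longrightarrow> zet x < 1" "1 < x \<Longrightarrow> x < y \<Longrightarrow> zet y < zet x" for x :: real
proof -
  assume "0 < x"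
  have "zet x = (1 - t1) + t1 / x" by (simp add: zet_def algebra_simps)
  moreover have "0 < t1 / x" using \<open>0 < x\<close> t_bounds by simp
  ultimately show "0 < zet x" using t_bounds by simp
next
  assume "1 < x"
  thus "zet x < 1" using t_bounds by (simp add: zet_def mult_less_0_iff)
next
  assume "1 < x" "x < y"
  hence "1 / y < 1 / x" by (simp add: frac_less2)
  thus "zet y < zet x" using t_bounds by (simp add: zet_def)
qed

definition "Df x y = of_real a2 * ((1 / y - 1) - of_real t1 * (1 / x - 1))" for x y :: complex

lemma Df_zet: "Df x y = of_real a2 * (1 / y - zet x)"
  by (simp add: Df_def zet_def)

text \<open>By \<open>zet_product\<close> only \<open>xp\<close> and \<open>xm\<close> are
  candidates. At \<open>xm\<close> the small root would be \<open>1 / zet xm > 1\<close>, so both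
  roots would exceed 1 and \<open>kern xm 1\<close> would be positive, while
  \<open>(xm - 1) * (l1 - a1 / xm)\<close> is negative.\<close>

lemma Df_zero:
  assumes x: "x \<in> cutdom" and D: "Df x (Y x) = 0"
  shows "x = of_real xp"
proof -
  have nz: "x \<noteq> 0" "x \<noteq> 1" using dom_nz x by auto
  have z: "1 / Y x = zet x" using D rate_pos by (simp add: Df_zet)
  have "(x - 1) * Gq x = 0"
    using zet_product[OF nz(1) vr_facts(2)[OF x]] kern_Y[OF x] z by (simp add: Y_def)
  hence "x = of_real xp \<or> x = of_real xm"
    using nz rate_pos t_bounds by (simp add: Gq_factor)
  moreover have "x \<noteq> of_real xm"
  proof
    assume xx: "x = of_real xm"
    obtain v where v: "vr (of_real xm) = of_real v" "0 < v" "v < 1"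
      using vr_of_real x xx by blast
    have "complex_of_real (1 / (rad * v)) = of_real (zet xm)"
      using z by (simp add: Y_def xx v zet_def)
    hence "1 / (rad * v) = zet xm" by (simp only: of_real_eq_iff)
    also have "zet xm < 1"
    proof -
      have "1 / xm < 0" using xpm by simp
      hence "t1 * (1 / xm - 1) < 0" using t_bounds by (intro mult_pos_neg) auto
      thus ?thesis by (simp add: zet_def)
    qed
    finally have gt: "1 < rad * v" using gm_rad v by (simp add: divide_less_eq)
    have "rad * v < rad" using v gm_rad by simp
    moreover have "rad < rad / v" using v gm_rad by (simp add: less_divide_eq)
    ultimately have "rad * v < rad / v" by simp
    hence "0 < l2 * (1 - rad * v) * (1 - rad / v)"
      using gt rate_pos by (intro mult_neg_neg mult_pos_neg) auto
    also have "\<dots> = kern xm 1"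
      using kern_factor[of xm 1 v] kern_vr_of_real[of xm v] x xx v xpm by simp
    also have "\<dots> = (xm - 1) * (l1 - a1 / xm)" using kern_one xpm by simp
    also have "\<dots> < 0"
    proof -
      have "a1 / xm < 0" using xpm rate_pos by (simp add: divide_less_0_iff)
      thus ?thesis using xpm rate_pos by (intro mult_neg_pos) auto
    qed
    finally show False .
  qed
  ultimately show ?thesis by blast
qed


section \<open>Continuation of the axis generating function\<close>

definition "rad2 = (SOME R. rad < R \<and> 1 \<le> R \<and> summable (\<lambda>n. w 0 n * R ^ n))"

lemma rad2: "rad < rad2" "1 \<le> rad2" "summable (\<lambda>n. w 0 n * rad2 ^ n)"
proof -
  have "\<exists>R. rad < R \<and> 1 \<le> R \<and> summable (\<lambda>n. w 0 n * R ^ n)"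
    using axis2_radius[OF drift1] unfolding rad_def by blast
  from someI_ex[OF this] show "rad < rad2" "1 \<le> rad2" "summable (\<lambda>n. w 0 n * rad2 ^ n)"
    unfolding rad2_def by blast+
qed

lemma axis_summable:
  assumes "summable (\<lambda>n. v n * R ^ n)" "\<And>n. 0 \<le> v n" "norm (z::complex) \<le> R"
  shows "summable (\<lambda>n. norm (complex_of_real (v n) * z ^ n))"
  using assms(1)
proof (rule summable_comparison_test')
  fix n :: nat
  show "norm (norm (complex_of_real (v n) * z ^ n)) \<le> v n * R ^ n"
    using assms(2)[of n] assms(3) by (auto simp: norm_mult norm_power intro!: mult_left_mono power_mono)
qed

lemma axis2_sums: "norm y \<le> rad2 \<Longrightarrow> (\<lambda>n. of_real (w 0 n) * y ^ n) sums axis2 y"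
  unfolding axis2_def
  by (intro summable_sums summable_norm_cancel[OF axis_summable[OF rad2(3)]]) (auto simp: less_imp_le[OF w_pos])

lemma axis2_holomorphic: "axis2 holomorphic_on ball 0 rad2"
  using axis2_sums by (intro sums_imp_holomorphic[of _ "\<lambda>n. of_real (w 0 n)"]) auto

lemma axis1_sums:
  assumes "norm x < a1 / l1"
  shows "(\<lambda>n. of_real (w n 0) * x ^ n) sums axis1 x"
  unfolding axis1_def
  by (intro summable_sums summable_norm_cancel[OF axis_summable[OF wsum_axis1[OF wsum_one[of "norm x"]]]])
     (use assms less_imp_le[OF w_pos] in auto)

lemma axis1_holomorphic: "axis1 holomorphic_on ball 0 (a1 / l1)"
  using axis1_sums by (intro sums_imp_holomorphic[of _ "\<lambda>n. of_real (w n 0)"]) auto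

definition Mf :: "complex \<Rightarrow> complex \<Rightarrow> complex" where
  "Mf x y = of_real a1 * (of_real t2 * (1 / y - 1) - (1 / x - 1)) * axis2 y
     - (of_real (a2 * t1) * (1 / x - 1) + of_real (a1 * t2) * (1 / y - 1)) * of_real (w 0 0)"

lemma fundamental_on_kernel:
  assumes "x \<noteq> 0" "y \<noteq> 0" "kern x y = 0" "wsum (norm x) (norm y)"
  shows "axis1 x * Df x y = Mf x y"
  using fundamental_equation[OF assms(1,2,4)] assms(3) by (simp add: Df_def Mf_def algebra_simps)

lemma Mf_Y_holomorphic: "(\<lambda>x. Mf x (Y x)) holomorphic_on cutdom"
proof -
  have "(\<lambda>x. axis2 (Y x)) holomorphic_on cutdom"
    using holomorphic_on_compose_gen[OF holomorphic_Y axis2_holomorphic] norm_Y rad2(1)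
    by (force simp: o_def)
  thus ?thesis
    unfolding Mf_def using norm_Y(2) dom_nz(1)
    by (intro holomorphic_intros holomorphic_Y) auto
qed

lemma Df_Y_holomorphic: "(\<lambda>x. Df x (Y x)) holomorphic_on cutdom"
  unfolding Df_def using norm_Y(2) dom_nz(1)
  by (intro holomorphic_intros holomorphic_Y) auto

lemma Y_of_real:
  assumes "complex_of_real x \<in> cutdom"
  shows "\<exists>v. vr (of_real x) = of_real v \<and> Y (of_real x) = of_real (rad * v) \<and> 0 < v \<and> v < 1 \<and> kern x (rad * v) = 0"
  using vr_of_real[OF assms] kern_vr_of_real[OF assms] by (auto simp: Y_def)

text \<open>The sign of the kernel at \<open>y = 1\<close> tells whether \<open>1\<close> separates the two roots.\<close>

lemma root_less_one:
  assumes "kern x 1 < 0" "0 < v" "v < 1" "kern x (rad * v) = 0" "x \<noteq> 0"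
  shows "rad * v < 1"
proof (rule ccontr)
  assume "\<not> rad * v < 1"
  hence ge: "1 \<le> rad * v" by simp
  have "rad * v < rad" using assms gm_rad by simp
  moreover have "rad < rad / v" using assms gm_rad by (simp add: less_divide_eq)
  ultimately have "1 < rad / v" using ge by simp
  hence "0 \<le> (l2 * (1 - rad * v)) * (1 - rad / v)"
    using ge rate_pos by (intro mult_nonpos_nonpos) (auto simp: mult_le_0_iff)
  moreover have "kern x 1 * 1 = l2 * (1 - rad * v) * (1 - rad / v)"
    using assms by (intro kern_factor) auto
  ultimately show False using assms(1) by simp
qed

text \<open>Near a real point \<open>x0\<close> of the annulus the small root has modulus below 1,
  so the double series converges and the functional equation applies on an open set. Both sides are
  holomorphic on the connected annulus, even where \<open>norm (Y x) > 1\<close>.\<close>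

theorem axis1_eq:
  assumes "1 < norm x" "norm x < a1 / l1"
  shows "axis1 x * Df x (Y x) = Mf x (Y x)"
proof -
  define U where "U = {x::complex. 1 < norm (x - 0) \<and> norm (x - 0) < a1 / l1}"
  have "U \<subseteq> ball 0 br3" using br_bounds(5) by (auto simp: U_def)
  hence Usub: "U \<subseteq> cutdom"
    using ball_subset_slit[of br3] by (auto simp: cutdom_def U_def)
  have "open U" unfolding U_def by (intro open_Collect_conj open_Collect_less continuous_intros)
  have "connected U" unfolding U_def by (intro connected_annulus) simp
  define x0 where "x0 = (1 + a1 / l1) / 2"
  have "1 < (1 + q) / 2 \<and> (1 + q) / 2 < q" if "1 < q" for q :: real
    using that by auto
  from this[OF br_bounds(4)] have x0: "1 < x0" "x0 < a1 / l1" unfolding x0_def by auto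
  have x0U: "of_real x0 \<in> U" using x0 by (auto simp: U_def)
  obtain v where v: "Y (of_real x0) = of_real (rad * v)" "0 < v" "v < 1" "kern x0 (rad * v) = 0"
    using Y_of_real[of x0] x0U Usub by blast
  \<comment> \<open>A negative kernel at \<open>y = 1\<close> puts 1 between the two roots, hence
    the small root below 1.\<close>
  have "kern x0 1 = (x0 - 1) * (l1 - a1 / x0)" using x0 by (intro kern_one) auto
  also have "\<dots> < 0" using x0 rate_pos by (intro mult_pos_neg) (auto simp: field_simps)
  finally have "rad * v < 1" using v x0 by (intro root_less_one) auto
  hence n0: "norm (Y (of_real x0)) < 1" using v gm_rad by (simp add: norm_mult)
  define V where "V = U \<inter> Y -` ball 0 1"
  have "continuous_on U Y"
    using holomorphic_Y Usub by (meson holomorphic_on_imp_continuous_on holomorphic_on_subset)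
  hence "open V" unfolding V_def using \<open>open U\<close> by (intro continuous_open_preimage) auto
  have x0V: "of_real x0 \<in> V" using x0U n0 by (auto simp: V_def)
  have eqV: "axis1 z * Df z (Y z) - Mf z (Y z) = 0" if "z \<in> V" for z
  proof -
    have z: "z \<in> cutdom" "norm z < a1 / l1" "norm (Y z) \<le> 1" using that Usub by (auto simp: V_def U_def)
    have "wsum (norm z) (norm (Y z))"
      using wsum_mono[OF wsum_one[of "norm z"]] z by auto
    thus ?thesis
      using fundamental_on_kernel[OF dom_nz(1) norm_Y(2) kern_Y] z by simp
  qed
  have "(\<lambda>z. axis1 z * Df z (Y z) - Mf z (Y z)) x = 0"
  proof (rule analytic_continuation[where f = "\<lambda>z. axis1 z * Df z (Y z) - Mf z (Y z)"])
    have "axis1 holomorphic_on U"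
      using axis1_holomorphic by (rule holomorphic_on_subset) (auto simp: U_def)
    thus "(\<lambda>z. axis1 z * Df z (Y z) - Mf z (Y z)) holomorphic_on U"
      using holomorphic_on_subset[OF Mf_Y_holomorphic Usub] holomorphic_on_subset[OF Df_Y_holomorphic Usub]
      by (intro holomorphic_intros)
    show "of_real x0 islimpt V"
      using \<open>open V\<close> x0V interior_limit_point[of "of_real x0" V] by (simp add: interior_open)
    show "V \<subseteq> U" by (auto simp: V_def)
    show "axis1 z * Df z (Y z) - Mf z (Y z) = 0" if "z \<in> V" for z using eqV that .
    show "x \<in> U" using assms by (simp add: U_def)
  qed fact+
  thus ?thesis by simp
qed

definition "ext x = (if norm x < a1 / l1 then axis1 x else Mf x (Y x) / Df x (Y x))"

lemma ext_eq:
  assumes "x \<in> cutdom" "Df x (Y x) \<noteq> 0"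
  shows "ext x = Mf x (Y x) / Df x (Y x)"
  using axis1_eq[of x] assms by (auto simp: ext_def cutdom_def field_simps)

lemma ext_holomorphic:
  assumes "\<And>x. x \<in> cutdom - Z \<Longrightarrow> Df x (Y x) \<noteq> 0" "closed Z"
  shows "ext holomorphic_on slit br3 - Z"
proof -
  have "ext holomorphic_on ball 0 (a1 / l1)"
    using axis1_holomorphic by (rule holomorphic_transform) (auto simp: ext_def)
  moreover have "ext holomorphic_on cutdom - Z"
  proof (rule holomorphic_transform)
    show "(\<lambda>x. Mf x (Y x) / Df x (Y x)) holomorphic_on cutdom - Z"
      using assms(1) holomorphic_on_subset[OF Mf_Y_holomorphic] holomorphic_on_subset[OF Df_Y_holomorphic]
      by (intro holomorphic_intros) auto
  qed (use assms(1) ext_eq in auto)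
  ultimately have "ext holomorphic_on ball 0 (a1 / l1) \<union> (cutdom - Z)"
    using open_dom assms(2) by (intro holomorphic_on_Un) auto
  thus ?thesis
    by (rule holomorphic_on_subset) (use br_bounds(4) in \<open>auto simp: cutdom_def\<close>)
qed

lemma ext_sums: "norm x < a1 / l1 \<Longrightarrow> (\<lambda>n. of_real (w n 0) * x ^ n) sums ext x"
  using axis1_sums by (simp add: ext_def)

section \<open>Whether \<open>xp\<close> is a pole\<close>

definition "Yxp = 1 / zet xp"

text \<open>\<open>Gq xp = 0\<close> is the kernel equation after the substitution
  \<open>1 / y = zet x\<close>, apart from a common factor \<open>1 - 1 / xp\<close>.\<close>

lemma Yxp: "1 < Yxp" "kern xp Yxp = 0"
proof -
  have z: "0 < zet xp" "zet xp < 1" using zet_pos[of xp] xpm by auto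
  thus "1 < Yxp" by (simp add: Yxp_def)
  have G0: "Gq xp = 0" by (simp add: Gq_factor)
  have "zet xp * xp = (1 - t1) * xp + t1" using xpm by (simp add: zet_def field_simps)
  hence "(l1 * xp - (a1 + a2 * t1)) * (zet xp * xp) + l2 * t1 * xp = 0"
    using G0 by (simp add: Gq_def)
  hence "((l1 * xp - (a1 + a2 * t1)) * zet xp + l2 * t1) * xp = 0" by (simp add: algebra_simps)
  hence e: "(l1 * xp - (a1 + a2 * t1)) * zet xp + l2 * t1 = 0" using xpm by simp
  define u where "u = 1 - 1 / xp"
  have zu: "zet xp = 1 - t1 * u" by (simp add: zet_def u_def algebra_simps)
  have xu: "xp - 1 = xp * u" using xpm by (simp add: u_def algebra_simps)
  have "Yxp - 1 = t1 * u * Yxp" using z unfolding Yxp_def zu by (simp add: field_simps)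
  moreover have "1 / Yxp - 1 = - (t1 * u)" by (simp add: Yxp_def zu)
  moreover have "1 / xp - 1 = - u" by (simp add: u_def)
  ultimately have "kern xp Yxp = l1 * (xp * u) + l2 * (t1 * u * Yxp) - a1 * u - a2 * (t1 * u)"
    unfolding kern_def xu by simp
  also have "\<dots> = u * (((l1 * xp - (a1 + a2 * t1)) * zet xp + l2 * t1) * Yxp)"
  proof -
    have "zet xp * Yxp = 1" using z by (simp add: Yxp_def)
    hence *: "((l1 * xp - (a1 + a2 * t1)) * zet xp + l2 * t1) * Yxp = l1 * xp - (a1 + a2 * t1) + l2 * t1 * Yxp"
      by (simp add: distrib_right mult.assoc)
    show ?thesis unfolding * by (simp add: algebra_simps)
  qed
  finally show "kern xp Yxp = 0" unfolding e by simp
qed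

lemma of_real_zet: "of_real (zet x) = (zet (of_real x) :: complex)"
  by (simp add: zet_def)

text \<open>The point \<open>(xp, Yxp)\<close> is always on the kernel curve; there is a pole only
  if \<open>Yxp\<close> is the small root at \<open>xp\<close> rather than the large one.\<close>

lemma Df_xp_zero_iff:
  assumes "xp < br3"
  shows "Df (of_real xp) (Y (of_real xp)) = 0 \<longleftrightarrow> Y (of_real xp) = of_real Yxp"
proof -
  have x: "complex_of_real xp \<in> cutdom" using assms xpm by (simp add: dom_real)
  have z: "0 < zet xp" using zet_pos[of xp] xpm by auto
  have "Df (of_real xp) (Y (of_real xp)) = 0 \<longleftrightarrow> 1 / Y (of_real xp) = of_real (zet xp)"
    using rate_pos by (simp add: Df_zet of_real_zet)
  also have "\<dots> \<longleftrightarrow> Y (of_real xp) = of_real Yxp"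
    using z norm_Y(2)[OF x] by (auto simp: Yxp_def field_simps)
  finally show ?thesis .
qed

lemma xp_cases:
  assumes "xp < br3"
  obtains v where "Y (of_real xp) = of_real (rad * v)" "0 < v" "v < 1" "Yxp = rad * v \<or> Yxp = rad / v"
proof -
  have x: "complex_of_real xp \<in> cutdom" using assms xpm by (simp add: dom_real)
  obtain v where v: "Y (of_real xp) = of_real (rad * v)" "0 < v" "v < 1" "kern xp (rad * v) = 0"
    using Y_of_real[OF x] by blast
  have "kern xp Yxp * Yxp = l2 * (Yxp - rad * v) * (Yxp - rad / v)"
    using v xpm Yxp(1) by (intro kern_factor) auto
  hence "Yxp = rad * v \<or> Yxp = rad / v" using Yxp(2) rate_pos by auto
  with v that show ?thesis by blast
qed

lemma Y_xp_pole:
  assumes "xp < br3" "Yxp < rad"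
  shows "Y (of_real xp) = of_real Yxp"
proof -
  obtain v where v: "Y (of_real xp) = of_real (rad * v)" "0 < v" "v < 1" "Yxp = rad * v \<or> Yxp = rad / v"
    using xp_cases[OF assms(1)] .
  have "rad < rad / v" using v gm_rad by (simp add: less_divide_eq)
  thus ?thesis using v assms by auto
qed

text \<open>Condition 3 in the parameters of the walk, with its side bounds dropped; see
  \<open>condition3D\<close>.\<close>

definition no_pole :: bool where
  "no_pole \<longleftrightarrow> a2 \<le> l2 \<or> xp \<le> a1 / l1 \<or> (xp < br3 \<and> rad \<le> Yxp)"

lemma rad_le_one: "a2 \<le> l2 \<Longrightarrow> rad \<le> 1"
  using rate_pos by (simp add: rad_def)

lemma kern_br3: "kern br3 rad = 0"
proof -
  have "kern (complex_of_real br3) (of_real rad * 1) = of_real gm * (1 + 1 / 1 - 2 * Tf (of_real br3))"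
    using br_bounds by (intro kern_scaled) auto
  also have "Tf (of_real br3) = 1" using Tf_minus_one[of "of_real br3"] br_bounds by simp
  finally have "complex_of_real (kern br3 rad) = 0" by (simp add: kern_of_real)
  thus ?thesis by simp
qed

text \<open>If \<open>Yxp\<close> were the small root, then \<open>1 < Yxp < rad\<close>, so both
  roots exceed 1 and \<open>kern xp 1 > 0\<close>. This contradicts \<open>xp \<le> a1 / l1\<close>;
  the other two alternatives already contradict \<open>1 < Yxp < rad\<close>.\<close>

lemma no_pole_xp:
  assumes "no_pole" "xp < br3"
  shows "Y (of_real xp) \<noteq> of_real Yxp"
proof
  assume eq: "Y (of_real xp) = of_real Yxp"
  have x: "complex_of_real xp \<in> cutdom" using assms xpm by (simp add: dom_real)
  have lt: "Yxp < rad" using norm_Y(1)[OF x] Yxp(1) unfolding eq by simp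
  hence "\<not> a2 \<le> l2" using rad_le_one Yxp(1) by fastforce
  with assms lt have le: "xp \<le> a1 / l1" by (auto simp: no_pole_def)
  obtain v where v: "Y (of_real xp) = of_real (rad * v)" "0 < v" "v < 1" "kern xp (rad * v) = 0"
    using Y_of_real[OF x] by blast
  have rv: "rad * v = Yxp" using v(1) unfolding eq by (metis of_real_eq_iff)
  have "rad < rad / v" using v gm_rad by (simp add: less_divide_eq)
  hence "1 < rad / v" using lt Yxp(1) by simp
  hence "0 < (l2 * (1 - rad * v)) * (1 - rad / v)"
    using rate_pos Yxp(1) rv by (intro mult_neg_neg mult_pos_neg) auto
  also have "\<dots> = kern xp 1" using kern_factor[of xp 1 v] v xpm by simp
  also have "\<dots> = (xp - 1) * (l1 - a1 / xp)" using kern_one xpm by simp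
  also have "\<dots> \<le> 0"
    using xpm le rate_pos by (intro mult_nonneg_nonpos) (auto simp: field_simps)
  finally show False by simp
qed

lemma no_pole_Df: "no_pole \<Longrightarrow> x \<in> cutdom \<Longrightarrow> Df x (Y x) \<noteq> 0"
  using Df_zero[of x] Df_xp_zero_iff no_pole_xp dom_real[of xp] by fastforce

text \<open>This is the strict positivity of \<open>Df\<close> at the branch point. The decreasing
  function \<open>zet\<close> transports \<open>1 / Yxp \<le> 1 / rad\<close> from \<open>xp\<close>
  to \<open>br3\<close>. If only \<open>xp \<le> a1 / l1\<close> is given,
  \<open>kern br3 1 > 0\<close> yields \<open>xp < br3\<close>, and \<open>Yxp\<close> is then the
  large root.\<close>

lemma no_pole_zet: "no_pole \<Longrightarrow> zet br3 < 1 / rad"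
proof -
  assume np: no_pole
  consider "a2 \<le> l2" | "l2 < a2" "xp < br3" "rad \<le> Yxp" | "l2 < a2" "xp \<le> a1 / l1"
    using np unfolding no_pole_def by (meson not_le)
  thus ?thesis
  proof cases
    case 1
    hence "1 \<le> 1 / rad" using rad_le_one gm_rad by simp
    thus ?thesis using zet_pos(2)[of br3] br_bounds by simp
  next
    case 2
    have "zet br3 < zet xp" using zet_pos(3) xpm 2 by simp
    also have "\<dots> = 1 / Yxp" by (simp add: Yxp_def)
    also have "\<dots> \<le> 1 / rad" using 2 gm_rad by (simp add: frac_le)
    finally show ?thesis .
  next
    case 3
    have "1 < rad" using 3 rate_pos by (simp add: rad_def)
    have "kern br3 1 * 1 = l2 * (1 - rad * 1) * (1 - rad / 1)"
      using kern_br3 br_bounds by (intro kern_factor) auto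
    also have "\<dots> > 0" using rate_pos \<open>1 < rad\<close> by (auto intro!: mult_neg_neg mult_pos_neg)
    finally have "0 < (br3 - 1) * (l1 - a1 / br3)" using kern_one br_bounds by simp
    hence "a1 / br3 < l1" using br_bounds by (simp add: zero_less_mult_iff)
    hence "a1 < l1 * br3" using br_bounds by (simp add: field_simps)
    moreover have "l1 * xp \<le> a1" using 3 rate_pos by (simp add: field_simps)
    ultimately have "l1 * xp < l1 * br3" by linarith
    hence "xp < br3" using rate_pos by simp
    obtain v where v: "Y (of_real xp) = of_real (rad * v)" "0 < v" "v < 1" "Yxp = rad * v \<or> Yxp = rad / v"
      using xp_cases[OF \<open>xp < br3\<close>] .
    hence "Yxp = rad / v" using no_pole_xp[OF np \<open>xp < br3\<close>] by auto
    moreover have "rad < rad / v" using v gm_rad by (simp add: less_divide_eq)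
    ultimately have "rad < Yxp" by simp
    have "zet br3 < zet xp" using zet_pos(3) xpm \<open>xp < br3\<close> by simp
    also have "\<dots> = 1 / Yxp" by (simp add: Yxp_def)
    also have "\<dots> \<le> 1 / rad" using \<open>rad < Yxp\<close> gm_rad by (simp add: frac_le)
    finally show ?thesis .
  qed
qed

end

section \<open>The branch point\<close>

text \<open>The principal root maps the right half-plane into the sector of opening
  \<open>pi / 2\<close> about the positive axis, and products of two such values stay in the right
  half-plane. This lets a product be recognised as a principal root.\<close>

lemma csqrt_facts_right_half:
  assumes "0 < Re z"
  shows "\<bar>Im (csqrt z)\<bar> < Re (csqrt z)"
proof -
  have "z \<notin> \<real>\<^sub>\<le>\<^sub>0" using assms by (auto elim!: nonpos_Reals_cases)
  hence p: "0 < Re (csqrt z)" by (rule Re_csqrt_pos)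
  have "Im c ^ 2 < Re c ^ 2" if "c ^ 2 = z" for c
    using assms unfolding that [symmetric] by (simp add: power2_eq_square)
  from this[OF power2_csqrt] have "Im (csqrt z) ^ 2 < Re (csqrt z) ^ 2" .
  hence "\<bar>Im (csqrt z)\<bar> ^ 2 < Re (csqrt z) ^ 2" by simp
  thus ?thesis by (rule power2_less_imp_less) (use p in simp)
qed

lemma Re_mult_pos:
  fixes w z :: complex
  assumes "\<bar>Im w\<bar> < Re w" "\<bar>Im z\<bar> < Re z"
  shows "0 < Re (w * z)"
proof -
  have "Im w * Im z \<le> \<bar>Im w\<bar> * \<bar>Im z\<bar>" by (metis abs_ge_self abs_mult)
  also have "\<dots> < Re w * Re z" using assms by (intro mult_strict_mono') auto
  finally show ?thesis by simp
qed

context stable_orbit_walk begin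

text \<open>The slope at \<open>br3\<close> of \<open>sqrt (Tf x - 1)\<close> as a function of
  \<open>sqrt (1 - x / br3)\<close>, read off from \<open>Tf_minus_one\<close>.\<close>

definition "kap = sqrt (l1 * (br3 - br2) / (2 * gm))"

lemma kap_pos: "0 < kap" "kap ^ 2 = l1 * (br3 - br2) / (2 * gm)"
  using rate_pos br_bounds gm_rad by (auto simp: kap_def)

text \<open>The local parameter is \<open>u = csqrt (1 - x / br3)\<close>.\<close>

definition Xw :: "complex \<Rightarrow> complex" where "Xw u = of_real br3 * (1 - u ^ 2)"
text \<open>\<open>u * Aw u\<close> is the branch of \<open>csqrt (Tf x - 1)\<close>, and
  \<open>Vw\<close> is \<open>jroot\<close> rewritten with it. Extracting the factor
  \<open>u\<close> makes both analytic at the branch point.\<close>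

definition "Aw u = csqrt (of_real (l1 * br3) * (Xw u - of_real br2) / (2 * of_real gm * Xw u))"
definition "Vw u = (csqrt (2 + (u * Aw u) ^ 2) - u * Aw u) / (csqrt (2 + (u * Aw u) ^ 2) + u * Aw u)"

lemma Aw_0: "Aw 0 = of_real kap"
proof -
  have "of_real (l1 * br3) * (Xw 0 - of_real br2) / (2 * of_real gm * Xw 0) = complex_of_real (kap ^ 2)"
    using br_bounds by (simp add: Xw_def kap_pos(2))
  hence "Aw 0 = csqrt (of_real (kap ^ 2))" unfolding Aw_def by simp
  also have "\<dots> = of_real (sqrt (kap ^ 2))" by (subst of_real_sqrt) auto
  finally show ?thesis using kap_pos(1) by simp
qed

lemma Aw_arg_0: "of_real (l1 * br3) * (Xw 0 - of_real br2) / (2 * of_real gm * Xw 0) \<notin> \<real>\<^sub>\<le>\<^sub>0"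
proof -
  have "of_real (l1 * br3) * (Xw 0 - of_real br2) / (2 * of_real gm * Xw 0) = complex_of_real (kap ^ 2)"
    using br_bounds by (simp add: Xw_def kap_pos(2))
  moreover have "\<not> kap ^ 2 \<le> 0" using kap_pos(1) by simp
  ultimately show ?thesis by (metis nonpos_Reals_of_real_iff)
qed

lemma Xw_analytic: "Xw analytic_on {0}" 
  unfolding Xw_def[abs_def] by (intro analytic_intros)

lemma Aw_analytic: "Aw analytic_on {0}"
  unfolding Aw_def[abs_def]
  using Aw_arg_0 br_bounds gm_rad by (intro analytic_intros Xw_analytic) (auto simp: Xw_def)

lemma csqrt_2: "csqrt 2 = of_real (sqrt 2)"
  using of_real_sqrt[of 2] by simp

lemma Vw_analytic: "Vw analytic_on {0}"
  unfolding Vw_def[abs_def] by (intro analytic_intros Aw_analytic) auto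

lemma Vw_0: "Vw 0 = 1"
  by (simp add: Vw_def)

lemma Vw_deriv: "(Vw has_field_derivative - of_real (sqrt 2 * kap)) (at 0)"
proof -
  have A: "(Aw has_field_derivative deriv Aw 0) (at 0)"
    using Aw_analytic by (simp add: analytic_on_imp_differentiable_at DERIV_deriv_iff_field_differentiable)
  have wA: "((\<lambda>u. u * Aw u) has_field_derivative of_real kap) (at 0)"
    using DERIV_mult[OF DERIV_ident A] by (simp add: Aw_0)
  have "((\<lambda>u. 2 + (u * Aw u) ^ 2) has_field_derivative 0) (at 0)"
    by (rule derivative_eq_intros wA refl)+ simp
  hence b: "((\<lambda>u. csqrt (2 + (u * Aw u) ^ 2)) has_field_derivative 0 / (2 * csqrt (2 + (0 * Aw 0) ^ 2))) (at 0)"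
    by (rule has_field_derivative_csqrt') simp
  have "(Vw has_field_derivative ((0 - of_real kap) * csqrt 2 - csqrt 2 * (0 + of_real kap)) / (csqrt 2 * csqrt 2)) (at 0)"
    unfolding Vw_def[abs_def]
    using DERIV_divide[OF DERIV_diff[OF b wA] DERIV_add[OF b wA]] by simp
  also have "((0 - of_real kap) * csqrt 2 - csqrt 2 * (0 + of_real kap)) / (csqrt 2 * csqrt 2)
      = - (2 * of_real kap) / csqrt 2"
    by (simp add: field_simps)
  also have "\<dots> = - of_real (sqrt 2 * kap)"
  proof -
    have "2 = sqrt 2 * sqrt 2" by simp
    hence "2 * kap / sqrt 2 = sqrt 2 * kap" by (metis nonzero_mult_div_cancel_left mult.assoc real_sqrt_eq_zero_cancel_iff zero_neq_numeral)
    hence "complex_of_real (2 * kap / sqrt 2) = of_real (sqrt 2 * kap)" by (rule arg_cong)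
    thus ?thesis unfolding csqrt_2 by simp
  qed
  finally show ?thesis .
qed

text \<open>The square of \<open>u * Aw u\<close> is \<open>Tf z - 1\<close>. Both factors lie in
  the sector about the positive axis, so the product has positive real part and is the principal
  root.\<close>

lemma vr_local:
  assumes z: "norm z < br3" "z \<in> cutdom" and u: "u = csqrt (1 - z / of_real br3)"
    and A: "\<bar>Im (Aw u)\<bar> < Re (Aw u)"
  shows "z = Xw u" "vr z = Vw u"
proof -
  have b3: "0 < br3" using br_bounds by simp
  have w2: "u ^ 2 = 1 - z / of_real br3" using u by simp
  show zX: "z = Xw u" unfolding Xw_def w2 using b3 by simp
  have "\<bar>Re z\<bar> < br3" using z(1) abs_Re_le_cmod[of z] by linarith
  hence "0 < Re (1 - z / of_real br3)" using b3 by (simp add: field_simps)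
  hence "\<bar>Im u\<bar> < Re u" unfolding u by (rule csqrt_facts_right_half)
  hence pos: "0 < Re (u * Aw u)" using A by (rule Re_mult_pos)
  have nz: "z \<noteq> 0" using dom_nz z by auto
  have "(u * Aw u) ^ 2 = u ^ 2 * (of_real (l1 * br3) * (Xw u - of_real br2) / (2 * of_real gm * Xw u))"
    unfolding power_mult_distrib by (simp add: Aw_def)
  also have "\<dots> = of_real l1 * (z - of_real br2) * (of_real br3 - z) / (2 * of_real gm * z)"
  proof -
    have "of_real br3 * u ^ 2 = of_real br3 - z" unfolding w2 using b3 by (simp add: algebra_simps)
    thus ?thesis unfolding zX [symmetric] by (simp add: mult_ac)
  qed
  also have "\<dots> = Tf z - 1" using Tf_minus_one[OF nz] by simp
  finally have sq: "(u * Aw u) ^ 2 = Tf z - 1" .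
  have "csqrt (Tf z - 1) = u * Aw u"
    using sq pos by (intro csqrt_unique) auto
  moreover have "Tf z + 1 = 2 + (u * Aw u) ^ 2" unfolding sq by simp
  ultimately show "vr z = Vw u" by (simp add: vr_def jroot_def Vw_def)
qed

text \<open>The partial derivative of \<open>Mf\<close> in \<open>y\<close> at
  \<open>(br3, rad)\<close>, written with real quantities.\<close>

definition "Mfy = a1 * t2 * (- 1 / rad ^ 2) * Re (axis2 (of_real rad))
   + a1 * (t2 * (1 / rad - 1) - (1 / br3 - 1)) * Re (deriv axis2 (of_real rad)) - a1 * t2 * (- 1 / rad ^ 2) * w 0 0"

lemma axis2_deriv: "norm y < rad2 \<Longrightarrow> (axis2 has_field_derivative deriv axis2 y) (at y)"
  by (rule holomorphic_derivI[OF axis2_holomorphic]) auto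

definition Mhat where "Mhat u = Mf (Xw u) (of_real rad * Vw u)"
definition Dhat where "Dhat u = Df (Xw u) (of_real rad * Vw u)"

lemma Xw_deriv: "(Xw has_field_derivative 0) (at 0)"
  unfolding Xw_def[abs_def] by (auto intro!: derivative_eq_intros)

lemma MD_analytic: "Mhat analytic_on {0}" "Dhat analytic_on {0}"
proof -
  have nz: "Xw 0 \<noteq> 0" "of_real rad * Vw 0 \<noteq> 0" using br_bounds gm_rad by (auto simp: Xw_def Vw_0)
  have "axis2 analytic_on ball 0 rad2" using axis2_holomorphic by (simp add: analytic_on_open)
  hence "axis2 analytic_on ((\<lambda>u. of_real rad * Vw u) ` {0})"
    using rad2(1) gm_rad by (auto intro: analytic_on_subset simp: Vw_0)
  moreover have "(\<lambda>u. of_real rad * Vw u) analytic_on {0}" by (intro analytic_intros Vw_analytic)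
  ultimately have "(\<lambda>u. axis2 (of_real rad * Vw u)) analytic_on {0}"
    using analytic_on_compose[of "\<lambda>u. of_real rad * Vw u" "{0}" axis2] by (simp add: o_def)
  thus "Mhat analytic_on {0}"
    unfolding Mhat_def[abs_def] Mf_def using nz
    by (intro analytic_intros Xw_analytic Vw_analytic) auto
  show "Dhat analytic_on {0}"
    unfolding Dhat_def[abs_def] Df_def using nz
    by (intro analytic_intros Xw_analytic Vw_analytic) auto
qed

lemma local_form:
  "\<exists>d>0. Mhat holomorphic_on ball 0 d \<and> Dhat holomorphic_on ball 0 d \<and>
     (\<forall>z. norm z < br3 \<longrightarrow> norm (csqrt (1 - z / of_real br3)) < d \<longrightarrow> z \<in> cutdom \<and>
        Mf z (Y z) = Mhat (csqrt (1 - z / of_real br3)) \<and> Df z (Y z) = Dhat (csqrt (1 - z / of_real br3)))"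
proof -
  have b3: "1 < br3" using br_bounds by simp
  obtain d1 where d1: "0 < d1" "Mhat holomorphic_on ball 0 d1"
    using MD_analytic(1) by (auto simp: analytic_on_def)
  obtain d2 where d2: "0 < d2" "Dhat holomorphic_on ball 0 d2"
    using MD_analytic(2) by (auto simp: analytic_on_def)
  have cA: "isCont Aw 0" and cX: "isCont Xw 0"
    using analytic_on_imp_differentiable_at[OF Aw_analytic] analytic_on_imp_differentiable_at[OF Xw_analytic]
    by (auto intro: field_differentiable_imp_continuous_at)
  have "((\<lambda>u. Re (Aw u) - \<bar>Im (Aw u)\<bar>) \<longlongrightarrow> Re (Aw 0) - \<bar>Im (Aw 0)\<bar>) (nhds 0)"
    using cA by (intro tendsto_intros) (auto simp: isCont_def tendsto_at_iff_tendsto_nhds)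
  hence "\<forall>\<^sub>F u in nhds 0. 0 < Re (Aw u) - \<bar>Im (Aw u)\<bar>"
    by (rule order_tendstoD) (use kap_pos in \<open>simp add: Aw_0\<close>)
  moreover have "((\<lambda>u. norm (Xw u)) \<longlongrightarrow> norm (Xw 0)) (nhds 0)"
    using cX by (intro tendsto_intros) (auto simp: isCont_def tendsto_at_iff_tendsto_nhds)
  hence "\<forall>\<^sub>F u in nhds 0. 1 < norm (Xw u)"
    by (rule order_tendstoD) (use b3 in \<open>simp add: Xw_def\<close>)
  ultimately have "\<forall>\<^sub>F u in nhds 0. 0 < Re (Aw u) - \<bar>Im (Aw u)\<bar> \<and> 1 < norm (Xw u)"
    by eventually_elim auto
  then obtain d3 where d3: "0 < d3" "\<And>u. norm u < d3 \<Longrightarrow> 0 < Re (Aw u) - \<bar>Im (Aw u)\<bar> \<and> 1 < norm (Xw u)"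
    unfolding eventually_nhds_metric by (auto simp: dist_norm)
  define d where "d = min d1 (min d2 d3)"
  have "Mhat holomorphic_on ball 0 d" "Dhat holomorphic_on ball 0 d"
    using d1(2) d2(2) by (auto intro: holomorphic_on_subset simp: d_def)
  moreover have "z \<in> cutdom \<and> Mf z (Y z) = Mhat (csqrt (1 - z / of_real br3)) \<and> Df z (Y z) = Dhat (csqrt (1 - z / of_real br3))"
    if z: "norm z < br3" "norm (csqrt (1 - z / of_real br3)) < d" for z
  proof -
    define u where "u = csqrt (1 - z / of_real br3)"
    have u: "0 < Re (Aw u) - \<bar>Im (Aw u)\<bar>" "1 < norm (Xw u)" using d3(2)[of u] z by (auto simp: u_def d_def)
    have "u ^ 2 = 1 - z / of_real br3" by (simp add: u_def)
    hence "z = Xw u" using b3 by (simp add: Xw_def)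
    hence zc: "z \<in> cutdom" using u z(1) ball_subset_slit[of br3] by (auto simp: cutdom_def)
    have "vr z = Vw u" using vr_local(2)[OF z(1) zc u_def] u by simp
    hence "Y z = of_real rad * Vw u" by (simp add: Y_def)
    with zc \<open>z = Xw u\<close> show ?thesis unfolding u_def [symmetric] Mhat_def Dhat_def by simp
  qed
  moreover have "0 < d" using d1 d2 d3 by (simp add: d_def)
  ultimately show ?thesis by blast
qed

lemma axis2_of_real: "\<bar>y\<bar> \<le> rad2 \<Longrightarrow> axis2 (of_real y) = of_real (\<Sum>n. w 0 n * y ^ n)"
proof -
  assume y: "\<bar>y\<bar> \<le> rad2"
  have b: "(\<lambda>n. complex_of_real (w 0 n * y ^ n)) sums axis2 (of_real y)"
    using axis2_sums[of "of_real y"] y by simp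
  have s: "(\<lambda>n. w 0 n * y ^ n) sums Re (axis2 (of_real y))"
    using sums_Re[OF b] by (simp only: Re_complex_of_real)
  have "(\<lambda>n. 0) sums Im (axis2 (of_real y))"
    using sums_Im[OF b] by (simp only: Im_complex_of_real)
  hence "Im (axis2 (of_real y)) = 0" by (simp add: sums_iff)
  moreover have "Re (axis2 (of_real y)) = (\<Sum>n. w 0 n * y ^ n)" using s by (simp add: sums_iff)
  ultimately show ?thesis by (simp add: complex_eq_iff)
qed

lemma axis2_deriv_real: "\<bar>y\<bar> < rad2 \<Longrightarrow> ((\<lambda>y. Re (axis2 (of_real y))) has_real_derivative Re (deriv axis2 (of_real y))) (at y)"
  and axis2_deriv_Im: "\<bar>y\<bar> < rad2 \<Longrightarrow> Im (deriv axis2 (of_real y)) = 0"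
proof -
  assume y: "\<bar>y\<bar> < rad2"
  have D: "(axis2 has_field_derivative deriv axis2 (of_real y)) (at (of_real y))"
    using axis2_deriv[of "of_real y"] y by simp
  have vd: "((\<lambda>y. axis2 (of_real y)) has_vector_derivative deriv axis2 (of_real y)) (at y)"
    using has_vector_derivative_real_field[OF D] .
  thus "((\<lambda>y. Re (axis2 (of_real y))) has_real_derivative Re (deriv axis2 (of_real y))) (at y)"
    unfolding has_real_derivative_iff_has_vector_derivative
    by (rule bounded_linear.has_vector_derivative[OF bounded_linear_Re])
  have "((\<lambda>y. Im (axis2 (of_real y))) has_vector_derivative Im (deriv axis2 (of_real y))) (at y)"
    using vd by (rule bounded_linear.has_vector_derivative[OF bounded_linear_Im])
  moreover have "((\<lambda>y. Im (axis2 (of_real y))) has_vector_derivative 0) (at y)"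
  proof (rule has_vector_derivative_transform_within_open[where S = "{-rad2<..<rad2}" and f = "\<lambda>_. 0"])
    fix x assume "x \<in> {- rad2<..<rad2}"
    thus "0 = Im (axis2 (of_real x))" using axis2_of_real[of x] by (simp add: abs_le_iff)
  qed (use y in auto)
  ultimately show "Im (deriv axis2 (of_real y)) = 0"
    using vector_derivative_unique_at by blast
qed

text \<open>\<open>Xw\<close> is even in \<open>u\<close>, so to first order only
  \<open>y = rad * Vw u\<close> moves, with velocity \<open>- sqrt 2 * kap * rad\<close>; the values
  are this velocity times the \<open>y\<close>-derivatives of \<open>Mf\<close> and
  \<open>Df\<close>.\<close>

lemma Mhat_deriv: "(Mhat has_field_derivative - of_real (sqrt 2 * kap * rad * Mfy)) (at 0)"
  and Dhat_deriv: "(Dhat has_field_derivative of_real (sqrt 2 * kap * a2 / rad)) (at 0)"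
proof -
  have b3: "0 < br3" and r: "0 < rad" using br_bounds gm_rad by auto
  have V: "((\<lambda>u. of_real rad * Vw u) has_field_derivative - of_real (rad * (sqrt 2 * kap))) (at 0)"
    using DERIV_cmult[OF Vw_deriv, of "of_real rad"] by simp
  have \<eta>: "((\<lambda>u. 1 / (of_real rad * Vw u)) has_field_derivative of_real (sqrt 2 * kap / rad)) (at 0)"
  proof -
    have "((\<lambda>u. 1 / (of_real rad * Vw u)) has_field_derivative
       (0 * (of_real rad * Vw 0) - 1 * (- of_real (rad * (sqrt 2 * kap)))) / ((of_real rad * Vw 0) * (of_real rad * Vw 0))) (at 0)"
      by (rule DERIV_divide[OF DERIV_const V]) (use r in \<open>simp add: Vw_0\<close>)
    thus ?thesis using r by (simp add: Vw_0)
  qed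
  have \<xi>: "((\<lambda>u. 1 / Xw u) has_field_derivative 0) (at 0)"
  proof -
    have "((\<lambda>u. 1 / Xw u) has_field_derivative (0 * Xw 0 - 1 * 0) / (Xw 0 * Xw 0)) (at 0)"
      by (rule DERIV_divide[OF DERIV_const Xw_deriv]) (use b3 in \<open>simp add: Xw_def\<close>)
    thus ?thesis by simp
  qed
  have D0: "(axis2 has_field_derivative deriv axis2 (of_real rad)) (at (of_real rad * Vw 0))"
    using axis2_deriv[of "of_real rad"] rad2(1) r by (simp add: Vw_0)
  have B: "((\<lambda>u. axis2 (of_real rad * Vw u)) has_field_derivative
      deriv axis2 (of_real rad) * - of_real (rad * (sqrt 2 * kap))) (at 0)"
    using DERIV_chain2[OF D0 V] .
  have d: "deriv axis2 (of_real rad) = of_real (Re (deriv axis2 (of_real rad)))"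
    using axis2_deriv_Im[of rad] rad2(1) r by (simp add: complex_eq_iff)
  have e: "axis2 (of_real rad) = of_real (Re (axis2 (of_real rad)))"
    using axis2_of_real[of rad] rad2(1) r by (simp add: complex_eq_iff)
  have X0: "Xw 0 = of_real br3" by (simp add: Xw_def)
  show "(Dhat has_field_derivative of_real (sqrt 2 * kap * a2 / rad)) (at 0)"
    unfolding Dhat_def[abs_def] Df_def
    by (rule derivative_eq_intros \<eta> \<xi> refl)+ simp
  have "(Mhat has_field_derivative
      of_real a1 * (of_real t2 * (of_real (sqrt 2 * kap / rad) - 0) - (0 - 0)) * axis2 (of_real rad * Vw 0)
      + (deriv axis2 (of_real rad) * - of_real (rad * (sqrt 2 * kap)))
        * (of_real a1 * (of_real t2 * (1 / (of_real rad * Vw 0) - 1) - (1 / Xw 0 - 1)))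
      - (of_real (a2 * t1) * (0 - 0) + of_real (a1 * t2) * (of_real (sqrt 2 * kap / rad) - 0)) * of_real (w 0 0)) (at 0)"
    unfolding Mhat_def[abs_def] Mf_def
    by (rule DERIV_diff DERIV_mult DERIV_cmult DERIV_cmult_right DERIV_add DERIV_const \<eta> \<xi> B)+
  also have "of_real a1 * (of_real t2 * (of_real (sqrt 2 * kap / rad) - 0) - (0 - 0)) * axis2 (of_real rad * Vw 0)
      + (deriv axis2 (of_real rad) * - of_real (rad * (sqrt 2 * kap)))
        * (of_real a1 * (of_real t2 * (1 / (of_real rad * Vw 0) - 1) - (1 / Xw 0 - 1)))
      - (of_real (a2 * t1) * (0 - 0) + of_real (a1 * t2) * (of_real (sqrt 2 * kap / rad) - 0)) * of_real (w 0 0)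
     = of_real (a1 * t2 * (sqrt 2 * kap / rad) * Re (axis2 (of_real rad))
      - Re (deriv axis2 (of_real rad)) * (rad * (sqrt 2 * kap)) * (a1 * (t2 * (1 / rad - 1) - (1 / br3 - 1)))
      - a1 * t2 * (sqrt 2 * kap / rad) * w 0 0)"
    unfolding Vw_0 X0 mult_1_right by (subst d, subst e) simp
  also have "a1 * t2 * (sqrt 2 * kap / rad) * Re (axis2 (of_real rad))
      - Re (deriv axis2 (of_real rad)) * (rad * (sqrt 2 * kap)) * (a1 * (t2 * (1 / rad - 1) - (1 / br3 - 1)))
      - a1 * t2 * (sqrt 2 * kap / rad) * w 0 0 = - (sqrt 2 * kap * rad * Mfy)"
  proof -
    have "sqrt 2 * kap / rad = sqrt 2 * kap * rad * (1 / rad ^ 2)" using r by (simp add: power2_eq_square)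
    thus ?thesis unfolding Mfy_def by (simp only:) (simp add: algebra_simps)
  qed
  finally show "(Mhat has_field_derivative - of_real (sqrt 2 * kap * rad * Mfy)) (at 0)"
    by simp
qed


section \<open>Tails when the denominator vanishes\<close>

definition "Mr = a1 * (t2 * (1 / rad - 1) - (1 / br3 - 1)) * Re (axis2 (of_real rad))
   - (a2 * t1 * (1 / br3 - 1) + a1 * t2 * (1 / rad - 1)) * w 0 0"
definition "Dr = a2 * ((1 / rad - 1) - t1 * (1 / br3 - 1))"

lemma Mf_of_real:
  assumes "\<bar>y\<bar> \<le> rad2"
  shows "Mf (of_real x) (of_real y) = of_real (a1 * (t2 * (1 / y - 1) - (1 / x - 1)) * Re (axis2 (of_real y))
   - (a2 * t1 * (1 / x - 1) + a1 * t2 * (1 / y - 1)) * w 0 0)"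
proof -
  have e: "axis2 (of_real y) = of_real (Re (axis2 (of_real y)))"
    using axis2_of_real[OF assms] by simp
  show ?thesis unfolding Mf_def by (subst e) simp
qed

lemma MD_rad: "Mf (of_real br3) (of_real rad) = of_real Mr" "Df (of_real br3) (of_real rad) = of_real Dr"
  using Mf_of_real[of rad br3] rad2(1) gm_rad by (simp_all add: Mr_def Dr_def Df_def)

lemma Dr_zet: "Dr = a2 * (1 / rad - zet br3)"
  by (simp add: Dr_def zet_def)

lemma MDhat_0: "Mhat 0 = of_real Mr" "Dhat 0 = of_real Dr"
  using MD_rad by (simp_all add: Mhat_def Dhat_def Xw_def Vw_0)

lemma Re_axis2_ge: "0 \<le> y \<Longrightarrow> y \<le> rad2 \<Longrightarrow> w 0 0 \<le> Re (axis2 (of_real y))"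
proof -
  assume y: "0 \<le> y" "y \<le> rad2"
  have "summable (\<lambda>n. w 0 n * y ^ n)"
    using rad2(3) by (rule summable_comparison_test')
      (use y less_imp_le[OF w_pos] in \<open>auto intro!: mult_left_mono power_mono\<close>)
  from sum_le_suminf[OF this, of "{0}"] y less_imp_le[OF w_pos]
  have "w 0 0 \<le> (\<Sum>n. w 0 n * y ^ n)" by auto
  thus ?thesis using axis2_of_real[of y] y by simp
qed

text \<open>Where \<open>Df\<close> vanishes, \<open>1 - 1 / y = t1 * (1 - 1 / x)\<close>, so all terms of \<open>Mf\<close> are positive.\<close>

lemma Mf_pos:
  assumes "1 < x" "0 < y" "y \<le> rad2" "1 / y = zet x"
  shows "0 < a1 * (t2 * (1 / y - 1) - (1 / x - 1)) * Re (axis2 (of_real y))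
   - (a2 * t1 * (1 / x - 1) + a1 * t2 * (1 / y - 1)) * w 0 0"
proof -
  define s where "s = 1 - 1 / x"
  have s: "0 < s" using assms by (simp add: s_def)
  have e: "1 / y - 1 = - (t1 * s)" "1 / x - 1 = - s" unfolding assms(4) by (simp_all add: zet_def s_def algebra_simps)
  have "t2 * t1 < 1" using mult_strict_mono[of t2 1 t1 1] t_bounds by simp
  hence "0 < a1 * (s * (1 - t2 * t1))" using rate_pos s by simp
  moreover have "0 < Re (axis2 (of_real y))" using Re_axis2_ge[of y] assms w_pos[of 0 0] by linarith
  ultimately have "0 < a1 * (s * (1 - t2 * t1)) * Re (axis2 (of_real y))" by (rule mult_pos_pos)
  moreover have "0 < (a2 * t1 * s + a1 * t2 * (t1 * s)) * w 0 0"
    using rate_pos t_bounds s w_pos by (intro mult_pos_pos add_pos_pos) auto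
  ultimately show ?thesis unfolding e by (simp add: algebra_simps)
qed

text \<open>Multiplying numerator and denominator by the factor of the large root turns the
  denominator into the polynomial of \<open>zet_product\<close>, so the residue is explicit. The
  factor \<open>1 / Yxp - Yxp * l2 / a2\<close> is the difference of the reciprocals of the two
  roots.\<close>

theorem tail_pole:
  assumes "xp < br3" "Yxp < rad"
  shows "(\<lambda>n. w n 0 * xp ^ Suc n) \<longlonglongrightarrow>
     (a1 * (t2 * (1 / Yxp - 1) - (1 / xp - 1)) * Re (axis2 (of_real Yxp))
       - (a2 * t1 * (1 / xp - 1) + a1 * t2 * (1 / Yxp - 1)) * w 0 0)
     * (1 / Yxp - Yxp * l2 / a2) * xp ^ 2 / ((xp - 1) * (l1 * (1 - t1)) * (xp - xm))"
proof -
  define M where "M = a1 * (t2 * (1 / Yxp - 1) - (1 / xp - 1)) * Re (axis2 (of_real Yxp))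
       - (a2 * t1 * (1 / xp - 1) + a1 * t2 * (1 / Yxp - 1)) * w 0 0"
  let ?p = "complex_of_real xp"
  have p: "?p \<in> cutdom" using assms xpm by (simp add: dom_real)
  have Yp: "Y ?p = of_real Yxp" by (rule Y_xp_pole[OF assms])
  have Mp: "Mf ?p (Y ?p) = of_real M"
    unfolding Yp M_def using Yxp(1) assms rad2(1) by (intro Mf_of_real) auto
  have nz: "?p \<noteq> 0" "?p \<noteq> 1" using xpm by auto
  have hol: "ext holomorphic_on ball 0 br3 - {?p}"
    by (rule holomorphic_on_subset[OF ext_holomorphic[of "{?p}"]])
       (use Df_zero ball_subset_slit in blast)+
  have q: "(z - ?p) * ext z = Mf z (Y z) * (zet z - vr z / of_real rad) * z ^ 2 / ((1 - z) * (of_real (l1 * (1 - t1))) * (z - of_real xm))"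
    if z: "z \<in> cutdom" "z \<noteq> ?p" "z \<noteq> of_real xm" for z
  proof -
    have D: "Df z (Y z) \<noteq> 0" using Df_zero[OF z(1)] z by auto
    have "Df z (Y z) * (vr z / of_real rad - zet z) * z ^ 2
        = (1 / (of_real rad * vr z) - zet z) * (vr z / of_real rad - zet z) * (of_real a2 * z ^ 2)"
      unfolding Df_zet Y_def by (simp add: mult_ac)
    also have "\<dots> = (z - 1) * Gq z"
      using zet_product[OF dom_nz(1)[OF z(1)] vr_facts(2)[OF z(1)]] kern_Y[OF z(1)] by (simp add: Y_def)
    also have "\<dots> = (z - 1) * (of_real (l1 * (1 - t1)) * (z - ?p) * (z - of_real xm))"
      by (simp add: Gq_factor)
    finally have e: "Df z (Y z) * (vr z / of_real rad - zet z) * z ^ 2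
        = (z - 1) * (of_real (l1 * (1 - t1)) * (z - ?p) * (z - of_real xm))" .
    have nz': "(1 - z) * (of_real (l1 * (1 - t1))) * (z - of_real xm) \<noteq> 0"
      using z dom_nz[OF z(1)] rate_pos t_bounds by auto
    have "(z - ?p) * ext z * ((1 - z) * (of_real (l1 * (1 - t1))) * (z - of_real xm))
        = ext z * (- ((z - 1) * (of_real (l1 * (1 - t1)) * (z - ?p) * (z - of_real xm))))"
      by (simp add: algebra_simps)
    also have "\<dots> = (ext z * Df z (Y z)) * (zet z - vr z / of_real rad) * z ^ 2"
      unfolding e [symmetric] by (simp add: algebra_simps)
    also have "ext z * Df z (Y z) = Mf z (Y z)" using ext_eq[OF z(1) D] D by simp
    finally show ?thesis by (simp only: nonzero_eq_divide_eq[OF nz'])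
  qed
  define L where "L = Mf ?p (Y ?p) * (zet ?p - vr ?p / of_real rad) * ?p ^ 2 / ((1 - ?p) * (of_real (l1 * (1 - t1))) * (?p - of_real xm))"
  have cont: "isCont (\<lambda>z. Mf z (Y z)) ?p" "isCont vr ?p"
  proof -
    have "vr holomorphic_on cutdom"
    proof -
      have "(\<lambda>x. Y x / of_real rad) holomorphic_on cutdom"
        using gm_rad by (intro holomorphic_intros holomorphic_Y) auto
      thus ?thesis by (rule holomorphic_transform) (use gm_rad in \<open>simp add: Y_def\<close>)
    qed
    thus "isCont (\<lambda>z. Mf z (Y z)) ?p" "isCont vr ?p"
      using Mf_Y_holomorphic p open_dom
      by (auto simp: continuous_on_eq_continuous_at dest!: holomorphic_on_imp_continuous_on)
  qed
  have "((\<lambda>z. Mf z (Y z) * (zet z - vr z / of_real rad) * z ^ 2 / ((1 - z) * (of_real (l1 * (1 - t1))) * (z - of_real xm)))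
     \<longlongrightarrow> L) (at ?p)"
    unfolding L_def zet_def
    using nz gm_rad rate_pos t_bounds xpm
    by (intro tendsto_intros cont[unfolded isCont_def]) auto
  moreover have "\<forall>\<^sub>F z in at ?p. Mf z (Y z) * (zet z - vr z / of_real rad) * z ^ 2 / ((1 - z) * (of_real (l1 * (1 - t1))) * (z - of_real xm))
      = (z - ?p) * ext z"
  proof -
    have "\<forall>\<^sub>F z in at ?p. z \<in> cutdom" using open_dom p by (rule eventually_at_in_open')
    moreover have "\<forall>\<^sub>F z in at ?p. z \<in> - {of_real xm}" using xpm by (intro eventually_at_in_open') auto
    moreover have "\<forall>\<^sub>F z in at ?p. z \<noteq> ?p" by (simp add: eventually_at_filter)
    ultimately show ?thesis by eventually_elim (use q in auto)
  qed
  ultimately have "((\<lambda>z. (z - ?p) * ext z) \<longlongrightarrow> L) (at ?p)" by (rule Lim_transform_eventually)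
  from simple_pole_transfer[OF _ assms(1) _ hol ext_sums this]
  have lim: "(\<lambda>n. complex_of_real (w n 0) * of_real (xp ^ Suc n)) \<longlonglongrightarrow> - L"
    using xpm br_bounds by auto
  have v: "vr ?p / of_real rad = of_real (Yxp * l2 / a2)"
  proof -
    have "vr ?p = of_real (Yxp / rad)" using Yp gm_rad by (simp add: Y_def field_simps)
    hence "vr ?p / of_real rad = of_real (Yxp / rad / rad)" by simp
    also have "Yxp / rad / rad = Yxp / rad ^ 2" by (simp add: power2_eq_square)
    also have "\<dots> = Yxp * l2 / a2" unfolding gm_rad by simp
    finally show ?thesis .
  qed
  have "zet ?p = of_real (1 / Yxp)" by (simp add: Yxp_def of_real_zet)
  hence Leq: "L = of_real (M * (1 / Yxp - Yxp * l2 / a2) * xp ^ 2 / ((1 - xp) * (l1 * (1 - t1)) * (xp - xm)))"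
    unfolding L_def Mp v by simp
  hence "- L = of_real (M * (1 / Yxp - Yxp * l2 / a2) * xp ^ 2 / ((xp - 1) * (l1 * (1 - t1)) * (xp - xm)))"
  proof -
    have "- (X / ((1 - xp) * b * c)) = X / ((xp - 1) * b * c)" for X b c
      by (simp add: divide_simps) (simp add: algebra_simps)
    thus ?thesis unfolding Leq of_real_minus [symmetric] by presburger
  qed
  with lim have "(\<lambda>n. complex_of_real (w n 0 * xp ^ Suc n)) \<longlonglongrightarrow>
      of_real (M * (1 / Yxp - Yxp * l2 / a2) * xp ^ 2 / ((xp - 1) * (l1 * (1 - t1)) * (xp - xm)))" by simp
  thus ?thesis unfolding M_def by (simp only: tendsto_of_real_iff)
qed

lemma Df_nonzero_imp_holomorphic:
  assumes "\<And>x. x \<in> cutdom \<Longrightarrow> Df x (Y x) \<noteq> 0"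
  shows "ext holomorphic_on slit br3"
  using ext_holomorphic[of "{}"] assms by simp

text \<open>The denominator vanishes at the branch point, where it is analytic in
  \<open>u = csqrt (1 - x / br3)\<close> with a simple zero. The quotient behaves like
  \<open>c / u\<close>, with \<open>c\<close> the ratio of \<open>Mhat 0\<close> to the derivative
  of \<open>Dhat\<close>.\<close>

lemma tail_double_pole:
  assumes "xp = br3"
  defines "c \<equiv> Mr * rad / (sqrt 2 * kap * a2)"
  shows "(\<lambda>n. w n 0 * br3 ^ n * real n powr (1/2)) \<longlonglongrightarrow> c / sqrt pi" and "0 < Mr"
    and "ext holomorphic_on slit br3"
    and "filterlim (\<lambda>t. norm (ext (of_real t))) at_top (at_left br3)"
proof -
  have b3: "1 < br3" and r: "0 < rad" using br_bounds gm_rad by auto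
  have Df: "Df x (Y x) \<noteq> 0" if "x \<in> cutdom" for x
    using Df_zero[OF that] that dom_real[of br3] assms(1) by auto
  show hol: "ext holomorphic_on slit br3" using Df by (rule Df_nonzero_imp_holomorphic)
  \<comment> \<open>The roots coincide at \<open>br3\<close>, so with \<open>v = 1\<close> the
    product in \<open>zet_product\<close> is a square, and it vanishes because \<open>br3\<close> is
    a zero of \<open>Gq\<close>.\<close>
  have zr: "1 / rad = zet br3"
  proof -
    have "(1 / (of_real rad * 1) - zet br3) * (1 / of_real rad - zet br3) * (of_real a2 * br3 ^ 2) = (br3 - 1) * Gq br3"
      using kern_br3 b3 by (intro zet_product) auto
    also have "\<dots> = 0" by (simp add: Gq_factor assms(1))
    finally show ?thesis using b3 rate_pos by simp
  qed
  show Mr: "0 < Mr"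
    unfolding Mr_def using b3 r rad2(1) zr by (intro Mf_pos) auto
  have Dr: "Dr = 0" by (simp add: Dr_zet zr)
  obtain d where d: "0 < d" "Mhat holomorphic_on ball 0 d" "Dhat holomorphic_on ball 0 d"
    and loc: "\<And>z. norm z < br3 \<Longrightarrow> norm (csqrt (1 - z / of_real br3)) < d \<Longrightarrow> z \<in> cutdom \<and>
        Mf z (Y z) = Mhat (csqrt (1 - z / of_real br3)) \<and> Df z (Y z) = Dhat (csqrt (1 - z / of_real br3))"
    using local_form by blast
  obtain h K where K: "K holomorphic_on ball 0 d" and "\<forall>u. Dhat u = (\<Sum>j<(1::nat). h j * u ^ j) + u ^ 1 * K u"
    using power_expansion_remainder[OF d(3), of 1] by blast
  hence DK: "Dhat u = h 0 + u * K u" for u by simp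
  have h0: "h 0 = 0" using DK[of 0] MDhat_0(2) Dr by simp
  have "(K has_field_derivative deriv K 0) (at 0)"
    using K d by (auto intro!: holomorphic_derivI)
  hence "((\<lambda>u. h 0 + u * K u) has_field_derivative K 0) (at 0)"
    by (auto intro!: derivative_eq_intros)
  hence "(Dhat has_field_derivative K 0) (at 0)" unfolding DK[symmetric] .
  hence K0: "K 0 = of_real (sqrt 2 * kap * a2 / rad)" using Dhat_deriv by (rule DERIV_unique)
  hence "K 0 \<noteq> 0" using kap_pos rate_pos r by simp
  have "isCont K 0" using K d(1) by (auto simp: continuous_on_eq_continuous_at dest!: holomorphic_on_imp_continuous_on)
  then obtain e where e: "0 < e" "\<And>u. norm u < e \<Longrightarrow> K u \<noteq> 0"
    using continuous_at_avoid[of 0 K 0] \<open>K 0 \<noteq> 0\<close> by (auto simp: dist_norm)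
  define d' where "d' = min d e"
  have d': "0 < d'" "d' \<le> d" "d' \<le> e" using d e by (auto simp: d'_def)
  have "(\<lambda>u. Mhat u / K u) holomorphic_on ball 0 d'"
    using e d' holomorphic_on_subset[OF d(2) subset_ball[OF d'(2)]] holomorphic_on_subset[OF K subset_ball[OF d'(2)]]
    by (intro holomorphic_intros) auto
  then obtain h' G where G: "G holomorphic_on ball 0 d'" and "\<forall>u. Mhat u / K u = (\<Sum>j<(1::nat). h' j * u ^ j) + u ^ 1 * G u"
    using power_expansion_remainder[of "\<lambda>u. Mhat u / K u" d' 1] by blast
  hence MG: "Mhat u / K u = h' 0 + u * G u" for u by simp
  have h'0: "h' 0 = of_real c"
    using MG[of 0] K0 MDhat_0(1) r by (simp add: c_def)
  have ext_loc: "ext z = of_real c / csqrt (1 - z / of_real br3) + G (csqrt (1 - z / of_real br3))"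
    if z: "norm z < br3" "norm (csqrt (1 - z / of_real br3)) < d'" for z
  proof -
    define u where "u = csqrt (1 - z / of_real br3)"
    have u: "z \<in> cutdom" "Mf z (Y z) = Mhat u" "Df z (Y z) = Dhat u" "norm u < d'"
      using loc[of z] z d' by (auto simp: u_def)
    have Du: "Dhat u = u * K u" using DK h0 by simp
    have nz: "u \<noteq> 0" "K u \<noteq> 0" using Df[OF u(1)] unfolding u(3) Du by auto
    have "ext z = Mhat u / (u * K u)" using ext_eq[OF u(1) Df[OF u(1)]] unfolding u(2,3) Du .
    also have "\<dots> = (Mhat u / K u) / u" by (simp add: mult.commute)
    also have "\<dots> = of_real c / u + G u" unfolding MG h'0 using nz by (simp add: field_simps)
    finally show ?thesis unfolding u_def .
  qed
  have "(\<lambda>n. of_real (w n 0) * of_real (br3 ^ n * real n powr (1/2))) \<longlonglongrightarrow> complex_of_real c / of_real (sqrt pi)"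
    by (rule sqrt_singularity_transfer(1)[OF _ d'(1) _ hol ext_sums G ext_loc])
       (use b3 br_bounds in auto)
  hence "(\<lambda>n. complex_of_real (w n 0 * br3 ^ n * real n powr (1/2))) \<longlonglongrightarrow> of_real (c / sqrt pi)"
    by (simp add: mult.assoc)
  thus "(\<lambda>n. w n 0 * br3 ^ n * real n powr (1/2)) \<longlonglongrightarrow> c / sqrt pi" by (simp only: tendsto_of_real_iff)
  have c: "0 < c" using Mr r kap_pos rate_pos by (simp add: c_def)
  have "isCont G 0" using G d'(1) by (auto simp: continuous_on_eq_continuous_at dest!: holomorphic_on_imp_continuous_on)
  have su: "((\<lambda>t. sqrt (1 - t / br3)) \<longlongrightarrow> sqrt (1 - br3 / br3)) (at_left br3)"
    using b3 by (intro tendsto_intros) auto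
  hence s0: "((\<lambda>t. sqrt (1 - t / br3)) \<longlongrightarrow> 0) (at_left br3)" using b3 by simp
  have lt: "\<forall>\<^sub>F t in at_left br3. t \<in> {0<..<br3}" using b3 by (intro eventually_at_leftI[of 0]) auto
  have spos: "\<forall>\<^sub>F t in at_left br3. sqrt (1 - t / br3) \<in> {0<..} \<and> sqrt (1 - t / br3) \<noteq> 0"
    using lt by eventually_elim (use b3 in auto)
  hence "filterlim (\<lambda>t. sqrt (1 - t / br3)) (at_right 0) (at_left br3)"
    using s0 by (simp add: filterlim_at)
  hence inf: "filterlim (\<lambda>t. c * (inverse (sqrt (1 - t / br3)))) at_top (at_left br3)"
    using c by (intro filterlim_tendsto_pos_mult_at_top[OF tendsto_const] filterlim_compose[OF filterlim_inverse_at_top_right])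
  have G0: "((\<lambda>t. - norm (G (of_real (sqrt (1 - t / br3))))) \<longlongrightarrow> - norm (G (of_real 0))) (at_left br3)"
    using \<open>isCont G 0\<close> by (intro tendsto_intros isCont_tendsto_compose[of _ G] s0) auto
  \<comment> \<open>The blow-up on the real axis is what later identifies \<open>br3\<close> as the
    dominant singularity.\<close>
  have "filterlim (\<lambda>t. - norm (G (of_real (sqrt (1 - t / br3)))) + c * (inverse (sqrt (1 - t / br3)))) at_top (at_left br3)"
    using filterlim_tendsto_add_at_top[OF G0 inf] .
  moreover have "\<forall>\<^sub>F t in at_left br3. - norm (G (of_real (sqrt (1 - t / br3)))) + c * (inverse (sqrt (1 - t / br3))) \<le> norm (ext (of_real t))"
  proof -
    have "\<forall>\<^sub>F t in at_left br3. sqrt (1 - t / br3) < d'" using s0 d'(1) by (rule order_tendstoD)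
    thus ?thesis using lt
    proof eventually_elim
      case (elim t)
      define s where "s = sqrt (1 - t / br3)"
      have s: "0 < s" "s < d'" using elim b3 by (auto simp: s_def)
      have cs: "csqrt (1 - of_real t / of_real br3) = of_real s"
      proof -
        have "1 - of_real t / of_real br3 = complex_of_real (1 - t / br3)" by simp
        thus ?thesis unfolding s_def using elim b3 by (subst of_real_sqrt) auto
      qed
      have "ext (of_real t) = of_real c / of_real s + G (of_real s)"
        using ext_loc[of "of_real t"] elim s unfolding cs by auto
      moreover have "norm (complex_of_real c / of_real s) = c * inverse s" using c s by (simp add: norm_mult norm_inverse divide_inverse)
      ultimately show ?case
        unfolding s_def [symmetric] using norm_triangle_ineq4[of "of_real c / of_real s + G (of_real s)" "G (of_real s)"] by simp
    qed
  qed
  ultimately show "filterlim (\<lambda>t. norm (ext (of_real t))) at_top (at_left br3)"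
    by (rule filterlim_at_top_mono)
qed


section \<open>Tails without a pole, and their leading constant\<close>

definition "Fy = (Mfy * Dr + Mr * a2 / rad ^ 2) / Dr ^ 2"

text \<open>Iterating the Harnack inequality downwards compares each row with the first axis.
  Summability on the axis thereby extends to the double series for small \<open>y\<close>.\<close>

lemma w_row_le: "w m n \<le> (cap / a2) ^ n * w m 0"
proof (induction n)
  case (Suc n)
  have "a2 * w m (Suc n) \<le> dwn m (Suc n) * w m (Suc n)"
    using dwn_bounds(3)[of n m] less_imp_le[OF w_pos] by (intro mult_right_mono) auto
  also have "\<dots> \<le> cap * w m n" by (rule inflow_le(4))
  finally have "w m (Suc n) \<le> (cap / a2) * w m n" using rate_pos by (simp add: field_simps)
  also have "\<dots> \<le> (cap / a2) * ((cap / a2) ^ n * w m 0)"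
    using Suc cap_pos rate_pos by (intro mult_left_mono) auto
  finally show ?case by simp
qed simp

lemma no_pole_Dr: "no_pole \<Longrightarrow> 0 < Dr"
  using no_pole_zet rate_pos by (simp add: Dr_zet)

text \<open>\<open>Fy\<close> is the \<open>y\<close>-derivative of \<open>Mf / Df\<close> at
  \<open>(br3, rad)\<close>, which is why it governs the coefficient of \<open>u\<close>
  here.\<close>

lemma local_quotient:
  assumes np: no_pole
  obtains d G where "0 < d" "G holomorphic_on ball 0 d" "G 0 = of_real (Mr / Dr)"
    "deriv G 0 = - of_real (sqrt 2 * kap * rad * Fy)"
    "\<And>z. norm z < br3 \<Longrightarrow> norm (csqrt (1 - z / of_real br3)) < d \<Longrightarrow> ext z = G (csqrt (1 - z / of_real br3))"
proof -
  obtain d where d: "0 < d" "Mhat holomorphic_on ball 0 d" "Dhat holomorphic_on ball 0 d"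
    and loc: "\<And>z. norm z < br3 \<Longrightarrow> norm (csqrt (1 - z / of_real br3)) < d \<Longrightarrow> z \<in> cutdom \<and>
        Mf z (Y z) = Mhat (csqrt (1 - z / of_real br3)) \<and> Df z (Y z) = Dhat (csqrt (1 - z / of_real br3))"
    using local_form by blast
  have Dr: "0 < Dr" using np by (rule no_pole_Dr)
  have D0: "Dhat 0 \<noteq> 0" using MDhat_0(2) Dr by simp
  have "isCont Dhat 0" using d by (auto simp: continuous_on_eq_continuous_at dest!: holomorphic_on_imp_continuous_on)
  then obtain e where e: "0 < e" "\<And>u. norm u < e \<Longrightarrow> Dhat u \<noteq> 0"
    using continuous_at_avoid[of 0 Dhat 0] D0 by (auto simp: dist_norm)
  define d' where "d' = min d e"
  have d': "0 < d'" "d' \<le> d" "d' \<le> e" using d e by (auto simp: d'_def)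
  show thesis
  proof (rule that[of d' "\<lambda>u. Mhat u / Dhat u"])
    show "(\<lambda>u. Mhat u / Dhat u) holomorphic_on ball 0 d'"
      using e d' holomorphic_on_subset[OF d(2) subset_ball[OF d'(2)]] holomorphic_on_subset[OF d(3) subset_ball[OF d'(2)]]
      by (intro holomorphic_intros) auto
    show "Mhat 0 / Dhat 0 = of_real (Mr / Dr)" using MDhat_0 by simp
    have r: "0 < rad" by (rule gm_rad)
    have "((\<lambda>u. Mhat u / Dhat u) has_field_derivative
        (- of_real (sqrt 2 * kap * rad * Mfy) * Dhat 0 - Mhat 0 * of_real (sqrt 2 * kap * a2 / rad)) / (Dhat 0 * Dhat 0)) (at 0)"
      by (rule DERIV_divide[OF Mhat_deriv Dhat_deriv D0])
    hence "deriv (\<lambda>u. Mhat u / Dhat u) 0 = of_real ((- (sqrt 2 * kap * rad * Mfy) * Dr - Mr * (sqrt 2 * kap * a2 / rad)) / (Dr * Dr))"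
      by (subst DERIV_imp_deriv) (auto simp: MDhat_0)
    also have "(- (sqrt 2 * kap * rad * Mfy) * Dr - Mr * (sqrt 2 * kap * a2 / rad)) / (Dr * Dr) = - (sqrt 2 * kap * rad * Fy)"
    proof -
      have *: "sqrt 2 * kap * a2 / rad = sqrt 2 * kap * rad * (a2 / rad ^ 2)" using r by (simp add: power2_eq_square)
      have "- (sqrt 2 * kap * rad * Mfy) * Dr - Mr * (sqrt 2 * kap * a2 / rad)
          = - (sqrt 2 * kap * rad) * (Mfy * Dr + Mr * a2 / rad ^ 2)"
        unfolding * by (simp add: algebra_simps)
      thus ?thesis unfolding Fy_def by (simp add: power2_eq_square)
    qed
    finally show "deriv (\<lambda>u. Mhat u / Dhat u) 0 = - of_real (sqrt 2 * kap * rad * Fy)" by simp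
    fix z assume z: "norm z < br3" "norm (csqrt (1 - z / of_real br3)) < d'"
    thus "ext z = Mhat (csqrt (1 - z / of_real br3)) / Dhat (csqrt (1 - z / of_real br3))"
      using loc[of z] d' ext_eq[of z] no_pole_Df[OF np, of z] by auto
  qed (use d' in auto)
qed

theorem tail_no_pole:
  assumes np: no_pole
  shows "(\<lambda>n. w n 0 * br3 ^ n * real n powr (3/2)) \<longlonglongrightarrow> sqrt 2 * kap * rad * Fy / (2 * sqrt pi)"
proof -
  obtain d G where G: "0 < d" "G holomorphic_on ball 0 d" "G 0 = of_real (Mr / Dr)"
    "deriv G 0 = - of_real (sqrt 2 * kap * rad * Fy)"
    and loc: "\<And>z. norm z < br3 \<Longrightarrow> norm (csqrt (1 - z / of_real br3)) < d \<Longrightarrow> ext z = G (csqrt (1 - z / of_real br3))"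
    using local_quotient[OF np] by blast
  have hol: "ext holomorphic_on slit br3" using no_pole_Df[OF np] by (rule Df_nonzero_imp_holomorphic)
  have "(\<lambda>n. of_real (w n 0) * of_real (br3 ^ n * real n powr (3/2))) \<longlonglongrightarrow> - deriv G 0 / of_real (2 * sqrt pi)"
    by (rule sqrt_singularity_transfer(2)[OF _ G(1) _ hol ext_sums G(2), where c = 0])
       (use loc br_bounds in auto)
  hence "(\<lambda>n. complex_of_real (w n 0 * br3 ^ n * real n powr (3/2))) \<longlonglongrightarrow> of_real (sqrt 2 * kap * rad * Fy / (2 * sqrt pi))"
    unfolding G(4) by (simp add: mult.assoc)
  thus ?thesis by (simp only: tendsto_of_real_iff)
qed

lemma axis1_br3_summable:
  assumes no_pole
  shows "summable (\<lambda>n. w n 0 * br3 ^ n)"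
proof -
  have "Bseq (\<lambda>n. w n 0 * br3 ^ n * real n powr (3/2))"
    using tail_no_pole[OF assms] by (intro convergent_imp_Bseq) (auto simp: convergent_def)
  then obtain C where C: "0 < C" "\<And>n. norm (w n 0 * br3 ^ n * real n powr (3/2)) \<le> C"
    by (auto simp: Bseq_def)
  show ?thesis
  proof (rule summable_comparison_test'[where N = 1])
    show "summable (\<lambda>n. C * real n powr (- 3/2))"
      by (intro summable_mult) (simp add: summable_real_powr_iff)
    fix n :: nat assume n: "1 \<le> n"
    have "w n 0 * br3 ^ n * real n powr (3/2) \<le> C" using C(2)[of n] by simp
    hence "w n 0 * br3 ^ n * real n powr (3/2) * real n powr (- 3/2) \<le> C * real n powr (- 3/2)"
      by (intro mult_right_mono) auto
    moreover have "real n powr (3/2) * real n powr (- 3/2) = 1" using n by (simp flip: powr_add)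
    ultimately have "w n 0 * br3 ^ n \<le> C * real n powr (- 3/2)" by (simp add: mult.assoc)
    thus "norm (w n 0 * br3 ^ n) \<le> C * real n powr (- 3/2)"
      using less_imp_le[OF w_pos] br_bounds by simp
  qed
qed

text \<open>The series converges uniformly on the closed disc, so its value at \<open>br3\<close> is
  the radial limit, which along \<open>br3 * (1 - u ^ 2)\<close> is the limit of \<open>G u\<close>
  at 0.\<close>

lemma axis1_br3:
  assumes np: no_pole
  shows "axis1 (of_real br3) = of_real (Mr / Dr)"
proof -
  have b3: "1 < br3" using br_bounds by simp
  obtain d G where G: "0 < d" "G holomorphic_on ball 0 d" "G 0 = of_real (Mr / Dr)"
    and loc: "\<And>z. norm z < br3 \<Longrightarrow> norm (csqrt (1 - z / of_real br3)) < d \<Longrightarrow> ext z = G (csqrt (1 - z / of_real br3))"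
    using local_quotient[OF np] by metis
  have "ext holomorphic_on slit br3" using no_pole_Df[OF np] by (rule Df_nonzero_imp_holomorphic)
  hence hol: "ext holomorphic_on ball 0 br3" by (rule holomorphic_on_subset) (rule ball_subset_slit)
  have ea: "axis1 z = ext z" if "norm z < br3" for z
    using sums_extend_ball[OF _ ext_sums hol that] br_bounds unfolding axis1_def by (simp add: sums_iff)
  have "uniform_limit (cball 0 br3) (\<lambda>n z. \<Sum>i<n. complex_of_real (w i 0) * z ^ i) (\<lambda>z. \<Sum>i. complex_of_real (w i 0) * z ^ i) sequentially"
    using axis1_br3_summable[OF np]
  proof (rule Weierstrass_m_test[rotated])
    fix n and z :: complex assume "z \<in> cball 0 br3"
    thus "norm (complex_of_real (w n 0) * z ^ n) \<le> w n 0 * br3 ^ n"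
      using less_imp_le[OF w_pos] by (auto simp: norm_mult norm_power intro!: mult_left_mono power_mono)
  qed
  hence cont: "continuous_on (cball 0 br3) axis1"
    unfolding axis1_def[abs_def]
    by (rule uniform_limit_theorem[rotated]) (auto intro!: always_eventually continuous_intros)
  have X: "((\<lambda>u. of_real (br3 * (1 - u ^ 2))) \<longlongrightarrow> complex_of_real (br3 * (1 - 0 ^ 2))) (at_right 0)"
    by (intro tendsto_intros)
  have ev: "\<forall>\<^sub>F u in at_right (0::real). 0 < u \<and> u < min d 1"
    using G(1) by (auto intro!: eventually_at_rightI[of 0 "min d 1"])
  have in_ball: "norm (complex_of_real (br3 * (1 - u ^ 2))) < br3" if "0 < u" "u < 1" for u
  proof -
    have "0 < u ^ 2" "u ^ 2 < 1" using that by (auto simp: power_less_one_iff)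
    thus ?thesis using b3 unfolding norm_of_real by (simp add: abs_mult)
  qed
  have "((\<lambda>u. axis1 (of_real (br3 * (1 - u ^ 2)))) \<longlongrightarrow> axis1 (of_real br3)) (at_right 0)"
  proof (rule continuous_on_tendsto_compose[OF cont])
    show "((\<lambda>u. of_real (br3 * (1 - u ^ 2))) \<longlongrightarrow> complex_of_real br3) (at_right 0)" using X by simp
    show "\<forall>\<^sub>F u in at_right 0. complex_of_real (br3 * (1 - u ^ 2)) \<in> cball 0 br3"
      using ev by eventually_elim (use in_ball in \<open>force simp: less_imp_le\<close>)
  qed (use b3 in auto)
  moreover have "\<forall>\<^sub>F u in at_right 0. axis1 (of_real (br3 * (1 - u ^ 2))) = G (of_real u)"
    using ev
  proof eventually_elim
    case (elim u)
    have "1 - complex_of_real (br3 * (1 - u ^ 2)) / of_real br3 = of_real u ^ 2" using b3 by simp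
    hence "csqrt (1 - complex_of_real (br3 * (1 - u ^ 2)) / of_real br3) = of_real u"
      using elim by (intro csqrt_unique) auto
    thus ?case using ea[OF in_ball] loc[OF in_ball] elim by simp
  qed
  ultimately have "((\<lambda>u. G (of_real u)) \<longlongrightarrow> axis1 (of_real br3)) (at_right 0)"
    by (rule Lim_transform_eventually)
  moreover have "((\<lambda>u. G (of_real u)) \<longlongrightarrow> G (of_real 0)) (at_right 0)"
  proof -
    have "isCont G 0" using G by (auto simp: continuous_on_eq_continuous_at dest!: holomorphic_on_imp_continuous_on)
    thus ?thesis by (intro isCont_tendsto_compose[of _ G] tendsto_intros) auto
  qed
  ultimately show ?thesis using G(3) tendsto_unique[of "at_right (0::real)"] by (auto simp: trivial_limit_at_right_real)
qed

lemma kern_br3_complex: "y \<noteq> 0 \<Longrightarrow> kern (of_real br3) y * y = of_real l2 * (y - of_real rad) ^ 2" for y :: complex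
proof -
  assume y: "y \<noteq> 0"
  have r: "complex_of_real rad \<noteq> 0" using gm_rad by simp
  define v where "v = y / of_real rad"
  have v: "v \<noteq> 0" "y = of_real rad * v" using y r by (auto simp: v_def)
  have T: "Tf (of_real br3) = 1" using Tf_minus_one[of "of_real br3"] br_bounds by simp
  have "kern (of_real br3) y * y = of_real gm * (v + 1 / v - 2) * (of_real rad * v)"
    unfolding v(2) using kern_scaled[of "of_real br3" v] v(1) br_bounds T by simp
  also have "\<dots> = of_real gm * of_real rad * ((v + 1 / v - 2) * v)" by (simp add: mult_ac)
  also have "(v + 1 / v - 2) * v = (v - 1) ^ 2" using v(1) by (simp add: algebra_simps power2_eq_square)
  also have "of_real gm = of_real l2 * complex_of_real rad" by (simp add: gm_rad(3)[symmetric])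
  also have "of_real l2 * complex_of_real rad * of_real rad * (v - 1) ^ 2 = of_real l2 * (y - of_real rad) ^ 2"
    unfolding v(2) by (simp add: power2_eq_square algebra_simps)
  finally show ?thesis .
qed

text \<open>At \<open>x = br3\<close> the functional equation reads
  \<open>kern * gfun = \<psi>\<close>, and the kernel has a double zero at \<open>rad\<close>. If
  \<open>Fy\<close> vanished, so would \<open>\<psi>\<close> and its derivative at
  \<open>rad\<close>; the quotient would extend to the disc of radius \<open>rad2 > rad\<close>.
  Nonnegative coefficients turn this into \<open>wsum br3 r1\<close> for some
  \<open>r1 > rad\<close>, which \<open>not_wsum_beyond_double_root\<close> forbids.\<close>

theorem Fy_nonzero:
  assumes np: no_pole
  shows "Fy \<noteq> 0"
proof
  assume F0: "Fy = 0"
  have Dr: "0 < Dr" using np by (rule no_pole_Dr)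
  have b3: "1 < br3" and r: "0 < rad" using br_bounds gm_rad by auto
  \<comment> \<open>\<open>Fy = 0\<close> solved for \<open>Mfy\<close>: the condition that the
    derivative of \<open>\<psi>\<close> at \<open>rad\<close> vanishes.\<close>
  have MD: "Mfy = - (Mr / Dr * a2 / rad ^ 2)"
  proof -
    have "Mfy * Dr = - (Mr * a2 / rad ^ 2)" using F0 Dr by (simp add: Fy_def eq_neg_iff_add_eq_0)
    moreover have "Mfy = Mfy * Dr / Dr" using Dr by simp
    ultimately have "Mfy = - (Mr * a2 / rad ^ 2) / Dr" by simp
    thus ?thesis by simp
  qed
  define C where "C = cap / a2"
  have C: "0 < C" using cap_pos rate_pos by (simp add: C_def)
  \<comment> \<open>For \<open>x = br3\<close> the double series is known to converge only for small
    \<open>y\<close>: \<open>1 / (2 * C)\<close> turns the bound of \<open>w_row_le\<close> into a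
    geometric series of ratio 1/2, and \<open>rad / 2\<close> keeps the double root away.\<close>
  define \<epsilon> where "\<epsilon> = min (1 / (2 * C)) (min (rad / 2) 1)"
  have \<epsilon>: "0 < \<epsilon>" "\<epsilon> \<le> 1 / (2 * C)" "\<epsilon> < rad" "\<epsilon> < rad2" using C r rad2 by (auto simp: \<epsilon>_def)
  have ws: "wsum br3 \<epsilon>"
  proof -
    have "(\<lambda>m. w m 0 * br3 ^ m) summable_on UNIV"
      using axis1_br3_summable[OF np] less_imp_le[OF w_pos] b3 by (subst summable_on_UNIV_nonneg_real_iff) auto
    hence s1: "(\<lambda>m. w m 0 * br3 ^ m * 2) summable_on UNIV" by (rule summable_on_cmult_left)
    have "((\<lambda>n. (1/2) ^ n) has_sum (2::real)) UNIV"
      using geometric_sums[of "1/2 :: real"] by (intro norm_summable_imp_has_sum) (auto simp: summable_geometric_iff)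
    hence "(\<lambda>(m, n). w m 0 * br3 ^ m * (1/2) ^ n) summable_on UNIV \<times> UNIV"
      using s1 less_imp_le[OF w_pos] b3
      by (intro summable_on_SigmaI[where g = "\<lambda>m. w m 0 * br3 ^ m * 2"]) (auto intro!: has_sum_cmult_right)
    thus ?thesis unfolding wsum_def UNIV_Times_UNIV
    proof (rule summable_on_comparison_test)
      fix z :: "nat \<times> nat"
      obtain m n where z: "z = (m, n)" by (cases z)
      have "w m n * \<epsilon> ^ n \<le> C ^ n * w m 0 * (1 / (2 * C)) ^ n"
        using w_row_le[of m n] \<epsilon> C less_imp_le[OF w_pos] by (intro mult_mono power_mono) (auto simp: C_def)
      also have "\<dots> = w m 0 * (1/2) ^ n" using C by (simp add: power_divide power_mult_distrib)
      finally have "br3 ^ m * (w m n * \<epsilon> ^ n) \<le> br3 ^ m * (w m 0 * (1/2) ^ n)" using b3 by (intro mult_left_mono) auto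
      thus "(case z of (m, n) \<Rightarrow> w m n * br3 ^ m * \<epsilon> ^ n) \<le> (case z of (m, n) \<Rightarrow> w m 0 * br3 ^ m * (1/2) ^ n)"
        by (simp add: z mult_ac)
    qed (use less_imp_le[OF w_pos] b3 \<epsilon> in auto)
  qed
  define cs where "cs = (\<lambda>n. \<Sum>\<^sub>\<infinity>m. w m n * br3 ^ m)"
  have cs: "((\<lambda>m. w m n * br3 ^ m) has_sum cs n) UNIV" for n
  proof -
    have "(\<lambda>(m, n). w m n * br3 ^ m * \<epsilon> ^ n) summable_on ((\<lambda>m. (m, n)) ` UNIV)"
      using ws unfolding wsum_def by (rule summable_on_subset_banach) auto
    hence "(\<lambda>m. w m n * br3 ^ m * \<epsilon> ^ n) summable_on UNIV"
      by (subst (asm) summable_on_reindex) (auto simp: inj_on_def o_def)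
    hence "(\<lambda>m. w m n * br3 ^ m * \<epsilon> ^ n * inverse (\<epsilon> ^ n)) summable_on UNIV"
      by (rule summable_on_cmult_left)
    hence "(\<lambda>m. w m n * br3 ^ m) summable_on UNIV"
      using \<epsilon>(1) by (simp add: mult.assoc)
    thus ?thesis unfolding cs_def by simp
  qed
  have cs0: "0 \<le> cs n" for n using cs by (rule has_sum_nonneg) (use less_imp_le[OF w_pos] b3 in auto)
  have gs: "(\<lambda>n. of_real (cs n) * y ^ n) sums gfun (of_real br3) y" if y: "norm y < \<epsilon>" for y
  proof -
    have "wsum br3 (norm y)" using wsum_mono[OF ws] y b3 by auto
    hence "(\<lambda>(m, n). of_real (w m n) * complex_of_real br3 ^ m * y ^ n) summable_on UNIV"
      using b3 less_imp_le[OF w_pos] unfolding wsum_def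
      by - (rule abs_summable_summable, simp add: norm_mult norm_power case_prod_unfold)
    hence "((\<lambda>(m, n). of_real (w m n) * complex_of_real br3 ^ m * y ^ n) has_sum gfun (of_real br3) y) (UNIV \<times> UNIV)"
      unfolding gfun_def by simp
    hence S1: "((\<lambda>(n, m). of_real (w m n) * complex_of_real br3 ^ m * y ^ n) has_sum gfun (of_real br3) y) (UNIV \<times> UNIV)"
      by (subst (asm) has_sum_swap) simp
    have S2: "((\<lambda>m. of_real (w m n) * complex_of_real br3 ^ m * y ^ n) has_sum (of_real (cs n) * y ^ n)) UNIV" for n
      using has_sum_cmult_left[OF has_sum_of_real[OF cs[of n], where ?'a = complex], of "y ^ n"] by simp
    have "((\<lambda>n. of_real (cs n) * y ^ n) has_sum gfun (of_real br3) y) UNIV"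
      by (rule has_sum_SigmaD[OF S1]) (use S2 in simp)
    thus ?thesis by (rule has_sum_imp_sums)
  qed
  define A3 where "A3 = Mr / Dr"
  define \<psi> where "\<psi> = (\<lambda>y. Df (of_real br3) y * of_real A3 - Mf (of_real br3) y)"
  define \<xi> where "\<xi> = 1 / complex_of_real br3 - 1"
  \<comment> \<open>\<open>y * \<psi> y\<close>, free of the pole at 0; correspondingly
    \<open>kern * y\<close> is the quadratic \<open>l2 * (y - rad) ^ 2\<close>.\<close>
  define chi where "chi = (\<lambda>y. of_real (a2 * A3) * ((1 - y) - of_real t1 * \<xi> * y)
     - (of_real a1 * (of_real t2 * (1 - y) - \<xi> * y) * axis2 y - (of_real (a2 * t1) * \<xi> * y + of_real (a1 * t2) * (1 - y)) * of_real (w 0 0)))"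
  have chi\<psi>: "chi y = y * \<psi> y" if "y \<noteq> 0" for y
  proof -
    have e: "y * (1 / y - 1) = 1 - y" using that by (simp add: algebra_simps)
    have "y * \<psi> y = of_real (a2 * A3) * (y * (1 / y - 1) - of_real t1 * \<xi> * y)
     - (of_real a1 * (of_real t2 * (y * (1 / y - 1)) - \<xi> * y) * axis2 y - (of_real (a2 * t1) * \<xi> * y + of_real (a1 * t2) * (y * (1 / y - 1))) * of_real (w 0 0))"
      unfolding \<psi>_def Df_def Mf_def \<xi>_def [symmetric] by (simp add: algebra_simps)
    thus ?thesis unfolding e chi_def by simp
  qed
  have hol: "chi holomorphic_on ball 0 rad2"
    unfolding chi_def by (intro holomorphic_intros axis2_holomorphic)
  have \<psi>0: "\<psi> (of_real rad) = 0"
    unfolding \<psi>_def MD_rad using Dr by (simp add: A3_def)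
  have "(\<psi> has_field_derivative of_real (- (a2 / rad ^ 2) * A3 - Mfy)) (at (of_real rad))"
  proof -
    have rc: "complex_of_real rad \<noteq> 0" using r by simp
    have i: "((\<lambda>y. 1 / y) has_field_derivative - of_real (1 / rad ^ 2)) (at (complex_of_real rad))"
    proof -
      have "((\<lambda>y. 1 / y) has_field_derivative (0 * of_real rad - 1 * 1) / (of_real rad * of_real rad)) (at (complex_of_real rad))"
        by (rule DERIV_divide[OF DERIV_const DERIV_ident rc])
      thus ?thesis by (simp add: power2_eq_square)
    qed
    have d: "deriv axis2 (of_real rad) = of_real (Re (deriv axis2 (of_real rad)))"
      using axis2_deriv_Im[of rad] rad2(1) r by (simp add: complex_eq_iff)
    have B: "(axis2 has_field_derivative of_real (Re (deriv axis2 (of_real rad)))) (at (of_real rad))"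
      unfolding d [symmetric] using axis2_deriv[of "of_real rad"] rad2(1) r by simp
    have e: "axis2 (of_real rad) = of_real (Re (axis2 (of_real rad)))"
      using axis2_of_real[of rad] rad2(1) r by (simp add: complex_eq_iff)
    have "(\<psi> has_field_derivative of_real a2 * (- of_real (1 / rad ^ 2) - 0 - 0) * of_real A3
        - (of_real a1 * (of_real t2 * (- of_real (1 / rad ^ 2) - 0) - 0) * axis2 (of_real rad)
           + of_real (Re (deriv axis2 (of_real rad))) * (of_real a1 * (of_real t2 * (1 / of_real rad - 1) - \<xi>))
           - (0 + of_real (a1 * t2) * (- of_real (1 / rad ^ 2) - 0)) * of_real (w 0 0))) (at (of_real rad))"
      unfolding \<psi>_def Df_def Mf_def \<xi>_def [symmetric]
      by (rule DERIV_diff DERIV_mult DERIV_cmult DERIV_cmult_right DERIV_add DERIV_const i B)+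
    also have "of_real a2 * (- of_real (1 / rad ^ 2) - 0 - 0) * of_real A3
        - (of_real a1 * (of_real t2 * (- of_real (1 / rad ^ 2) - 0) - 0) * axis2 (of_real rad)
           + of_real (Re (deriv axis2 (of_real rad))) * (of_real a1 * (of_real t2 * (1 / of_real rad - 1) - \<xi>))
           - (0 + of_real (a1 * t2) * (- of_real (1 / rad ^ 2) - 0)) * of_real (w 0 0))
       = complex_of_real (- (a2 / rad ^ 2) * A3 - Mfy)"
      unfolding Mfy_def \<xi>_def by (subst e) (simp add: mult_ac)
    finally show ?thesis .
  qed
  also have "- (a2 / rad ^ 2) * A3 - Mfy = 0" unfolding MD A3_def by simp
  finally have \<psi>': "(\<psi> has_field_derivative 0) (at (of_real rad))" by simp
  have "((\<lambda>y. (y - of_real rad) * (chi y / (y - of_real rad) ^ 2)) \<longlongrightarrow> of_real rad * 0) (at (of_real rad))"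
  proof (rule Lim_transform_eventually)
    show "((\<lambda>y. y * ((\<psi> y - \<psi> (of_real rad)) / (y - of_real rad))) \<longlongrightarrow> of_real rad * 0) (at (of_real rad))"
      using \<psi>' by (intro tendsto_mult tendsto_ident_at) (simp add: has_field_derivative_iff)
    have "\<forall>\<^sub>F y in at (complex_of_real rad). y \<in> - {0}" using r by (intro eventually_at_in_open') auto
    moreover have "\<forall>\<^sub>F y in at (complex_of_real rad). y \<noteq> of_real rad" by (simp add: eventually_at_filter)
    ultimately show "\<forall>\<^sub>F y in at (complex_of_real rad). y * ((\<psi> y - \<psi> (of_real rad)) / (y - of_real rad))
        = (y - of_real rad) * (chi y / (y - of_real rad) ^ 2)"
      by eventually_elim (simp add: chi\<psi> \<psi>0 power2_eq_square)
  qed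
  moreover have "(\<lambda>y. chi y / (y - of_real rad) ^ 2) holomorphic_on ball 0 rad2 - {of_real rad}"
    using holomorphic_on_subset[OF hol] by (intro holomorphic_intros) auto
  moreover have "complex_of_real rad \<in> interior (ball 0 rad2)" using rad2(1) r by simp
  ultimately obtain h where h: "h holomorphic_on ball 0 rad2"
    and h_eq: "\<And>y. y \<in> ball 0 rad2 - {of_real rad} \<Longrightarrow> h y = chi y / (y - of_real rad) ^ 2"
    using holomorphic_on_extend_lim[of "\<lambda>y. chi y / (y - of_real rad) ^ 2" "ball 0 rad2" "of_real rad"] by auto
  have gh: "h y = of_real l2 * gfun (of_real br3) y" if y: "norm y < \<epsilon>" for y
  proof -
    have yr: "y \<noteq> of_real rad" using y \<epsilon> r by auto
    have hy: "h y * (y - of_real rad) ^ 2 = chi y" using h_eq[of y] y \<epsilon> yr by simp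
    show ?thesis
    proof (cases "y = 0")
      case True
      have "h 0 * of_real (rad ^ 2) = of_real (a2 * A3)"
        using hy unfolding True chi_def axis2_def by (simp add: powser_zero)
      moreover have "gfun (of_real br3) 0 = of_real A3"
      proof -
        have "gfun (of_real br3) 0 = of_real (cs 0)" using gs[of 0] \<epsilon> by (simp add: sums_iff powser_zero)
        also have "complex_of_real (cs 0) = axis1 (of_real br3)"
          using has_sum_imp_sums[OF has_sum_of_real[OF cs[of 0], where ?'a = complex]] by (simp add: axis1_def sums_iff)
        finally show ?thesis using axis1_br3[OF np] by (simp add: A3_def)
      qed
      moreover have "complex_of_real (a2 * A3) = of_real (l2 * A3) * of_real (rad ^ 2)"
      proof -
        have "a2 = l2 * rad ^ 2" using gm_rad(5) rate_pos by simp
        hence "a2 * A3 = (l2 * A3) * rad ^ 2" by (simp only: mult_ac)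
        thus ?thesis by (simp only: of_real_mult)
      qed
      ultimately have "h 0 * of_real (rad ^ 2) = of_real (l2 * A3) * of_real (rad ^ 2)" by simp
      hence "h 0 = of_real (l2 * A3)" using r by simp
      with \<open>gfun (of_real br3) 0 = of_real A3\<close> show ?thesis using True by simp
    next
      case False
      have "wsum (norm (complex_of_real br3)) (norm y)" using wsum_mono[OF ws] y b3 by auto
      from fundamental_equation[OF _ False this]
      have "kern (of_real br3) y * gfun (of_real br3) y = \<psi> y"
        unfolding \<psi>_def Df_def Mf_def using b3 axis1_br3[OF np] by (simp add: A3_def algebra_simps)
      hence "chi y = kern (of_real br3) y * y * gfun (of_real br3) y" unfolding chi\<psi>[OF False] by (simp add: mult_ac)
      also have "\<dots> = of_real l2 * (y - of_real rad) ^ 2 * gfun (of_real br3) y" unfolding kern_br3_complex[OF False] ..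
      finally have "h y * (y - of_real rad) ^ 2 = (of_real l2 * gfun (of_real br3) y) * (y - of_real rad) ^ 2"
        unfolding hy by (simp add: mult_ac)
      thus ?thesis using yr by simp
    qed
  qed
  define r1 where "r1 = (rad + rad2) / 2"
  have r1: "rad < r1" "r1 < rad2" using rad2(1) by (auto simp: r1_def)
  have "(\<lambda>n. of_real (cs n) * complex_of_real r1 ^ n) sums (h (of_real r1) / of_real l2)"
  proof (rule sums_extend_ball[OF \<epsilon>(1), where f = "\<lambda>y. h y / of_real l2"])
    show "(\<lambda>n. of_real (cs n) * y ^ n) sums (h y / of_real l2)" if "norm y < \<epsilon>" for y
      using gs[OF that] gh[OF that] rate_pos by simp
    show "(\<lambda>y. h y / of_real l2) holomorphic_on ball 0 rad2" using h rate_pos by (intro holomorphic_intros) auto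
  qed (use r1 r in auto)
  hence "summable (\<lambda>n. complex_of_real (cs n * r1 ^ n))" by (simp add: sums_iff)
  hence "summable (\<lambda>n. cs n * r1 ^ n)" by (simp only: summable_complex_of_real)
  hence "(\<lambda>n. cs n * r1 ^ n) summable_on UNIV"
    using cs0 r1 r by (subst summable_on_UNIV_nonneg_real_iff) auto
  hence "(\<lambda>(n, m). w m n * br3 ^ m * r1 ^ n) summable_on UNIV \<times> UNIV"
    using cs less_imp_le[OF w_pos] b3 r1 r
    by (intro summable_on_SigmaI[where g = "\<lambda>n. cs n * r1 ^ n"]) (auto intro!: has_sum_cmult_left)
  hence "wsum br3 r1"
    unfolding wsum_def UNIV_Times_UNIV [symmetric] by (subst (asm) summable_on_swap) simp
  moreover have "\<not> wsum br3 r1"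
  proof (rule not_wsum_beyond_double_root)
    show "l2 * rad = a2 / rad" using gm_rad by simp
    show "kern br3 rad = 0" by (rule kern_br3)
    show "a1 / br3\<^sup>2 < l1"
    proof -
      have "a1 \<le> l1 * br3" using br_bounds(5) rate_pos by (simp add: field_simps)
      also have "\<dots> < l1 * br3 * br3" using rate_pos b3 by simp
      finally show ?thesis using b3 by (simp add: field_simps power2_eq_square)
    qed
    \<comment> \<open>On the bottom row the generator differs from the kernel by \<open>Dr\<close>,
      so the remaining hypothesis is \<open>Dr > 0\<close>.\<close>
    have "l1 * (br3 - 1) + l2 * (rad - 1) + (a1 + a2 * t1) * (1 / br3 - 1) = kern br3 rad - Dr"
      by (simp add: kern_def Dr_def algebra_simps add_divide_distrib)
    thus "l1 * (br3 - 1) + l2 * (rad - 1) + (a1 + a2 * t1) * (1 / br3 - 1) < 0" using Dr kern_br3 by simp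
  qed (use b3 r r1 in auto)
  ultimately show False by simp
qed

end

section \<open>The retrial queue\<close>

text \<open>Service ends at rate \<open>mu\<close>, and the next event in the idle state is a
  retrial from orbit \<open>i\<close> with probability \<open>mu_i / alpha\<close>. If the other
  orbit is empty, the denominator shrinks to \<open>lam + mu_i\<close>; \<open>frac1\<close> and
  \<open>frac2\<close> are these larger probabilities.\<close>

definition "down1 P = mu P * mu1 P / alpha P"
definition "down2 P = mu P * mu2 P / alpha P"
definition "frac1 P = mu1 P / (lam P + mu1 P)"
definition "frac2 P = mu2 P / (lam P + mu2 P)"

locale retrial_queue =
  fixes P :: retrial_params and p :: "state \<Rightarrow> real"
  assumes params_pos: "lam1 P > 0" "lam2 P > 0" "mu P > 0" "mu1 P > 0" "mu2 P > 0"
    and stability: "lam P * (lam1 P + mu1 P) < mu P * mu1 P"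
    and drift: "lamh1 P < muh1 P"
    and stationary: "stationary_distribution P p"
begin

lemma lam_alpha: "0 < lam P" "0 < alpha P" "alpha P = lam P + mu1 P + mu2 P"
  using params_pos by (auto simp: lam_def alpha_def)

lemma p_nonneg: "0 \<le> p s" and p_sum: "(p has_sum 1) UNIV"
  and global_balance: "(\<Sum>\<^sub>\<infinity>t. p t * rate P t s) = p s * (\<Sum>\<^sub>\<infinity>t. rate P s t)"
  using stationary unfolding stationary_distribution_def by blast+

section \<open>Elimination of the idle states\<close>

lemma has_sum_single: "((\<lambda>t. if b \<and> t = a then c else 0) has_sum (if b then c else (0::real))) UNIV"
  by (rule has_sum_finite_neutralI[of "{a}"]) auto

lemma has_sum_single': "((\<lambda>t. if t = a then c else 0) has_sum (c::real)) UNIV"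
  using has_sum_single[of True a c] by simp

lemma outflow_idle: "(\<Sum>\<^sub>\<infinity>t. rate P (m, n, Idle) t) = lam P + (if 1 \<le> m then mu1 P else 0) + (if 1 \<le> n then mu2 P else 0)"
  unfolding rate.simps by (intro infsumI has_sum_add has_sum_single has_sum_single')

lemma outflow_busy: "(\<Sum>\<^sub>\<infinity>t. rate P (m, n, Busy) t) = lam P + mu P"
  unfolding rate.simps lam_def by (intro infsumI has_sum_add has_sum_single')

lemma balance_idle:
  "mu P * p (m, n, Busy) = (lam P + (if 1 \<le> m then mu1 P else 0) + (if 1 \<le> n then mu2 P else 0)) * p (m, n, Idle)"
proof -
  have "(\<lambda>t. p t * rate P t (m, n, Idle)) = (\<lambda>t. if t = (m, n, Busy) then p (m, n, Busy) * mu P else 0)"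
  proof
    fix t :: state
    obtain a b k where t: "t = (a, b, k)" by (cases t)
    show "p t * rate P t (m, n, Idle) = (if t = (m, n, Busy) then p (m, n, Busy) * mu P else 0)"
      by (cases k) (auto simp: t)
  qed
  hence "(\<Sum>\<^sub>\<infinity>t. p t * rate P t (m, n, Idle)) = p (m, n, Busy) * mu P"
    by (simp only:) (intro infsumI has_sum_single')
  thus ?thesis using global_balance[of "(m, n, Idle)"] unfolding outflow_idle by (simp add: mult.commute)
qed

lemma balance_busy:
  "(lam P + mu P) * p (m, n, Busy) = lam P * p (m, n, Idle) + mu1 P * p (Suc m, n, Idle) + mu2 P * p (m, Suc n, Idle)
     + (if 1 \<le> m then lam1 P * p (m - 1, n, Busy) else 0) + (if 1 \<le> n then lam2 P * p (m, n - 1, Busy) else 0)"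
proof -
  have eq: "(\<lambda>t. p t * rate P t (m, n, Busy)) = (\<lambda>t. (if t = (m, n, Idle) then lam P * p (m, n, Idle) else 0)
      + (if t = (Suc m, n, Idle) then mu1 P * p (Suc m, n, Idle) else 0)
      + (if t = (m, Suc n, Idle) then mu2 P * p (m, Suc n, Idle) else 0)
      + (if 1 \<le> m \<and> t = (m - 1, n, Busy) then lam1 P * p (m - 1, n, Busy) else 0)
      + (if 1 \<le> n \<and> t = (m, n - 1, Busy) then lam2 P * p (m, n - 1, Busy) else 0))"
  proof
    fix t :: state
    obtain a b k where t: "t = (a, b, k)" by (cases t)
    show "p t * rate P t (m, n, Busy) = (if t = (m, n, Idle) then lam P * p (m, n, Idle) else 0)
      + (if t = (Suc m, n, Idle) then mu1 P * p (Suc m, n, Idle) else 0)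
      + (if t = (m, Suc n, Idle) then mu2 P * p (m, Suc n, Idle) else 0)
      + (if 1 \<le> m \<and> t = (m - 1, n, Busy) then lam1 P * p (m - 1, n, Busy) else 0)
      + (if 1 \<le> n \<and> t = (m, n - 1, Busy) then lam2 P * p (m, n - 1, Busy) else 0)"
    proof (cases k)
      case Idle
      have "p t * (if (m, n, Busy) = (a, b, Busy) then lam P else 0) = (if t = (m, n, Idle) then lam P * p (m, n, Idle) else 0)"
        by (auto simp: t Idle)
      moreover have "p t * (if 1 \<le> a \<and> (m, n, Busy) = (a - 1, b, Busy) then mu1 P else 0) = (if t = (Suc m, n, Idle) then mu1 P * p (Suc m, n, Idle) else 0)"
        by (cases a) (auto simp: t Idle)
      moreover have "p t * (if 1 \<le> b \<and> (m, n, Busy) = (a, b - 1, Busy) then mu2 P else 0) = (if t = (m, Suc n, Idle) then mu2 P * p (m, Suc n, Idle) else 0)"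
        by (cases b) (auto simp: t Idle)
      moreover have "t \<noteq> (m - 1, n, Busy)" "t \<noteq> (m, n - 1, Busy)" by (auto simp: t Idle)
      moreover have "rate P t (m, n, Busy) = (if (m, n, Busy) = (a, b, Busy) then lam P else 0)
          + (if 1 \<le> a \<and> (m, n, Busy) = (a - 1, b, Busy) then mu1 P else 0) + (if 1 \<le> b \<and> (m, n, Busy) = (a, b - 1, Busy) then mu2 P else 0)"
        unfolding t Idle by (rule rate.simps)
      ultimately show ?thesis by (simp only: distrib_left) simp
    next
      case Busy
      have "p t * (if (m, n, Busy) = (a + 1, b, Busy) then lam1 P else 0) = (if 1 \<le> m \<and> t = (m - 1, n, Busy) then lam1 P * p (m - 1, n, Busy) else 0)"
        by (cases m) (auto simp: t Busy)
      moreover have "p t * (if (m, n, Busy) = (a, b + 1, Busy) then lam2 P else 0) = (if 1 \<le> n \<and> t = (m, n - 1, Busy) then lam2 P * p (m, n - 1, Busy) else 0)"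
        by (cases n) (auto simp: t Busy)
      moreover have "t \<noteq> (m, n, Idle)" "t \<noteq> (Suc m, n, Idle)" "t \<noteq> (m, Suc n, Idle)" by (auto simp: t Busy)
      moreover have "rate P t (m, n, Busy) = (if (m, n, Busy) = (a + 1, b, Busy) then lam1 P else 0)
          + (if (m, n, Busy) = (a, b + 1, Busy) then lam2 P else 0)"
        unfolding t Busy rate.simps by simp
      ultimately show ?thesis by (simp only: distrib_left) simp
    qed
  qed
  have "(\<Sum>\<^sub>\<infinity>t. p t * rate P t (m, n, Busy)) = lam P * p (m, n, Idle) + mu1 P * p (Suc m, n, Idle) + mu2 P * p (m, Suc n, Idle)
     + (if 1 \<le> m then lam1 P * p (m - 1, n, Busy) else 0) + (if 1 \<le> n then lam2 P * p (m, n - 1, Busy) else 0)"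
    unfolding eq by (intro infsumI has_sum_add has_sum_single has_sum_single')
  thus ?thesis using global_balance[of "(m, n, Busy)"] unfolding outflow_busy by (simp add: mult.commute)
qed

lemma idle_eq:
  "p (m, n, Idle) = mu P * p (m, n, Busy) / (lam P + (if 1 \<le> m then mu1 P else 0) + (if 1 \<le> n then mu2 P else 0))"
proof -
  have "0 < lam P + (if 1 \<le> m then mu1 P else 0) + (if 1 \<le> n then mu2 P else 0)"
    using params_pos lam_alpha by (auto intro: add_pos_pos)
  thus ?thesis using balance_idle[of m n] by (simp add: nonzero_eq_divide_eq mult.commute)
qed

text \<open>With the other orbit empty, its share of the idle clock is redistributed between
  arrivals and the nonempty orbit, the latter receiving the fraction \<open>frac1\<close> or
  \<open>frac2\<close>.\<close>

lemma edge_rate: "down1 P + down2 P * frac1 P = mu P * mu1 P / (lam P + mu1 P)"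
  "down2 P + down1 P * frac2 P = mu P * mu2 P / (lam P + mu2 P)"
proof -
  have "X * Y / (L + Y + Z) + X * Z / (L + Y + Z) * (Y / (L + Y)) = X * Y / (L + Y)"
    if "0 < L" "0 < Y" "0 < Z" for X Y Z L :: real
  proof -
    define T where "T = L + Y"
    have T: "T \<noteq> 0" "T + Z \<noteq> 0" using that by (auto simp: T_def)
    have "X * Y / (T + Z) + X * Z / (T + Z) * (Y / T) = X * Y / (T + Z) * (1 + Z / T)"
      by (simp add: distrib_left)
    also have "1 + Z / T = (T + Z) / T" using T by (simp add: add_divide_distrib)
    also have "X * Y / (T + Z) * ((T + Z) / T) = X * Y / T" using T by simp
    finally show ?thesis by (simp add: T_def)
  qed
  note edge = this
  show "down1 P + down2 P * frac1 P = mu P * mu1 P / (lam P + mu1 P)"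
    unfolding down1_def down2_def frac1_def lam_alpha(3)
    using lam_alpha params_pos by (intro edge)
  have "alpha P = lam P + mu2 P + mu1 P" using lam_alpha(3) by simp
  thus "down2 P + down1 P * frac2 P = mu P * mu2 P / (lam P + mu2 P)"
    unfolding down1_def down2_def frac2_def
    using edge[of "lam P" "mu2 P" "mu1 P" "mu P"] lam_alpha params_pos by (simp only:)
qed

lemma left_rate_idle:
  "left_rate (down1 P) (down2 P) (frac1 P) (Suc m) n = mu P * mu1 P / (lam P + mu1 P + (if 1 \<le> n then mu2 P else 0))"
  "left_rate (down2 P) (down1 P) (frac2 P) (Suc n) m = mu P * mu2 P / (lam P + (if 1 \<le> m then mu1 P else 0) + mu2 P)"
  unfolding left_rate_def edge_rate by (auto simp: down1_def down2_def lam_alpha(3))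

lemma walk_balance:
  "(lam1 P + lam2 P + left_rate (down1 P) (down2 P) (frac1 P) m n + left_rate (down2 P) (down1 P) (frac2 P) n m) * p (m, n, Busy) =
       (case m of 0 \<Rightarrow> 0 | Suc i \<Rightarrow> lam1 P * p (i, n, Busy)) + (case n of 0 \<Rightarrow> 0 | Suc j \<Rightarrow> lam2 P * p (m, j, Busy)) +
       left_rate (down1 P) (down2 P) (frac1 P) (Suc m) n * p (Suc m, n, Busy) +
       left_rate (down2 P) (down1 P) (frac2 P) (Suc n) m * p (m, Suc n, Busy)"
proof -
  define e where "e = (if 1 \<le> m then mu1 P else 0)"
  define f where "f = (if 1 \<le> n then mu2 P else 0)"
  have ef: "0 \<le> e" "0 \<le> f" using params_pos by (auto simp: e_def f_def)
  have L: "left_rate (down1 P) (down2 P) (frac1 P) m n = mu P * e / (lam P + e + f)"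
    using left_rate_idle(1)[of "m - 1" n] by (cases m) (auto simp: e_def f_def left_rate_def)
  have D: "left_rate (down2 P) (down1 P) (frac2 P) n m = mu P * f / (lam P + e + f)"
    using left_rate_idle(2)[of "n - 1" m] by (cases n) (auto simp: e_def f_def left_rate_def)
  have s: "lam P + e + f \<noteq> 0" using ef lam_alpha by linarith
  \<comment> \<open>The term \<open>lam * mu / (lam + e + f)\<close> is the rate of idle periods
    ended by a fresh arrival: they return to the same busy state and cancel from the
    balance.\<close>
  have E: "lam1 P + lam2 P + mu P * e / (lam P + e + f) + mu P * f / (lam P + e + f) = lam P + mu P - lam P * mu P / (lam P + e + f)"
  proof -
    have "mu P * e / (lam P + e + f) + mu P * f / (lam P + e + f) + lam P * mu P / (lam P + e + f)
        = mu P * (lam P + e + f) / (lam P + e + f)"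
      by (simp add: add_divide_distrib [symmetric] algebra_simps)
    also have "\<dots> = mu P" using s by simp
    finally show ?thesis by (simp add: lam_def)
  qed
  have "(lam1 P + lam2 P + mu P * e / (lam P + e + f) + mu P * f / (lam P + e + f)) * p (m, n, Busy)
      = (lam P + mu P) * p (m, n, Busy) - lam P * p (m, n, Idle)"
    unfolding idle_eq[of m n] e_def [symmetric] f_def [symmetric] by (simp only: E left_diff_distrib) simp
  also have "\<dots> = mu1 P * p (Suc m, n, Idle) + mu2 P * p (m, Suc n, Idle)
     + (if 1 \<le> m then lam1 P * p (m - 1, n, Busy) else 0) + (if 1 \<le> n then lam2 P * p (m, n - 1, Busy) else 0)"
    unfolding balance_busy[of m n] by simp
  also have "mu1 P * p (Suc m, n, Idle) = left_rate (down1 P) (down2 P) (frac1 P) (Suc m) n * p (Suc m, n, Busy)"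
    unfolding left_rate_idle idle_eq[of "Suc m" n] by simp
  also have "mu2 P * p (m, Suc n, Idle) = left_rate (down2 P) (down1 P) (frac2 P) (Suc n) m * p (m, Suc n, Busy)"
    unfolding left_rate_idle idle_eq[of m "Suc n"] by simp
  finally show ?thesis unfolding L D by (cases m; cases n) auto
qed

lemma walk_rates_pos: "0 < down1 P" "0 < down2 P" "0 < frac1 P" "frac1 P < 1" "0 < frac2 P" "frac2 P < 1"
  using params_pos lam_alpha
  by (auto simp: down1_def down2_def frac1_def frac2_def divide_less_eq add_pos_pos)

text \<open>Irreducibility by hand. If a busy probability is 0, so are its inflows, hence its right
  and upper neighbours; a zero at the origin would kill all mass. Positivity at the origin then
  spreads upwards through arrivals.\<close>

lemma busy_pos: "0 < p (m, n, Busy)"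
proof -
  let ?L = "left_rate (down1 P) (down2 P) (frac1 P)" and ?D = "left_rate (down2 P) (down1 P) (frac2 P)"
  have L: "0 \<le> ?L i j" "0 < ?L (Suc i) j" "0 \<le> ?D i j" "0 < ?D (Suc i) j" for i j
    using walk_rates_pos by (auto simp: left_rate_def intro!: add_pos_pos add_nonneg_nonneg)
  have nn: "0 \<le> (case m of 0 \<Rightarrow> 0 | Suc i \<Rightarrow> lam1 P * p (i, n, Busy))" "0 \<le> (case n of 0 \<Rightarrow> 0 | Suc j \<Rightarrow> lam2 P * p (m, j, Busy))"
    "0 \<le> ?L (Suc m) n * p (Suc m, n, Busy)" "0 \<le> ?D (Suc n) m * p (m, Suc n, Busy)" for m n
    using params_pos p_nonneg L by (auto split: nat.splits)
  have out: "0 < lam1 P + lam2 P + ?L m n + ?D n m" for m n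
    using params_pos L(1)[of m n] L(3)[of n m] by linarith
  have z: "p (Suc m, n, Busy) = 0" "p (m, Suc n, Busy) = 0" if "p (m, n, Busy) = 0" for m n
  proof -
    have "?L (Suc m) n * p (Suc m, n, Busy) = 0" "?D (Suc n) m * p (m, Suc n, Busy) = 0"
    proof -
      have "(case m of 0 \<Rightarrow> 0 | Suc i \<Rightarrow> lam1 P * p (i, n, Busy)) + (case n of 0 \<Rightarrow> 0 | Suc j \<Rightarrow> lam2 P * p (m, j, Busy)) +
          ?L (Suc m) n * p (Suc m, n, Busy) + ?D (Suc n) m * p (m, Suc n, Busy) = 0"
        unfolding walk_balance [symmetric] that by simp
      thus "?L (Suc m) n * p (Suc m, n, Busy) = 0" "?D (Suc n) m * p (m, Suc n, Busy) = 0"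
        using nn[where m = m and n = n] by linarith+
    qed
    thus "p (Suc m, n, Busy) = 0" "p (m, Suc n, Busy) = 0" using L(2)[of m n] L(4)[of n m] by simp_all
  qed
  have "p (0, 0, Busy) \<noteq> 0"
  proof
    assume 0: "p (0, 0, Busy) = 0"
    have 1: "p (m, 0, Busy) = 0" for m by (induction m) (use 0 z in auto)
    have 2: "p (m, n, Busy) = 0" for m n by (induction n) (use 1 z in auto)
    have "p s = 0" for s
    proof -
      obtain m n k where s: "s = (m, n, k)" by (cases s)
      show ?thesis by (cases k) (simp_all add: s idle_eq 2)
    qed
    hence "(p has_sum 0) UNIV" by (simp add: has_sum_0)
    thus False using p_sum has_sum_unique by fastforce
  qed
  hence 00: "0 < p (0, 0, Busy)" using p_nonneg[of "(0, 0, Busy)"] by simp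
  have up1: "0 < p (Suc m, n, Busy)" if "0 < p (m, n, Busy)" for m n
  proof -
    have "0 < lam1 P * p (m, n, Busy)" using that params_pos by simp
    hence "0 < (lam1 P + lam2 P + ?L (Suc m) n + ?D n (Suc m)) * p (Suc m, n, Busy)"
      using walk_balance[of "Suc m" n] nn(2-4)[where m = "Suc m" and n = n] by simp
    thus ?thesis using out[where m = "Suc m" and n = n] by (simp add: zero_less_mult_iff)
  qed
  have up2: "0 < p (m, Suc n, Busy)" if "0 < p (m, n, Busy)" for m n
  proof -
    have "0 < lam2 P * p (m, n, Busy)" using that params_pos by simp
    hence "0 < (lam1 P + lam2 P + ?L m (Suc n) + ?D (Suc n) m) * p (m, Suc n, Busy)"
      using walk_balance[of m "Suc n"] nn(1,3,4)[where m = m and n = "Suc n"] by simp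
    thus ?thesis using out[where m = m and n = "Suc n"] by (simp add: zero_less_mult_iff)
  qed
  have "0 < p (m, 0, Busy)" for m by (induction m) (use 00 up1 in auto)
  thus ?thesis by (induction n) (use up2 in auto)
qed

lemma summable_busy: "(\<lambda>(m, n). p (m, n, Busy)) summable_on UNIV"
proof -
  have "p summable_on UNIV" using p_sum by (auto simp: summable_on_def)
  hence "p summable_on ((\<lambda>(m, n). (m, n, Busy)) ` UNIV)"
    by (rule summable_on_subset_banach) simp
  hence "(p \<circ> (\<lambda>(m, n). (m, n, Busy))) summable_on UNIV"
    by (subst (asm) summable_on_reindex) (auto simp: inj_on_def)
  thus ?thesis by (simp add: o_def case_prod_unfold)
qed

lemma orbit_walk_busy: "orbit_walk (lam1 P) (lam2 P) (down1 P) (down2 P) (frac1 P) (frac2 P) (\<lambda>m n. p (m, n, Busy))"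
  by (rule orbit_walk.intro) (rule params_pos walk_rates_pos busy_pos walk_balance summable_busy)+

lemma walk_drift: "lam1 P < down1 P"
  using drift lam_alpha(2) by (simp add: lamh1_def muh1_def down1_def less_divide_eq mult.commute)

lemma walk_stable: "lam1 P + lam2 P * frac1 P < down1 P + down2 P * frac1 P"
proof -
  have nz: "lam P + mu1 P \<noteq> 0" "0 < lam P + mu1 P" using lam_alpha params_pos by auto
  have "(lam1 P + lam2 P * frac1 P) * (lam P + mu1 P) = lam1 P * (lam P + mu1 P) + lam2 P * (frac1 P * (lam P + mu1 P))"
    by (simp add: algebra_simps)
  also have "frac1 P * (lam P + mu1 P) = mu1 P" using nz by (simp add: frac1_def)
  also have "lam1 P * (lam P + mu1 P) + lam2 P * mu1 P = lam P * (lam1 P + mu1 P)" by (simp add: lam_def algebra_simps)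
  also have "\<dots> < mu P * mu1 P" by (rule stability)
  finally show ?thesis unfolding edge_rate using nz by (simp add: less_divide_eq)
qed

end

sublocale retrial_queue \<subseteq> stable_orbit_walk "lam1 P" "lam2 P" "down1 P" "down2 P" "frac1 P" "frac2 P" "\<lambda>m n. p (m, n, Busy)"
  by (rule stable_orbit_walk.intro[OF orbit_walk_busy stable_orbit_walk_axioms.intro[OF walk_drift walk_stable]])

lemma tail_ratio:
  fixes a :: "nat \<Rightarrow> real"
  assumes lim: "(\<lambda>n. a n * x ^ n * real n powr s) \<longlonglongrightarrow> l" and "l \<noteq> 0" "0 < x" "C * x ^ j = l"
  shows "(\<lambda>m. a m / (C * real m powr (- s) * (1 / x) ^ (m - j))) \<longlonglongrightarrow> 1"
proof (rule Lim_transform_eventually)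
  show "(\<lambda>n. (a n * x ^ n * real n powr s) / l) \<longlonglongrightarrow> 1"
    using tendsto_divide[OF lim tendsto_const[of l]] \<open>l \<noteq> 0\<close> by simp
  show "\<forall>\<^sub>F m in sequentially. (a m * x ^ m * real m powr s) / l = a m / (C * real m powr (- s) * (1 / x) ^ (m - j))"
    using eventually_ge_at_top[of "max 1 j"]
  proof eventually_elim
    case (elim m)
    have "C \<noteq> 0" using assms by auto
    have "x ^ m = x ^ j * x ^ (m - j)" using elim by (simp flip: power_add)
    hence "(a m * x ^ m * real m powr s) / l = (a m * x ^ (m - j) * real m powr s) / C"
      unfolding \<open>C * x ^ j = l\<close> [symmetric] using assms(3) by simp
    also have "\<dots> = a m / (C * real m powr (- s) * (1 / x) ^ (m - j))"
      using elim assms(3) by (simp add: powr_minus divide_inverse power_inverse)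
    finally show ?case .
  qed
qed

text \<open>The boundary generating functions start at index 1, whereas \<open>axis1\<close> and
  \<open>axis2\<close> include the term at the origin.\<close>

lemma sums_drop_first:
  fixes z :: complex
  assumes "(\<lambda>n. a n * z ^ n) sums s"
  shows "(\<lambda>n. a (Suc n) * z ^ n) sums (if z = 0 then a 1 else (s - a 0) / z)"
proof (cases "z = 0")
  case True
  have "(\<lambda>n. a (Suc n) * 0 ^ n) sums a (Suc 0)" using powser_sums_zero[of "\<lambda>n. a (Suc n)"] by simp
  thus ?thesis using True by simp
next
  case False
  have "(\<lambda>n. a (Suc n) * z ^ Suc n) sums (s - a 0)"
    using assms by (subst sums_Suc_iff) simp
  from sums_divide[OF this, of z] False show ?thesis by simp
qed

context retrial_queue begin

section \<open>Constants of the queue in terms of the walk\<close>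

lemma hats: "lamh1 P = alpha P * lam1 P" "lamh2 P = alpha P * lam2 P" "muh1 P = alpha P * down1 P" "muh2 P = alpha P * down2 P"
  using lam_alpha(2) by (simp_all add: lamh1_def lamh2_def muh1_def muh2_def down1_def down2_def)

lemma sqrt_hats: "sqrt (lamh2 P * muh2 P) = alpha P * gm" "sqrt (muh2 P / lamh2 P) = rad" "muh1 P / lamh1 P = down1 P / lam1 P"
proof -
  have "lamh2 P * muh2 P = alpha P ^ 2 * (lam2 P * down2 P)" by (simp add: hats power2_eq_square)
  thus "sqrt (lamh2 P * muh2 P) = alpha P * gm"
    using lam_alpha(2) by (simp add: real_sqrt_mult gm_def)
  show "sqrt (muh2 P / lamh2 P) = rad" "muh1 P / lamh1 P = down1 P / lam1 P"
    using lam_alpha(2) by (simp_all add: hats rad_def)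
qed

lemma bhat_eq: "bhat P x = alpha P * (lam1 P * x ^ 2 - (lam1 P + lam2 P + down1 P + down2 P) * x + down1 P)"
  by (simp add: bhat_def hats algebra_simps)

lemma bplus_eq: "bplus P x = alpha P * lam1 P * ((x - br2) * (x - br3))"
proof -
  have "bplus P x = alpha P * (lam1 P * x ^ 2 - mid * x + down1 P)"
    unfolding bplus_def bhat_eq sqrt_hats mid_def by (simp add: algebra_simps)
  thus ?thesis unfolding br_quadratic by (simp add: mult_ac)
qed

lemma x23_eq: "x2 P = br2" "x3 P = br3"
proof -
  have "{x. bplus P x = 0} = {br2, br3}"
    using lam_alpha(2) params_pos by (auto simp: bplus_eq)
  thus "x2 P = br2" "x3 P = br3" using br_bounds(2) by (auto simp: x2_def x3_def)
qed

text \<open>\<open>bminus\<close> and \<open>bplus\<close> differ by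
  \<open>4 * x * alpha P * gm\<close>; evaluating at \<open>br3\<close>, a zero of
  \<open>bplus\<close>, gives the product of the distances to the outer branch points.\<close>

lemma bminus_x14: "bminus P x = alpha P * lam1 P * ((x - x1 P) * (x - x4 P))"
  and x14_product: "lam1 P * ((br3 - x1 P) * (x4 P - br3)) = 4 * br3 * gm"
proof -
  define c where "c = mid + 4 * gm"
  have bm: "bminus P z = alpha P * (lam1 P * z ^ 2 - c * z + down1 P)" for z
    unfolding bminus_def bhat_eq sqrt_hats c_def mid_def by (simp add: algebra_simps)
  have "mid ^ 2 \<le> c ^ 2" using mid_disc gm_rad(1) by (intro power_mono) (auto simp: c_def)
  hence disc: "0 < c ^ 2 - 4 * lam1 P * down1 P" using mid_disc by simp
  define u where "u = (c - sqrt (c ^ 2 - 4 * lam1 P * down1 P)) / (2 * lam1 P)"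
  define v where "v = (c + sqrt (c ^ 2 - 4 * lam1 P * down1 P)) / (2 * lam1 P)"
  have uv: "lam1 P * (u + v) = c" "lam1 P * (u * v) = down1 P"
    using quadratic_factor[of "lam1 P" "- c" "down1 P"] disc params_pos
    unfolding u_def v_def by simp_all
  have lt: "u < v" using disc params_pos by (simp add: u_def v_def divide_strict_right_mono)
  have f: "bminus P z = alpha P * lam1 P * ((z - u) * (z - v))" for z
  proof -
    have "alpha P * lam1 P * ((z - u) * (z - v)) = alpha P * (lam1 P * z ^ 2 - (lam1 P * (u + v)) * z + lam1 P * (u * v))"
      by (simp add: algebra_simps power2_eq_square)
    also have "\<dots> = bminus P z" unfolding uv bm ..
    finally show ?thesis by (rule sym)
  qed
  have "{x. bminus P x = 0} = {u, v}"
    using lam_alpha(2) params_pos by (auto simp: f)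
  hence e: "x1 P = u" "x4 P = v" using lt by (auto simp: x1_def x4_def)
  show "bminus P x = alpha P * lam1 P * ((x - x1 P) * (x - x4 P))" unfolding e by (rule f)
  have "bminus P br3 = bplus P br3 - 4 * br3 * (alpha P * gm)"
    unfolding bminus_def bplus_def sqrt_hats by simp
  also have "bplus P br3 = 0" by (simp add: bplus_eq)
  finally have "alpha P * (lam1 P * ((br3 - u) * (br3 - v))) = alpha P * (- (4 * br3 * gm))"
    unfolding f by (simp add: mult_ac)
  hence pr: "lam1 P * ((br3 - u) * (br3 - v)) = - (4 * br3 * gm)" using lam_alpha(2) by (metis less_irrefl mult_left_cancel)
  have "lam1 P * ((br3 - u) * (v - br3)) = - (lam1 P * ((br3 - u) * (br3 - v)))" by (simp add: algebra_simps)
  thus "lam1 P * ((br3 - x1 P) * (x4 P - br3)) = 4 * br3 * gm" unfolding pr e by simp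
qed

lemma g_eq: "g P x = (lam P + mu1 P) ^ 2 * Gq x"
proof -
  define L where "L = lam P + mu1 P"
  have L: "L \<noteq> 0" using lam_alpha params_pos by (simp add: L_def)
  have e: "frac1 P * L = mu1 P" "(down1 P + down2 P * frac1 P) * L = mu P * mu1 P"
    unfolding edge_rate L_def [symmetric] using L by (simp_all add: frac1_def L_def)
  have e3: "(1 - frac1 P) * L = lam P"
    using e(1) by (simp add: left_diff_distrib L_def)
  have "L ^ 2 * Gq x = (lam1 P * x * L - (down1 P + down2 P * frac1 P) * L) * ((1 - frac1 P) * L * x + frac1 P * L) + lam2 P * (frac1 P * L) * L * x"
    by (simp add: Gq_def algebra_simps power2_eq_square)
  also have "\<dots> = (lam1 P * x * L - mu P * mu1 P) * (lam P * x + mu1 P) + lam2 P * mu1 P * L * x"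
    unfolding e e3 ..
  also have "\<dots> = lam P * lam1 P * L * x ^ 2 + mu1 P * ((lam1 P + lam2 P) * L - mu P * lam P) * x - mu P * mu1 P ^ 2"
    by (simp add: algebra_simps power2_eq_square)
  also have "\<dots> = g P x"
    unfolding lam_def [symmetric] g_def L_def by (simp add: algebra_simps)
  finally show ?thesis by (simp add: L_def)
qed

lemma xpm_eq: "xplus P = xp" "xminus P = xm"
proof -
  have "g P x = 0 \<longleftrightarrow> x = xp \<or> x = xm" for x
    using lam_alpha params_pos walk_rates_pos by (auto simp: g_eq Gq_factor)
  thus "xplus P = xp" "xminus P = xm"
    unfolding xplus_def xminus_def using xpm by (auto intro!: the_equality)
qed

lemma Yxplus_eq: "Yxplus P = Yxp"
proof -
  have L: "lam P + mu1 P \<noteq> 0" using lam_alpha params_pos by simp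
  have z: "0 < zet xp" using zet_pos(1)[of xp] xpm by simp
  define k where "k = down1 P + down2 P * frac1 P"
  have k: "k * (lam P + mu1 P) = mu P * mu1 P" unfolding k_def edge_rate using L by simp
  have "Yxplus P = 1 - ((lam1 P * xp - k) * (lam P + mu1 P) * (xp - 1)) / (lam2 P * xp * (lam P + mu1 P))"
    unfolding Yxplus_def xpm_eq k [symmetric] by (simp add: algebra_simps)
  also have "\<dots> = 1 - ((lam1 P * xp - k) * (xp - 1)) / (lam2 P * xp)"
    using L by simp
  also have "\<dots> = Yxp"
  proof -
    have "Gq xp = 0" by (simp add: Gq_factor)
    moreover have zx: "zet xp * xp = (1 - frac1 P) * xp + frac1 P" using xpm by (simp add: zet_def field_simps)
    ultimately have "(lam1 P * xp - k) * (zet xp * xp) + lam2 P * frac1 P * xp = 0"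
      by (simp add: Gq_def k_def)
    hence "((lam1 P * xp - k) * zet xp + lam2 P * frac1 P) * xp = 0" by (simp add: algebra_simps)
    hence "(lam1 P * xp - k) * zet xp + lam2 P * frac1 P = 0" using xpm by simp
    hence "(lam1 P * xp - k) * zet xp = - (lam2 P * frac1 P)" by simp
    moreover have "lam1 P * xp - k = (lam1 P * xp - k) * zet xp / zet xp" using z by simp
    ultimately have kz: "lam1 P * xp - k = - (lam2 P * frac1 P) / zet xp" by simp
    have "1 - ((lam1 P * xp - k) * (xp - 1)) / (lam2 P * xp) = (zet xp * xp + frac1 P * (xp - 1)) / (zet xp * xp)"
      unfolding kz using z xpm params_pos by (simp add: field_simps)
    also have "zet xp * xp + frac1 P * (xp - 1) = xp" unfolding zx by (simp add: algebra_simps)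
    also have "xp / (zet xp * xp) = Yxp" using xpm by (simp add: Yxp_def)
    finally show ?thesis .
  qed
  finally show ?thesis .
qed

lemma condition1D: "condition1 P \<Longrightarrow> xp < br3 \<and> Yxp < rad"
  unfolding condition1_def sqrt_hats xpm_eq x23_eq Yxplus_eq by auto

lemma condition2D: "condition2 P \<Longrightarrow> xp = br3"
  unfolding condition2_def xpm_eq x23_eq by auto

lemma condition3D:
  assumes "condition3 P"
  shows no_pole
proof -
  have "down2 P \<le> lam2 P" if "muh2 P \<le> lamh2 P"
    using that lam_alpha(2) by (simp add: hats)
  thus ?thesis
    using assms unfolding condition3_def sqrt_hats xpm_eq x23_eq Yxplus_eq no_pole_def by auto
qed

definition "Mre x y = down1 P * (frac2 P * (1 / y - 1) - (1 / x - 1)) * Re (axis2 (of_real y))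
   - (down2 P * frac1 P * (1 / x - 1) + down1 P * frac2 P * (1 / y - 1)) * p (0, 0, Busy)"
definition "Dre x y = down2 P * ((1 / y - 1) - frac1 P * (1 / x - 1))"

text \<open>The disc of radius \<open>rad2\<close> is already a star-shaped domain of continuation,
  so no further continuation enters at the arguments used.\<close>

lemma pi2_eq:
  assumes "0 < y" "y < rad2"
  shows "y * pi2 p y = Re (axis2 (of_real y)) - p (0, 0, Busy)"
proof -
  define f where "f = (\<lambda>z. if z = 0 then complex_of_real (p (0, 1, Busy)) else (axis2 z - of_real (p (0, 0, Busy))) / z)"
  have "(\<lambda>n. complex_of_real (p (0, n + 1, Busy)) * z ^ n) sums f z" if "norm z < rad2" for z
    using sums_drop_first[OF axis2_sums[of z]] that by (simp add: f_def)
  from star_continuation_ball[OF _ this] have "star_continuation (gf2 p) (ball 0 rad2) f"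
    using assms by (simp add: gf2_def)
  hence "continuation (gf2 p) (of_real y) = f (of_real y)"
    using assms by (intro continuation_eq) auto
  hence "pi2 p y = Re ((axis2 (of_real y) - of_real (p (0, 0, Busy))) / of_real y)"
    using assms by (simp add: pi2_def f_def)
  also have "\<dots> = (Re (axis2 (of_real y)) - p (0, 0, Busy)) / y" by (simp add: Re_divide_of_real)
  finally show ?thesis using assms by simp
qed

text \<open>On the kernel \<open>N\<close> is \<open>Mf - Df * w 0 0\<close>. It agrees with
  \<open>Mf\<close> at zeros of \<open>Df\<close>, and dividing by \<open>- h1 = x * Df\<close>
  gives \<open>(axis1 x - w 0 0) / x\<close>, the generating function starting at index 1.\<close>

lemma N_eq:
  assumes "0 < y" "y < rad2" "x \<noteq> 0"
  shows "N P p x y = kern x y * Re (axis2 (of_real y)) + Mre x y - Dre x y * p (0, 0, Busy)"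
proof -
  have k2: "muh2 P / (lam P + mu2 P) = down2 P + down1 P * frac2 P"
    unfolding edge_rate by (simp add: muh2_def)
  define \<xi> where "\<xi> = 1 / x - 1"
  define \<eta> where "\<eta> = 1 / y - 1"
  have "(down2 P + down1 P * frac2 P) * \<eta> * y = (down2 P + down1 P * frac2 P) * (1 - y)"
    using assms(1) by (simp add: \<eta>_def left_diff_distrib)
  hence "h2 P x y = (lam1 P * (x - 1) + lam2 P * (y - 1) + (down2 P + down1 P * frac2 P) * \<eta>) * y"
    unfolding h2_def k2 distrib_right[of _ _ y] by (simp add: lam_def algebra_simps power2_eq_square)
  hence "h2 P x y * pi2 p y = (lam1 P * (x - 1) + lam2 P * (y - 1) + (down2 P + down1 P * frac2 P) * \<eta>) * (y * pi2 p y)"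
    by (simp add: mult.assoc)
  hence "N P p x y = (lam1 P * (x - 1) + lam2 P * (y - 1) + (down2 P + down1 P * frac2 P) * \<eta>) * (Re (axis2 (of_real y)) - p (0, 0, Busy))
      + (lam1 P * (x - 1) + lam2 P * (y - 1)) * p (0, 0, Busy)"
    unfolding N_def pi2_eq[OF assms(1,2)] by (simp add: h0_def lam_def algebra_simps)
  moreover have "kern x y = lam1 P * (x - 1) + lam2 P * (y - 1) + down1 P * \<xi> + down2 P * \<eta>"
    by (simp add: kern_def \<xi>_def \<eta>_def)
  ultimately have n: "N P p x y = (kern x y - down1 P * \<xi> - down2 P * \<eta> + (down2 P + down1 P * frac2 P) * \<eta>) * (Re (axis2 (of_real y)) - p (0, 0, Busy))
      + (kern x y - down1 P * \<xi> - down2 P * \<eta>) * p (0, 0, Busy)" by simp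
  show ?thesis
    unfolding n Mre_def Dre_def \<xi>_def [symmetric] \<eta>_def [symmetric] by (simp add: algebra_simps)
qed

lemma h1_eq:
  assumes "0 < y" "x \<noteq> 0"
  shows "h1 P x y = x * (kern x y - Dre x y)"
proof -
  have k1: "muh1 P / (lam P + mu1 P) = down1 P + down2 P * frac1 P"
    unfolding edge_rate by (simp add: muh1_def)
  have "kern x y - Dre x y = lam1 P * (x - 1) + lam2 P * (y - 1) + (down1 P + down2 P * frac1 P) * (1 / x - 1)"
    by (simp add: kern_def Dre_def algebra_simps add_divide_distrib)
  hence "x * (kern x y - Dre x y) = x * (lam1 P * (x - 1) + lam2 P * (y - 1)) + (down1 P + down2 P * frac1 P) * (x * (1 / x - 1))"
    by (simp only: distrib_left mult_ac)
  also have "x * (1 / x - 1) = 1 - x" using assms by (simp add: right_diff_distrib)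
  finally show ?thesis
    unfolding h1_def b1_def k1 by (simp add: lam_def algebra_simps power2_eq_square)
qed

lemma MDre_rad: "Mre br3 rad = Mr" "Dre br3 rad = Dr"
  by (simp_all add: Mre_def Mr_def Dre_def Dr_def)

lemma Y0_br3: "Y0 P br3 = rad"
proof -
  have "bplus P br3 = 0" by (simp add: bplus_eq)
  hence D: "Delta P br3 = 0" and b: "- bhat P br3 = 2 * br3 * (alpha P * gm)"
    by (simp_all add: Delta_def bplus_def sqrt_hats)
  have "2 * br3 * (alpha P * gm) / (2 * lamh2 P * br3) = gm / lam2 P"
    using br_bounds lam_alpha(2) by (simp add: hats)
  also have "\<dots> = rad" using gm_rad(3) params_pos by (simp add: field_simps)
  finally show ?thesis unfolding Y0_def Yminus_def Yplus_def D b by simp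
qed

section \<open>The three types of tail\<close>

lemma type1:
  assumes "condition1 P"
  shows "(\<lambda>m. p (m, 0, Busy) / (C1 P p * (1 / xplus P) ^ (m - 1))) \<longlonglongrightarrow> 1"
proof -
  have c: "xp < br3" "Yxp < rad" using condition1D[OF assms] by auto
  define y where "y = Yxp"
  \<comment> \<open>The large root of the kernel at \<open>xp\<close>, from the product of the
    roots; \<open>sqrt (Delta P xp)\<close> below is a multiple of \<open>y1 - y\<close>.\<close>
  define y1 where "y1 = down2 P / (lam2 P * y)"
  have y: "1 < y" "y < rad" "kern xp y = 0" using Yxp c by (auto simp: y_def)
  have x: "1 < xp" by (rule xpm)
  have z: "1 / y = zet xp" by (simp add: y_def Yxp_def)
  have y1: "lam2 P * y1 = down2 P / y" "down2 P = lam2 P * (y * y1)" using y params_pos by (auto simp: y1_def)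
  have "y * y < rad * rad" using y by (intro mult_strict_mono) auto
  hence "y * y < down2 P / lam2 P" using gm_rad(5) by (simp add: power2_eq_square)
  also have "\<dots> = y * y1" using y by (simp add: y1_def)
  finally have lt: "y < y1" using y by simp
  have b: "- bhat P xp = alpha P * xp * (lam2 P * (y + y1))"
  proof -
    have "lam1 P * (xp - 1) + lam2 P * (y - 1) + down1 P * (1 / xp - 1) + (lam2 P * y1 - down2 P) = 0"
      using y(3) unfolding y1(1) by (simp add: kern_def algebra_simps)
    hence "(lam1 P * (xp - 1) + lam2 P * (y - 1) + down1 P * (1 / xp - 1) + (lam2 P * y1 - down2 P)) * xp = 0" by simp
    moreover have "down1 P * (1 / xp - 1) * xp = down1 P * (1 - xp)" using x by (simp add: left_diff_distrib)
    ultimately have "lam1 P * (xp - 1) * xp + lam2 P * (y - 1) * xp + down1 P * (1 - xp) + (lam2 P * y1 - down2 P) * xp = 0"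
      by (simp only: distrib_right)
    hence "- (lam1 P * xp ^ 2 - (lam1 P + lam2 P + down1 P + down2 P) * xp + down1 P) = xp * (lam2 P * (y + y1))"
      by (simp add: algebra_simps power2_eq_square)
    thus ?thesis unfolding bhat_eq by (metis mult.assoc mult_minus_right)
  qed
  have "Delta P xp = (- bhat P xp) ^ 2 - 4 * xp ^ 2 * (alpha P * gm) ^ 2"
    unfolding Delta_def bplus_def bminus_def sqrt_hats by (simp add: algebra_simps power2_eq_square)
  also have "(alpha P * gm) ^ 2 = alpha P ^ 2 * (lam2 P * (lam2 P * (y * y1)))"
    unfolding power_mult_distrib gm_rad(6) y1(2) [symmetric] ..
  also have "(- bhat P xp) ^ 2 - 4 * xp ^ 2 * (alpha P ^ 2 * (lam2 P * (lam2 P * (y * y1)))) = (alpha P * xp * (lam2 P * (y1 - y))) ^ 2"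
    unfolding b by (simp add: algebra_simps power2_eq_square)
  finally have sD: "sqrt (Delta P xp) = alpha P * xp * (lam2 P * (y1 - y))"
    using lt lam_alpha(2) x params_pos by simp
  have den: "2 * lamh2 P * xp = alpha P * xp * lam2 P * 2" by (simp add: hats)
  have nz: "alpha P * xp * lam2 P \<noteq> 0" using lam_alpha(2) x params_pos by simp
  have "Yminus P xp = (alpha P * xp * lam2 P * (2 * y)) / (alpha P * xp * lam2 P * 2)"
    unfolding Yminus_def b sD den by (simp add: algebra_simps)
  hence Ym: "Yminus P xp = y" using nz by simp
  have "Yplus P xp = (alpha P * xp * lam2 P * (2 * y1)) / (alpha P * xp * lam2 P * 2)"
    unfolding Yplus_def b sD den by (simp add: algebra_simps)
  hence "Yplus P xp = y1" using nz by simp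
  hence Y0: "Y0 P xp = y" using Ym lt y by (simp add: Y0_def)
  have M: "0 < Mre xp y" unfolding Mre_def using x y z rad2(1) by (intro Mf_pos) auto
  have D0: "Dre xp y = 0"
  proof -
    have "Dre xp y = down2 P * (1 / y - zet xp)" by (simp add: Dre_def zet_def)
    thus ?thesis using z by simp
  qed
  have N: "N P p xp (Y0 P xp) = Mre xp y"
    unfolding Y0 using N_eq[of y xp] y x rad2(1) D0 by simp
  have L: "lam P + mu1 P \<noteq> 0" "0 < lam P + mu1 P" using lam_alpha params_pos by auto
  have t1: "1 - frac1 P = lam P / (lam P + mu1 P)" using L by (simp add: frac1_def field_simps)
  have "C1 P p = (lam P + mu1 P) * (alpha P * xp * (lam2 P * (y1 - y))) * Mre xp y
     / (alpha P * down2 P * lam P * lam1 P * xp * (xp - 1) * (xp - xm))"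
    unfolding C1_def xpm_eq sD N by (simp add: hats)
  also have "\<dots> = (alpha P * xp) * (Mre xp y * (lam2 P * (y1 - y)) * (lam P + mu1 P)) / ((alpha P * xp) * (down2 P * lam P * lam1 P * (xp - 1) * (xp - xm)))"
    by (simp only: mult_ac)
  also have "\<dots> = Mre xp y * (lam2 P * (y1 - y)) * (lam P + mu1 P) / (down2 P * lam P * lam1 P * (xp - 1) * (xp - xm))"
    using lam_alpha(2) x by (subst mult_divide_mult_cancel_left) auto
  finally have C1: "C1 P p = Mre xp y * (lam2 P * (y1 - y)) * (lam P + mu1 P) / (down2 P * lam P * lam1 P * (xp - 1) * (xp - xm))" .
  have C1pos: "0 < C1 P p"
    unfolding C1 using M lt L lam_alpha params_pos walk_rates_pos x xpm by (intro divide_pos_pos mult_pos_pos) auto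
  have T: "Mre xp y * (1 / y - y * lam2 P / down2 P) * xp ^ 2 / ((xp - 1) * (lam1 P * (1 - frac1 P)) * (xp - xm)) = C1 P p * xp ^ 2"
  proof -
    \<comment> \<open>\<open>y * lam2 P / down2 P\<close> is the reciprocal of the large root, so
      the factor from \<open>tail_pole\<close> is the one produced by
      \<open>sqrt (Delta P xp)\<close> in \<open>C1\<close>.\<close>
    have "1 / y - y * lam2 P / down2 P = lam2 P * (y1 - y) / down2 P"
      unfolding right_diff_distrib y1(1) diff_divide_distrib using walk_rates_pos by (simp add: mult.commute)
    thus ?thesis unfolding C1 t1 by (simp add: mult_ac)
  qed
  have "(\<lambda>n. p (n, 0, Busy) * xp ^ Suc n) \<longlonglongrightarrow> C1 P p * xp ^ 2"
    using tail_pole[OF c] T unfolding Mre_def y_def by simp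
  from tendsto_divide[OF this tendsto_const[of xp]] x
  have "(\<lambda>n. p (n, 0, Busy) * xp ^ n) \<longlonglongrightarrow> C1 P p * xp"
    by (simp add: power2_eq_square)
  moreover have "\<forall>\<^sub>F n in sequentially. p (n, 0, Busy) * xp ^ n = p (n, 0, Busy) * xp ^ n * real n powr 0"
    using eventually_gt_at_top[of 0] by eventually_elim simp
  ultimately have "(\<lambda>n. p (n, 0, Busy) * xp ^ n * real n powr 0) \<longlonglongrightarrow> C1 P p * xp"
    by (rule Lim_transform_eventually)
  from tail_ratio[OF this, of "C1 P p" 1]
  have "(\<lambda>m. p (m, 0, Busy) / (C1 P p * real m powr (- 0) * (1 / xp) ^ (m - 1))) \<longlonglongrightarrow> 1"
    using C1pos x by simp
  moreover have "\<forall>\<^sub>F m in sequentially. p (m, 0, Busy) / (C1 P p * real m powr (- 0) * (1 / xp) ^ (m - 1))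
      = p (m, 0, Busy) / (C1 P p * (1 / xplus P) ^ (m - 1))"
    using eventually_gt_at_top[of 0] by eventually_elim (simp add: xpm_eq)
  ultimately show ?thesis by (rule Lim_transform_eventually)
qed

lemma sqrt_product: "sqrt (br3 * (br3 - x1 P) * (br3 - br2) * (x4 P - br3)) = 2 * sqrt 2 * br3 * gm * kap / lam1 P"
proof -
  have "(br3 - x1 P) * (x4 P - br3) = 4 * br3 * gm / lam1 P"
    using x14_product params_pos by (simp add: nonzero_eq_divide_eq mult.commute)
  moreover have "br3 - br2 = 2 * gm * kap ^ 2 / lam1 P"
    using kap_pos(2) gm_rad(1) params_pos by (simp add: field_simps)
  ultimately have "br3 * ((br3 - x1 P) * (x4 P - br3)) * (br3 - br2) = br3 * (4 * br3 * gm / lam1 P) * (2 * gm * kap ^ 2 / lam1 P)"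
    by (simp only:)
  also have "\<dots> = 2 * (2 * br3 * gm * kap / lam1 P) ^ 2"
    by (simp add: power2_eq_square)
  finally have "br3 * (br3 - x1 P) * (br3 - br2) * (x4 P - br3) = 2 * (2 * br3 * gm * kap / lam1 P) ^ 2"
    by (simp add: mult_ac)
  hence "sqrt (br3 * (br3 - x1 P) * (br3 - br2) * (x4 P - br3)) = sqrt 2 * \<bar>2 * br3 * gm * kap / lam1 P\<bar>"
    unfolding real_sqrt_abs [symmetric] real_sqrt_mult [symmetric] by (rule arg_cong)
  also have "\<bar>2 * br3 * gm * kap / lam1 P\<bar> = 2 * br3 * gm * kap / lam1 P"
    using br_bounds gm_rad kap_pos params_pos by (intro abs_of_nonneg) simp
  finally show ?thesis by simp
qed

text \<open>Dropping the term at the origin and dividing by \<open>z\<close> preserves holomorphy on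
  the slit plane and the blow-up of \<open>ext\<close> at \<open>br3\<close>, so
  \<open>dominant_singularity_eqI\<close> applies.\<close>

lemma xdom_eq:
  assumes "xp = br3"
  shows "xdom p = br3"
proof -
  have b3: "1 < br3" by (rule br_bounds)
  define f where "f = (\<lambda>z. if z = 0 then complex_of_real (p (1, 0, Busy)) else (ext z - of_real (p (0, 0, Busy))) / z)"
  have e: "0 < down1 P / lam1 P" using br_bounds(4) by simp
  have s: "(\<lambda>n. complex_of_real (p (n + 1, 0, Busy)) * z ^ n) sums f z" if "norm z < down1 P / lam1 P" for z
    using sums_drop_first[OF ext_sums[OF that]] by (simp add: f_def)
  have hol: "f holomorphic_on slit br3"
  proof -
    have "f holomorphic_on ball 0 (down1 P / lam1 P)" using s by (rule sums_imp_holomorphic)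
    moreover have "f holomorphic_on slit br3 - {0}"
    proof (rule holomorphic_transform)
      show "(\<lambda>z. (ext z - of_real (p (0, 0, Busy))) / z) holomorphic_on slit br3 - {0}"
        using holomorphic_on_subset[OF tail_double_pole(3)[OF assms]] by (intro holomorphic_intros) auto
    qed (auto simp: f_def)
    ultimately have "f holomorphic_on ball 0 (down1 P / lam1 P) \<union> (slit br3 - {0})"
      using open_slit by (intro holomorphic_on_Un) auto
    thus ?thesis by (rule holomorphic_on_subset) (use e in auto)
  qed
  have "star_continuation (gf1 p) (slit br3) f"
    unfolding star_continuation_def gf1_def
    using hol open_slit closed_segment_slit b3 has_fps_expansion_sums[OF e s] by (auto simp: slit_iff)
  moreover have "filterlim (\<lambda>t. norm (f (of_real t))) at_top (at_left br3)"
  proof (rule filterlim_at_top_mono)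
    have "filterlim (\<lambda>t. - p (0, 0, Busy) + norm (ext (of_real t))) at_top (at_left br3)"
      by (rule filterlim_tendsto_add_at_top[OF tendsto_const tail_double_pole(4)[OF assms]])
    thus "filterlim (\<lambda>t. (1 / br3) * (- p (0, 0, Busy) + norm (ext (of_real t)))) at_top (at_left br3)"
      using b3 by (intro filterlim_tendsto_pos_mult_at_top[OF tendsto_const]) auto
    have "\<forall>\<^sub>F t in at_left br3. t \<in> {1<..<br3}" using b3 by (intro eventually_at_leftI[of 1]) auto
    moreover have "\<forall>\<^sub>F t in at_left br3. p (0, 0, Busy) \<le> norm (ext (of_real t))"
      using tail_double_pole(4)[OF assms] by (simp add: filterlim_at_top)
    ultimately show "\<forall>\<^sub>F t in at_left br3. (1 / br3) * (- p (0, 0, Busy) + norm (ext (of_real t))) \<le> norm (f (of_real t))"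
    proof eventually_elim
      case (elim t)
      have "(1 / br3) * (- p (0, 0, Busy) + norm (ext (of_real t))) \<le> (1 / t) * (- p (0, 0, Busy) + norm (ext (of_real t)))"
        using elim b3 by (intro mult_right_mono) (auto simp: frac_le)
      also have "\<dots> \<le> (1 / t) * norm (ext (of_real t) - of_real (p (0, 0, Busy)))"
        using elim norm_triangle_ineq2[of "ext (of_real t)" "of_real (p (0, 0, Busy))"] p_nonneg[of "(0, 0, Busy)"]
        by (intro mult_left_mono) auto
      also have "\<dots> = norm (f (of_real t))" using elim by (simp add: f_def norm_divide)
      finally show ?case .
    qed
  qed
  ultimately have "dominant_singularity (gf1 p) = of_real br3"
    using b3 by (intro dominant_singularity_eqI) auto
  thus ?thesis by (simp add: xdom_def)
qed

lemma type2:
  assumes "condition2 P"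
  shows "(\<lambda>m. p (m, 0, Busy) / (C2 P p / sqrt pi * real m powr (- 1 / 2) * (1 / xdom p) ^ (m - 1))) \<longlonglongrightarrow> 1"
proof -
  have eq: "xp = br3" using condition2D[OF assms] .
  have b3: "1 < br3" and r: "0 < rad" "rad < rad2" using br_bounds gm_rad rad2 by auto
  note T = tail_double_pole[OF eq]
  have z: "1 / rad = zet br3"
  proof -
    have "(1 / (of_real rad * 1) - zet br3) * (1 / of_real rad - zet br3) * (of_real (down2 P) * br3 ^ 2) = (br3 - 1) * Gq br3"
      using kern_br3 b3 by (intro zet_product) auto
    also have "\<dots> = 0" by (simp add: Gq_factor eq)
    finally show ?thesis using b3 walk_rates_pos by simp
  qed
  have "Dr = 0" by (simp add: Dr_zet z)
  hence N: "N P p br3 (Y0 P br3) = Mr"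
    unfolding Y0_br3 using N_eq[of rad br3] r b3 kern_br3 MDre_rad by simp
  have C2: "C2 P p = 2 / lam1 P * (Mr / (2 * sqrt 2 * br3 * gm * kap / lam1 P))"
    unfolding C2_def xdom_eq[OF eq] N x23_eq sqrt_product ..
  have alg: "2 / l * (M / (2 * s * b * c * k / l)) * b = M * y / (s * k * (c * y))"
    if "l \<noteq> 0" "b \<noteq> 0" "c \<noteq> 0" "y \<noteq> 0" for l M s b c k y :: real
    using that by simp
  have d: "gm * rad = down2 P" using gm_rad(4) r by (simp add: field_simps)
  have "C2 P p * br3 = Mr * rad / (sqrt 2 * kap * (gm * rad))"
    unfolding C2 by (rule alg) (use b3 r gm_rad(1) params_pos in auto)
  hence c: "C2 P p * br3 = Mr * rad / (sqrt 2 * kap * down2 P)"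
    by (simp only: d)
  have ne: "Mr * rad / (sqrt 2 * kap * down2 P) / sqrt pi \<noteq> 0"
    using T(2) r kap_pos(1) walk_rates_pos by simp
  have "C2 P p / sqrt pi * br3 ^ 1 = Mr * rad / (sqrt 2 * kap * down2 P) / sqrt pi"
    using c by simp
  from tail_ratio[OF T(1) ne _ this] b3
  show ?thesis by (simp add: xdom_eq[OF eq])
qed

text \<open>The zero of \<open>bplus\<close> at \<open>br3\<close> supplies the factor
  \<open>1 - x / br3\<close> of \<open>Delta\<close>; after cancelling it the expression is
  continuous at \<open>br3\<close>.\<close>

lemma Lim_q: "Lim (at (x3 P)) (q P) = - (sqrt 2 * rad * kap)"
proof (rule tendsto_Lim)
  have b3: "1 < br3" by (rule br_bounds)
  have a: "0 < alpha P" "0 < lam1 P" "0 < lam2 P" using lam_alpha params_pos by auto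
  have "((\<lambda>x. - (1 / (2 * lamh2 P * x)) * sqrt ((alpha P * lam1 P) ^ 2 * (br3 * (x - x1 P) * (x - br2) * (x4 P - x))))
      \<longlongrightarrow> - (1 / (2 * lamh2 P * br3)) * sqrt ((alpha P * lam1 P) ^ 2 * (br3 * (br3 - x1 P) * (br3 - br2) * (x4 P - br3)))) (at br3)"
    using b3 a by (intro tendsto_intros) (auto simp: hats)
  moreover have "\<forall>\<^sub>F x in at br3. - (1 / (2 * lamh2 P * x)) * sqrt ((alpha P * lam1 P) ^ 2 * (br3 * (x - x1 P) * (x - br2) * (x4 P - x))) = q P x"
  proof -
    have "\<forall>\<^sub>F x in at br3. x \<noteq> br3" by (simp add: eventually_at_filter)
    thus ?thesis
    proof eventually_elim
      case (elim x)
      have nz: "1 - x / br3 \<noteq> 0" using elim b3 by (simp add: field_simps)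
      have "(1 - x / br3) * br3 = br3 - x" using b3 by (simp add: left_diff_distrib)
      hence "Delta P x = (alpha P * lam1 P) ^ 2 * (br3 * (x - x1 P) * (x - br2) * (x4 P - x)) * (1 - x / br3)"
      proof -
        assume h: "(1 - x / br3) * br3 = br3 - x"
        have "(alpha P * lam1 P) ^ 2 * (br3 * (x - x1 P) * (x - br2) * (x4 P - x)) * (1 - x / br3)
            = (alpha P * lam1 P) ^ 2 * ((x - x1 P) * (x - br2) * (x4 P - x)) * ((1 - x / br3) * br3)"
          by (simp only: mult_ac)
        thus ?thesis unfolding h Delta_def bplus_eq bminus_x14 by (simp add: algebra_simps power2_eq_square)
      qed
      thus ?case unfolding q_def x23_eq using nz by simp
    qed
  qed
  ultimately have "(q P \<longlongrightarrow> - (1 / (2 * lamh2 P * br3)) * sqrt ((alpha P * lam1 P) ^ 2 * (br3 * (br3 - x1 P) * (br3 - br2) * (x4 P - br3)))) (at br3)"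
    by (rule Lim_transform_eventually)
  moreover have "- (1 / (2 * lamh2 P * br3)) * sqrt ((alpha P * lam1 P) ^ 2 * (br3 * (br3 - x1 P) * (br3 - br2) * (x4 P - br3)))
      = - (sqrt 2 * rad * kap)"
  proof -
    have "sqrt ((alpha P * lam1 P) ^ 2 * (br3 * (br3 - x1 P) * (br3 - br2) * (x4 P - br3)))
       = alpha P * lam1 P * (2 * sqrt 2 * br3 * gm * kap / lam1 P)"
      unfolding real_sqrt_mult[of "(alpha P * lam1 P) ^ 2"] sqrt_product using a by simp
    also have "\<dots> = (2 * (alpha P * lam2 P) * br3) * (sqrt 2 * rad * kap)"
      using a by (simp add: gm_rad(3)[symmetric])
    finally show ?thesis using a b3 by (simp add: hats)
  qed
  ultimately show "(q P \<longlongrightarrow> - (sqrt 2 * rad * kap)) (at (x3 P))" unfolding x23_eq by (simp only:)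
qed simp

text \<open>At \<open>(br3, rad)\<close> the kernel and its \<open>y\<close>-derivative both vanish,
  so to first order \<open>- N / h1\<close> is \<open>(Mre / Dre - p (0, 0, Busy)) / br3\<close>,
  and the constant drops out of the derivative.\<close>

lemma deriv_quotient:
  assumes np: no_pole
  shows "deriv (\<lambda>y. - (N P p br3 y / h1 P br3 y)) rad = Fy / br3"
proof (rule DERIV_imp_deriv)
  have b3: "1 < br3" and r: "0 < rad" "rad < rad2" using br_bounds gm_rad rad2 by auto
  have Dr: "0 < Dr" using np by (rule no_pole_Dr)
  define B where "B = (\<lambda>y. Re (axis2 (of_real y)))"
  define w0 where "w0 = p (0, 0, Busy)"
  have dB: "(B has_real_derivative Re (deriv axis2 (of_real rad))) (at rad)"
    unfolding B_def by (rule axis2_deriv_real) (use r in simp)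
  have i: "((\<lambda>y. 1 / y) has_real_derivative - (1 / rad ^ 2)) (at rad)"
    using DERIV_divide[OF DERIV_const[of 1] DERIV_ident, of rad] r by (simp add: power2_eq_square)
  have "((\<lambda>y. kern br3 y) has_real_derivative 0 + lam2 P * (1 - 0) + 0 + down2 P * (- (1 / rad ^ 2) - 0)) (at rad)"
    unfolding kern_def of_real_eq_id id_def
    by (rule DERIV_add DERIV_diff DERIV_cmult DERIV_const DERIV_ident i)+
  moreover have "down2 P * (1 / rad ^ 2) = lam2 P" using gm_rad(5) params_pos walk_rates_pos by simp
  ultimately have dk: "((\<lambda>y. kern br3 y) has_real_derivative 0) (at rad)" by simp
  have dM: "((\<lambda>y. Mre br3 y) has_real_derivative Mfy) (at rad)"
  proof -
    have "((\<lambda>y. Mre br3 y) has_real_derivative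
       (down1 P * (frac2 P * (- (1 / rad ^ 2) - 0) - 0)) * Re (axis2 (of_real rad)) + Re (deriv axis2 (of_real rad)) * (down1 P * (frac2 P * (1 / rad - 1) - (1 / br3 - 1)))
       - (0 + down1 P * frac2 P * (- (1 / rad ^ 2) - 0)) * w0) (at rad)"
      unfolding Mre_def w0_def
      by (rule DERIV_add DERIV_diff DERIV_mult DERIV_cmult DERIV_cmult_right DERIV_const dB[unfolded B_def] i)+
    thus ?thesis by (simp add: Mfy_def B_def w0_def mult_ac)
  qed
  have dD: "((\<lambda>y. Dre br3 y) has_real_derivative - (down2 P / rad ^ 2)) (at rad)"
  proof -
    have "((\<lambda>y. Dre br3 y) has_real_derivative down2 P * (- (1 / rad ^ 2) - 0 - 0)) (at rad)"
      unfolding Dre_def by (rule DERIV_diff DERIV_cmult DERIV_const i)+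
    thus ?thesis by simp
  qed
  define num where "num = (\<lambda>y. kern br3 y * B y + Mre br3 y - Dre br3 y * w0)"
  define den where "den = (\<lambda>y. br3 * (kern br3 y - Dre br3 y))"
  have dnum: "(num has_real_derivative Mfy + down2 P / rad ^ 2 * w0) (at rad)"
  proof -
    have "(num has_real_derivative 0 * B rad + Re (deriv axis2 (of_real rad)) * kern br3 rad + Mfy - (- (down2 P / rad ^ 2)) * w0) (at rad)"
      unfolding num_def by (rule DERIV_add DERIV_diff DERIV_mult DERIV_cmult_right dk dB dM dD)+
    thus ?thesis by (simp add: kern_br3)
  qed
  have dden: "(den has_real_derivative br3 * (down2 P / rad ^ 2)) (at rad)"
  proof -
    have "(den has_real_derivative br3 * (0 - - (down2 P / rad ^ 2))) (at rad)"
      unfolding den_def by (rule DERIV_diff DERIV_cmult dk dD)+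
    thus ?thesis by simp
  qed
  have v: "num rad = Mr - Dr * w0" "den rad = - (br3 * Dr)" by (simp_all add: num_def den_def kern_br3 MDre_rad)
  have "den rad \<noteq> 0" using v b3 Dr by simp
  from DERIV_minus[OF DERIV_divide[OF dnum dden this]]
  have "((\<lambda>y. - (num y / den y)) has_real_derivative
      - (((Mfy + down2 P / rad ^ 2 * w0) * - (br3 * Dr) - (Mr - Dr * w0) * (br3 * (down2 P / rad ^ 2))) / (- (br3 * Dr) * - (br3 * Dr)))) (at rad)"
    unfolding v .
  also have "- (((Mfy + down2 P / rad ^ 2 * w0) * - (br3 * Dr) - (Mr - Dr * w0) * (br3 * (down2 P / rad ^ 2))) / (- (br3 * Dr) * - (br3 * Dr)))
      = (br3 * (Mfy * Dr + Mr * down2 P / rad ^ 2)) / (br3 * (br3 * Dr ^ 2))"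
  proof -
    define s where "s = down2 P / rad ^ 2"
    have "Mr * down2 P / rad ^ 2 = Mr * s" by (simp add: s_def)
    moreover have "- ((Mfy + s * w0) * - (br3 * Dr) - (Mr - Dr * w0) * (br3 * s)) = br3 * (Mfy * Dr + Mr * s)"
      by (simp add: algebra_simps)
    ultimately show ?thesis
      unfolding s_def [symmetric] minus_divide_left by (simp add: power2_eq_square mult_ac)
  qed
  also have "\<dots> = Fy / br3" using b3 by (simp add: Fy_def)
  finally have d: "((\<lambda>y. - (num y / den y)) has_real_derivative Fy / br3) (at rad)" .
  show "((\<lambda>y. - (N P p br3 y / h1 P br3 y)) has_real_derivative Fy / br3) (at rad)"
  proof (rule has_field_derivative_transform_within_open[OF d, of "{0<..<rad2}"])
    fix y assume "y \<in> {0<..<rad2}"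
    thus "- (num y / den y) = - (N P p br3 y / h1 P br3 y)"
      using N_eq[of y br3] h1_eq[of y br3] b3 by (simp add: num_def den_def B_def w0_def)
  qed (use r in auto)
qed

lemma type3:
  assumes "condition3 P"
  shows "(\<lambda>m. p (m, 0, Busy) / (C3 P p / sqrt pi * real m powr (- 3 / 2) * (1 / x3 P) ^ (m - 2))) \<longlonglongrightarrow> 1"
proof -
  have np: no_pole using condition3D[OF assms] .
  have b3: "1 < br3" and r: "0 < rad" using br_bounds gm_rad by auto
  have C3: "C3 P p = sqrt 2 * rad * kap / (2 * br3) * (Fy / br3)"
    unfolding C3_def unfolding Lim_q unfolding x23_eq Y0_br3 deriv_quotient[OF np] by simp
  \<comment> \<open>Without \<open>Fy_nonzero\<close> only a bound of this order would follow, not a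
    ratio tending to 1.\<close>
  have ne: "sqrt 2 * kap * rad * Fy / (2 * sqrt pi) \<noteq> 0"
    using kap_pos(1) r Fy_nonzero[OF np] by simp
  have "C3 P p / sqrt pi * br3 ^ 2 = sqrt 2 * kap * rad * Fy / (2 * sqrt pi)"
    unfolding C3 using b3 by (simp add: power2_eq_square)
  from tail_ratio[OF tail_no_pole[OF np] ne _ this] b3
  show ?thesis by (simp add: x23_eq)
qed

end

theorem theorem6p2:
  fixes P :: retrial_params and p :: "state \<Rightarrow> real"
  assumes "lam1 P > 0" "lam2 P > 0" "mu P > 0" "mu1 P > 0" "mu2 P > 0"
    and "lam P + mu P + mu1 P + mu2 P = 1"
    and "lam P * (lam1 P + mu1 P) < mu P * mu1 P"
    and "lam P * (lam2 P + mu2 P) < mu P * mu2 P"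
    and "lamh1 P < muh1 P"
    and "stationary_distribution P p"
  shows "(condition1 P \<longrightarrow>
           (\<lambda>m. p (m, 0, Busy) / (C1 P p * (1 / xplus P) ^ (m - 1))) \<longlonglongrightarrow> 1) \<and>
         (condition2 P \<longrightarrow>
           (\<lambda>m. p (m, 0, Busy) /
             (C2 P p / sqrt pi * real m powr (- 1 / 2) * (1 / xdom p) ^ (m - 1))) \<longlonglongrightarrow> 1) \<and>
         (condition3 P \<longrightarrow>
           (\<lambda>m. p (m, 0, Busy) /
             (C3 P p / sqrt pi * real m powr (- 3 / 2) * (1 / x3 P) ^ (m - 2))) \<longlonglongrightarrow> 1)"
proof -
  have "retrial_queue P p"
    using assms by (intro retrial_queue.intro)
  thus ?thesis
    using retrial_queue.type1 retrial_queue.type2 retrial_queue.type3 by blast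
qed

end
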